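(* Let $K$ be any commutative ring. For all integers $n\geq 0$ and $k\geq 0$, the weight-$k$ component $U(K^n)_k$ of the universal enveloping algebra $U(K^n)$ of the abelian alternative $K$-algebra $K^n$ is a free $K$-module, and \[ \mathrm{rank}_K\, U(K^n)_k= \begin{cases} 1 & \text{if } k=0\\ 2n & \text{if } k=1\\ \frac{3n^2-n}{2} & \text{if } k=2\\ 2\binom{n}{k} & \text{if } k\geq 3\,. \end{cases} \]
   Context: $K$ is a commutative ring. A $K$-algebra is a $K$-module $A$ with a $K$-bilinear product $A\times A\to A$, written as juxtaposition (no associativity, commutativity or unit is assumed). It is alternative if $(xx)y=x(xy)$ and $(xy)y=x(yy)$ for all $x,y\in A$. $K^n$ denotes the free $K$-module of rank $n$ regarded as an alternative $K$-algebra with trivial product ($ab=0$ for all $a,b$); such an algebra is called abelian. A Beck module for an alternative algebra $A$ (an abelian group object in the category of alternative $K$-algebras over $A$) amounts to a $K$-module $M$ with $K$-linear maps $A\otimes_K M\to M$ and $M\otimes_K A\to M$ such that $A\oplus M$ with product $(a,x)(b,y)=(ab,ay+xb)$ is alternative. The universal enveloping algebra $U(A)=U_{\mathbf{Alt}}(A)$ is the unital associative $K$-algebra whose right modules are the Beck $A$-modules. Explicitly, $U(A)$ is the quotient of the tensor algebra $\mathrm{Tens}_K(A\oplus A)$ by the two-sided ideal generated by the following relations for all $a,b\in A$, where $l_a$ and $r_a$ denote the images of $a$ from the first and second summand respectively (with $x l_a=ax$ and $x r_a=xa$ for $x$ in a Beck module): \[ r_br_b=r_{bb},\qquad l_al_a=l_{aa},\qquad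 l_{ab}-l_bl_a=r_bl_a-l_ar_b=r_ar_b-r_{ab}. \] For $A=K^n$ with trivial product, all terms $l_{ab},r_{ab},l_{aa},r_{bb}$ vanish, so the relations are homogeneous quadratic, and $U(K^n)$ inherits from the tensor algebra a grading by word length, called weight; $U(K^n)_k$ is the component of weight $k$. *)

theory Defs
  imports "HOL-Algebra.Module" "HOL-Algebra.QuotRing"
begin

text \<open>
  The record type \<^typ>\<open>('k, 'a) module\<close> carries a multiplication, and the locale \<^locale>\<open>module\<close>
  imposes no law on it. Hence it serves here for nonassociative algebras (the field \<open>one\<close> is then
  meaningless) as well as for unital associative algebras.
\<close>

locale nonassoc_algebra = module K A for K (structure) and A (structure) +
  assumes mult_closed: "\<lbrakk>x \<in> carrier A; y \<in> carrier A\<rbrakk> \<Longrightarrow> x \<otimes>\<^bsub>A\<^esub> y \<in> carrier A"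
    and mult_l_distr: "\<lbrakk>x \<in> carrier A; y \<in> carrier A; z \<in> carrier A\<rbrakk>
      \<Longrightarrow> (x \<oplus>\<^bsub>A\<^esub> y) \<otimes>\<^bsub>A\<^esub> z = (x \<otimes>\<^bsub>A\<^esub> z) \<oplus>\<^bsub>A\<^esub> (y \<otimes>\<^bsub>A\<^esub> z)"
    and mult_r_distr: "\<lbrakk>x \<in> carrier A; y \<in> carrier A; z \<in> carrier A\<rbrakk>
      \<Longrightarrow> z \<otimes>\<^bsub>A\<^esub> (x \<oplus>\<^bsub>A\<^esub> y) = (z \<otimes>\<^bsub>A\<^esub> x) \<oplus>\<^bsub>A\<^esub> (z \<otimes>\<^bsub>A\<^esub> y)"
    and mult_smult_l: "\<lbrakk>c \<in> carrier K; x \<in> carrier A; y \<in> carrier A\<rbrakk>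
      \<Longrightarrow> (c \<odot>\<^bsub>A\<^esub> x) \<otimes>\<^bsub>A\<^esub> y = c \<odot>\<^bsub>A\<^esub> (x \<otimes>\<^bsub>A\<^esub> y)"
    and mult_smult_r: "\<lbrakk>c \<in> carrier K; x \<in> carrier A; y \<in> carrier A\<rbrakk>
      \<Longrightarrow> x \<otimes>\<^bsub>A\<^esub> (c \<odot>\<^bsub>A\<^esub> y) = c \<odot>\<^bsub>A\<^esub> (x \<otimes>\<^bsub>A\<^esub> y)"

locale alternative_algebra = nonassoc_algebra +
  assumes left_alternative: "\<lbrakk>x \<in> carrier A; y \<in> carrier A\<rbrakk>
      \<Longrightarrow> (x \<otimes>\<^bsub>A\<^esub> x) \<otimes>\<^bsub>A\<^esub> y = x \<otimes>\<^bsub>A\<^esub> (x \<otimes>\<^bsub>A\<^esub> y)"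
    and right_alternative: "\<lbrakk>x \<in> carrier A; y \<in> carrier A\<rbrakk>
      \<Longrightarrow> (x \<otimes>\<^bsub>A\<^esub> y) \<otimes>\<^bsub>A\<^esub> y = x \<otimes>\<^bsub>A\<^esub> (y \<otimes>\<^bsub>A\<^esub> y)"

definition abelian_algebra :: "('k, 'm) ring_scheme \<Rightarrow> nat \<Rightarrow> ('k, nat \<Rightarrow> 'k) module" where
  "abelian_algebra K n =
    \<lparr>carrier = {..<n} \<rightarrow>\<^sub>E carrier K,
     mult = (\<lambda>x y. \<lambda>i\<in>{..<n}. \<zero>\<^bsub>K\<^esub>),
     one = undefined,
     zero = (\<lambda>i\<in>{..<n}. \<zero>\<^bsub>K\<^esub>),
     add = (\<lambda>x y. \<lambda>i\<in>{..<n}. x i \<oplus>\<^bsub>K\<^esub> y i),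
     smult = (\<lambda>c x. \<lambda>i\<in>{..<n}. c \<otimes>\<^bsub>K\<^esub> x i)\<rparr>"

definition direct_sum :: "('k, 'a) module \<Rightarrow> ('k, 'b) module \<Rightarrow> ('k, 'a \<times> 'b) module" where
  "direct_sum A B =
    \<lparr>carrier = carrier A \<times> carrier B,
     mult = undefined,
     one = undefined,
     zero = (\<zero>\<^bsub>A\<^esub>, \<zero>\<^bsub>B\<^esub>),
     add = (\<lambda>(a, b) (a', b'). (a \<oplus>\<^bsub>A\<^esub> a', b \<oplus>\<^bsub>B\<^esub> b')),
     smult = (\<lambda>c (a, b). (c \<odot>\<^bsub>A\<^esub> a, c \<odot>\<^bsub>B\<^esub> b))\<rparr>"

text \<open>
  The free unital associative \<open>K\<close>-algebra on a set \<open>X\<close>: finitely supported \<open>K\<close>-valued functions on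
  the words over \<open>X\<close>, with the product extending concatenation of words.
\<close>

definition free_algebra :: "('k, 'm) ring_scheme \<Rightarrow> 'x set \<Rightarrow> ('k, 'x list \<Rightarrow> 'k) module" where
  "free_algebra K X =
    \<lparr>carrier = {f. (\<forall>w. f w \<in> carrier K) \<and> finite {w. f w \<noteq> \<zero>\<^bsub>K\<^esub>} \<and> (\<forall>w. w \<notin> lists X \<longrightarrow> f w = \<zero>\<^bsub>K\<^esub>)},
     mult = (\<lambda>f g w. \<Oplus>\<^bsub>K\<^esub>i\<in>{..length w}. f (take i w) \<otimes>\<^bsub>K\<^esub> g (drop i w)),
     one = (\<lambda>w. if w = [] then \<one>\<^bsub>K\<^esub> else \<zero>\<^bsub>K\<^esub>),
     zero = (\<lambda>w. \<zero>\<^bsub>K\<^esub>),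
     add = (\<lambda>f g w. f w \<oplus>\<^bsub>K\<^esub> g w),
     smult = (\<lambda>c f w. c \<otimes>\<^bsub>K\<^esub> f w)\<rparr>"

definition free_gen :: "('k, 'm) ring_scheme \<Rightarrow> 'x \<Rightarrow> 'x list \<Rightarrow> 'k" where
  "free_gen K x = (\<lambda>w. if w = [x] then \<one>\<^bsub>K\<^esub> else \<zero>\<^bsub>K\<^esub>)"

definition quotient_algebra :: "('k, 'a) module \<Rightarrow> 'a set \<Rightarrow> ('k, 'a set) module" where
  "quotient_algebra A I = ring.extend (A Quot I)
    (module.fields (\<lambda>c C. \<Union>x\<in>C. I +>\<^bsub>A\<^esub> (c \<odot>\<^bsub>A\<^esub> x)))"

text \<open>
  The tensor algebra of a module \<open>V\<close>, presented as the free algebra on the elements of \<open>V\<close> modulo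
  linearity of the inclusion of \<open>V\<close>. In word length \<open>k\<close> this imposes exactly multilinearity of
  \<open>(v\<^sub>1, \<dots>, v\<^sub>k) \<mapsto> v\<^sub>1 \<cdots> v\<^sub>k\<close>, so that component is the \<open>k\<close>-fold tensor power of \<open>V\<close>.
\<close>

definition linearity_ideal :: "('k, 'm) ring_scheme \<Rightarrow> ('k, 'v) module \<Rightarrow> ('v list \<Rightarrow> 'k) set" where
  "linearity_ideal K V = (let F = free_algebra K (carrier V); g = free_gen K in
    Idl\<^bsub>F\<^esub>
      ({g (x \<oplus>\<^bsub>V\<^esub> y) \<ominus>\<^bsub>F\<^esub> (g x \<oplus>\<^bsub>F\<^esub> g y) | x y. x \<in> carrier V \<and> y \<in> carrier V} \<union>
       {g (c \<odot>\<^bsub>V\<^esub> x) \<ominus>\<^bsub>F\<^esub> (c \<odot>\<^bsub>F\<^esub> g x) | c x. c \<in> carrier K \<and> x \<in> carrier V}))"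

definition tensor_algebra ::
  "('k, 'm) ring_scheme \<Rightarrow> ('k, 'v) module \<Rightarrow> ('k, ('v list \<Rightarrow> 'k) set) module" where
  "tensor_algebra K V = quotient_algebra (free_algebra K (carrier V)) (linearity_ideal K V)"

definition tensor_incl ::
  "('k, 'm) ring_scheme \<Rightarrow> ('k, 'v) module \<Rightarrow> 'v \<Rightarrow> ('v list \<Rightarrow> 'k) set" where
  "tensor_incl K V v = linearity_ideal K V +>\<^bsub>free_algebra K (carrier V)\<^esub> free_gen K v"

definition tensor_power ::
  "('k, 'm) ring_scheme \<Rightarrow> ('k, 'v) module \<Rightarrow> nat \<Rightarrow> ('v list \<Rightarrow> 'k) set set" where
  "tensor_power K V k = (let F = free_algebra K (carrier V) in
    {linearity_ideal K V +>\<^bsub>F\<^esub> f | f. f \<in> carrier F \<and> (\<forall>w. length w \<noteq> k \<longrightarrow> f w = \<zero>\<^bsub>K\<^esub>)})"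

text \<open>
  The universal enveloping algebra of an alternative algebra. Modules over it are right modules,
  with \<open>x \<cdot> l a = a x\<close> and \<open>x \<cdot> r a = x a\<close>.
\<close>

definition alt_ideal ::
  "('k, 'm) ring_scheme \<Rightarrow> ('k, 'a) module \<Rightarrow> (('a \<times> 'a) list \<Rightarrow> 'k) set set" where
  "alt_ideal K A = (let V = direct_sum A A; T = tensor_algebra K V;
      l = (\<lambda>a. tensor_incl K V (a, \<zero>\<^bsub>A\<^esub>)); r = (\<lambda>a. tensor_incl K V (\<zero>\<^bsub>A\<^esub>, a)) in
    Idl\<^bsub>T\<^esub>
      ({(r b \<otimes>\<^bsub>T\<^esub> r b) \<ominus>\<^bsub>T\<^esub> r (b \<otimes>\<^bsub>A\<^esub> b) | b. b \<in> carrier A} \<union>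
       {(l a \<otimes>\<^bsub>T\<^esub> l a) \<ominus>\<^bsub>T\<^esub> l (a \<otimes>\<^bsub>A\<^esub> a) | a. a \<in> carrier A} \<union>
       {(l (a \<otimes>\<^bsub>A\<^esub> b) \<ominus>\<^bsub>T\<^esub> (l b \<otimes>\<^bsub>T\<^esub> l a)) \<ominus>\<^bsub>T\<^esub> ((r b \<otimes>\<^bsub>T\<^esub> l a) \<ominus>\<^bsub>T\<^esub> (l a \<otimes>\<^bsub>T\<^esub> r b))
         | a b. a \<in> carrier A \<and> b \<in> carrier A} \<union>
       {((r b \<otimes>\<^bsub>T\<^esub> l a) \<ominus>\<^bsub>T\<^esub> (l a \<otimes>\<^bsub>T\<^esub> r b)) \<ominus>\<^bsub>T\<^esub> ((r a \<otimes>\<^bsub>T\<^esub> r b) \<ominus>\<^bsub>T\<^esub> r (a \<otimes>\<^bsub>A\<^esub> b))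
         | a b. a \<in> carrier A \<and> b \<in> carrier A}))"

definition U_Alt ::
  "('k, 'm) ring_scheme \<Rightarrow> ('k, 'a) module \<Rightarrow> ('k, (('a \<times> 'a) list \<Rightarrow> 'k) set set) module" where
  "U_Alt K A = quotient_algebra (tensor_algebra K (direct_sum A A)) (alt_ideal K A)"

text \<open>
  The image of the \<open>k\<close>-th tensor power in \<^term>\<open>U_Alt K A\<close>, as a \<open>K\<close>-module. When \<open>A\<close> has trivial
  product, \<^term>\<open>alt_ideal K A\<close> is homogeneous and these are the weight components of a grading.
\<close>

definition U_Alt_weight :: "('k, 'm) ring_scheme \<Rightarrow> ('k, 'a) module \<Rightarrow> nat
    \<Rightarrow> ('k, (('a \<times> 'a) list \<Rightarrow> 'k) set set) module" where
  "U_Alt_weight K A k = (let V = direct_sum A A in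
    (U_Alt K A)\<lparr>carrier := {alt_ideal K A +>\<^bsub>tensor_algebra K V\<^esub> t | t. t \<in> tensor_power K V k}\<rparr>)"

text \<open>
  Freeness is stated with an indexed basis: over the zero ring, which \<^locale>\<open>cring\<close> admits, a
  basis need not be an injective family.
\<close>

definition is_basis ::
  "('k, 'm) ring_scheme \<Rightarrow> ('k, 'a) module \<Rightarrow> 'i set \<Rightarrow> ('i \<Rightarrow> 'a) \<Rightarrow> bool" where
  "is_basis K M I e \<longleftrightarrow> e \<in> I \<rightarrow> carrier M \<and>
    (\<forall>x\<in>carrier M. \<exists>!c. c \<in> I \<rightarrow>\<^sub>E carrier K \<and> x = (\<Oplus>\<^bsub>M\<^esub>i\<in>I. c i \<odot>\<^bsub>M\<^esub> e i))"

definition free_of_rank :: "('k, 'm) ring_scheme \<Rightarrow> ('k, 'a) module \<Rightarrow> nat \<Rightarrow> bool" where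
  "free_of_rank K M d \<longleftrightarrow> module K M \<and> (\<exists>e. is_basis K M {..<d} e)"

lemma abelian_algebra_alternative:
  assumes "cring K"
  shows "alternative_algebra K (abelian_algebra K n)"
proof -
  interpret K: cring K by fact
  have "abelian_group (abelian_algebra K n)"
  proof (rule abelian_groupI)
    fix x y z
    assume "x \<in> carrier (abelian_algebra K n)" "y \<in> carrier (abelian_algebra K n)"
      "z \<in> carrier (abelian_algebra K n)"
    then show "x \<oplus>\<^bsub>abelian_algebra K n\<^esub> y \<oplus>\<^bsub>abelian_algebra K n\<^esub> z =
        x \<oplus>\<^bsub>abelian_algebra K n\<^esub> (y \<oplus>\<^bsub>abelian_algebra K n\<^esub> z)"
      by (auto simp: abelian_algebra_def PiE_iff fun_eq_iff K.a_assoc)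
  next
    fix x y
    assume "x \<in> carrier (abelian_algebra K n)" "y \<in> carrier (abelian_algebra K n)"
    then show "x \<oplus>\<^bsub>abelian_algebra K n\<^esub> y = y \<oplus>\<^bsub>abelian_algebra K n\<^esub> x"
      by (auto simp: abelian_algebra_def PiE_iff fun_eq_iff intro: K.a_comm)
  next
    fix x assume x: "x \<in> carrier (abelian_algebra K n)"
    show "\<exists>y\<in>carrier (abelian_algebra K n).
        y \<oplus>\<^bsub>abelian_algebra K n\<^esub> x = \<zero>\<^bsub>abelian_algebra K n\<^esub>"
      using x by (intro bexI[of _ "\<lambda>i\<in>{..<n}. \<ominus>\<^bsub>K\<^esub> x i"])
        (auto simp: abelian_algebra_def PiE_iff K.l_neg)
  qed (auto simp: abelian_algebra_def PiE_iff extensional_def fun_eq_iff)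
  then have "module K (abelian_algebra K n)"
  proof (rule moduleI[OF assms])
    fix c x y
    assume "c \<in> carrier K" "x \<in> carrier (abelian_algebra K n)" "y \<in> carrier (abelian_algebra K n)"
    then show "c \<odot>\<^bsub>abelian_algebra K n\<^esub> (x \<oplus>\<^bsub>abelian_algebra K n\<^esub> y) =
        c \<odot>\<^bsub>abelian_algebra K n\<^esub> x \<oplus>\<^bsub>abelian_algebra K n\<^esub> c \<odot>\<^bsub>abelian_algebra K n\<^esub> y"
      by (auto simp: abelian_algebra_def PiE_iff fun_eq_iff intro!: K.r_distr)
  next
    fix c d x
    assume cdx: "c \<in> carrier K" "d \<in> carrier K" "x \<in> carrier (abelian_algebra K n)"
    then show "(c \<oplus>\<^bsub>K\<^esub> d) \<odot>\<^bsub>abelian_algebra K n\<^esub> x =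
        c \<odot>\<^bsub>abelian_algebra K n\<^esub> x \<oplus>\<^bsub>abelian_algebra K n\<^esub> d \<odot>\<^bsub>abelian_algebra K n\<^esub> x"
      by (auto simp: abelian_algebra_def PiE_iff fun_eq_iff intro!: K.l_distr)
    from cdx show "(c \<otimes>\<^bsub>K\<^esub> d) \<odot>\<^bsub>abelian_algebra K n\<^esub> x =
        c \<odot>\<^bsub>abelian_algebra K n\<^esub> (d \<odot>\<^bsub>abelian_algebra K n\<^esub> x)"
      by (auto simp: abelian_algebra_def PiE_iff fun_eq_iff intro!: K.m_assoc)
  qed (auto simp: abelian_algebra_def PiE_iff extensional_def fun_eq_iff)
  then show ?thesis
    by (auto intro!: alternative_algebra.intro nonassoc_algebra.intro
        nonassoc_algebra_axioms.intro alternative_algebra_axioms.intro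
        simp: abelian_algebra_def fun_eq_iff)
qed

end

theory Submission
  imports Defs
begin

text \<open>
  Write \<open>l\<^sub>i\<close> and \<open>r\<^sub>i\<close> for the images in the enveloping algebra \<open>U\<close> of the standard basis vectors of
  the two copies of \<open>K\<^sup>n\<close>. The defining relations say that

  \<^item> \<open>l\<^sub>i l\<^sub>i = 0\<close> and \<open>l\<^sub>i l\<^sub>j = - l\<^sub>j l\<^sub>i\<close>,
  \<^item> \<open>r\<^sub>i r\<^sub>j = l\<^sub>i l\<^sub>j\<close>,
  \<^item> \<open>r\<^sub>j l\<^sub>i = l\<^sub>i r\<^sub>j + l\<^sub>i l\<^sub>j\<close>.

  By the last two, every word is a combination of words \<open>l \<cdots> l\<close> and \<open>l \<cdots> l r\<close>. The former are
  alternating in their indices. Rewriting \<open>r\<^sub>i r\<^sub>j r\<^sub>k\<close> in two ways gives the cyclic identity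
  \<open>l\<^sub>i l\<^sub>j r\<^sub>k = l\<^sub>j l\<^sub>k r\<^sub>i\<close>, so the latter are alternating in all their indices as soon as the
  length is at least 3; in length 2 there is no such relation. Hence \<open>U\<^sub>k\<close> is spanned by the words
  \<open>l \<cdots> l\<close> and \<open>l \<cdots> l r\<close> with strictly increasing indices, except that for \<open>k = 2\<close> all \<open>n\<^sup>2\<close> words
  \<open>l\<^sub>i r\<^sub>j\<close> are needed (lemma \<open>ev_in_lspan_basis_words\<close>). Their number is the claimed rank.

  For linear independence, let \<open>\<omega>\<close> be a primitive cube root of unity and let the exterior algebra of
  \<open>\<int>\<^sup>n\<close>, tensored with \<open>\<int>[\<omega>]\<close>, be twisted so that vectors conjugate the scalars they pass. Then
  \<open>l\<^sub>i \<mapsto> e\<^sub>i\<close>, \<open>r\<^sub>i \<mapsto> e\<^sub>i \<omega>\<close> respects all relations: for example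
  \<open>e\<^sub>i \<omega> e\<^sub>j \<omega> = e\<^sub>i e\<^sub>j \<omega>\<^sup>-\<^sup>1 \<omega> = e\<^sub>i e\<^sub>j\<close>, and the last relation becomes
  \<open>1 + \<omega> + \<omega>\<^sup>2 = 0\<close>. The image of a word is the wedge of its indices times a power of \<open>\<omega>\<close>, and the
  coordinates of this image are integer functionals on words (\<open>top_functional\<close>). With another
  family in place of the coordinates at \<open>\<omega>\<close> in length 2 (\<open>square_functional\<close>), they are dual to the
  spanning words (lemma \<open>dual_functional_basis_words\<close>). Such a functional extends multilinearly to words in arbitrary
  elements of \<open>K\<^sup>n \<oplus> K\<^sup>n\<close>, hence linearly to the free algebra on that set. The extension vanishes on
  the kernel of the projection to \<open>U\<close> (lemma \<open>weight_functional_kernel\<close>), because the elements \<open>f\<close>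
  with \<open>\<phi> (u f v) = 0\<close> for all \<open>u\<close> and \<open>v\<close> form a two-sided ideal, which contains the generating
  relations.
\<close>

section \<open>The free algebra\<close>

text \<open>
  The product of the free algebra, as a function of two coefficient functions. It is defined for all
  functions, finitely supported or not; its laws are proved pointwise by induction on the word, with
  the support playing no role.
\<close>

definition convolution :: "('k, 'm) ring_scheme \<Rightarrow> ('x list \<Rightarrow> 'k) \<Rightarrow> ('x list \<Rightarrow> 'k) \<Rightarrow> 'x list \<Rightarrow> 'k" where
  "convolution K f g w = (\<Oplus>\<^bsub>K\<^esub>i\<in>{..length w}. f (take i w) \<otimes>\<^bsub>K\<^esub> g (drop i w))"

text \<open>
  The basis element of the free algebra given by a single word.
\<close>

definition word :: "('k, 'm) ring_scheme \<Rightarrow> 'x list \<Rightarrow> 'x list \<Rightarrow> 'k" where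
  "word K u = (\<lambda>w. if w = u then \<one>\<^bsub>K\<^esub> else \<zero>\<^bsub>K\<^esub>)"

text \<open>
  Unital associative algebras, not necessarily commutative.
\<close>

locale unital_algebra = nonassoc_algebra K A + A: ring A
  for K :: "('k, 'm) ring_scheme" (structure) and A :: "('k, 'a) module" (structure)

context cring
begin

lemma word_closed [simp]: "word R u w \<in> carrier R"
  by (simp add: word_def)

lemma convolution_Nil:
  assumes "\<And>w. f w \<in> carrier R" "\<And>w. g w \<in> carrier R"
  shows "convolution R f g [] = f [] \<otimes> g []"
  using assms by (simp add: convolution_def)

text \<open>
  This recursion replaces all manipulations of the finite sum in the definition: it is the Leibniz-like
  rule for stripping the first letter.
\<close>

lemma convolution_Cons:
  assumes "\<And>w. f w \<in> carrier R" "\<And>w. g w \<in> carrier R"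
  shows "convolution R f g (x # w) = f [] \<otimes> g (x # w) \<oplus> convolution R (\<lambda>u. f (x # u)) g w"
proof -
  have "convolution R f g (x # w) =
      (\<Oplus>i\<in>{..length w}. f (take (Suc i) (x # w)) \<otimes> g (drop (Suc i) (x # w))) \<oplus> f [] \<otimes> g (x # w)"
    unfolding convolution_def using assms by (simp add: finsum_Suc2 del: finsum_Suc)
  also have "\<dots> = convolution R (\<lambda>u. f (x # u)) g w \<oplus> f [] \<otimes> g (x # w)"
    by (simp add: convolution_def)
  also have "\<dots> = f [] \<otimes> g (x # w) \<oplus> convolution R (\<lambda>u. f (x # u)) g w"
    using assms by (intro a_comm) (auto simp: convolution_def)
  finally show ?thesis .
qed

lemma convolution_closed [simp]:
  assumes "\<And>w. f w \<in> carrier R" "\<And>w. g w \<in> carrier R"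
  shows "convolution R f g w \<in> carrier R"
  using assms by (auto simp: convolution_def)

lemma convolution_add_left:
  assumes "\<And>w. f w \<in> carrier R" "\<And>w. g w \<in> carrier R" "\<And>w. h w \<in> carrier R"
  shows "convolution R (\<lambda>w. f w \<oplus> g w) h w = convolution R f h w \<oplus> convolution R g h w"
  using assms(1,2)
proof (induction w arbitrary: f g)
  case Nil
  then show ?case using assms(3) by (simp add: convolution_Nil l_distr)
next
  case (Cons x w)
  have "convolution R (\<lambda>u. f (x # u) \<oplus> g (x # u)) h w =
      convolution R (\<lambda>u. f (x # u)) h w \<oplus> convolution R (\<lambda>u. g (x # u)) h w"
    using Cons by simp
  then show ?case using Cons.prems assms(3) by (simp add: convolution_Cons l_distr a_ac)
qed

lemma convolution_add_right:
  assumes "\<And>w. f w \<in> carrier R" "\<And>w. g w \<in> carrier R" "\<And>w. h w \<in> carrier R"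
  shows "convolution R h (\<lambda>w. f w \<oplus> g w) w = convolution R h f w \<oplus> convolution R h g w"
  using assms(3)
proof (induction w arbitrary: h)
  case Nil
  then show ?case using assms(1,2) by (simp add: convolution_Nil r_distr)
next
  case (Cons x w)
  have "convolution R (\<lambda>u. h (x # u)) (\<lambda>w. f w \<oplus> g w) w =
      convolution R (\<lambda>u. h (x # u)) f w \<oplus> convolution R (\<lambda>u. h (x # u)) g w"
    using Cons by simp
  then show ?case using Cons.prems assms(1,2) by (simp add: convolution_Cons r_distr a_ac)
qed

lemma convolution_smult_left:
  assumes "c \<in> carrier R" "\<And>w. f w \<in> carrier R" "\<And>w. h w \<in> carrier R"
  shows "convolution R (\<lambda>w. c \<otimes> f w) h w = c \<otimes> convolution R f h w"
  using assms(2)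
proof (induction w arbitrary: f)
  case Nil
  then show ?case using assms(1,3) by (simp add: convolution_Nil m_assoc)
next
  case (Cons x w)
  have "convolution R (\<lambda>u. c \<otimes> f (x # u)) h w = c \<otimes> convolution R (\<lambda>u. f (x # u)) h w"
    using Cons by simp
  then show ?case using Cons.prems assms(1,3) by (simp add: convolution_Cons r_distr m_assoc)
qed

lemma convolution_smult_right:
  assumes "c \<in> carrier R" "\<And>w. f w \<in> carrier R" "\<And>w. h w \<in> carrier R"
  shows "convolution R h (\<lambda>w. c \<otimes> f w) w = c \<otimes> convolution R h f w"
  using assms(3)
proof (induction w arbitrary: h)
  case Nil
  then show ?case using assms(1,2) by (simp add: convolution_Nil m_lcomm)
next
  case (Cons x w)
  have "convolution R (\<lambda>u. h (x # u)) (\<lambda>w. c \<otimes> f w) w = c \<otimes> convolution R (\<lambda>u. h (x # u)) f w"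
    using Cons by simp
  then show ?case using Cons.prems assms(1,2) by (simp add: convolution_Cons r_distr m_lcomm)
qed

lemma convolution_zero_left:
  assumes "\<And>w. g w \<in> carrier R"
  shows "convolution R (\<lambda>w. \<zero>) g w = \<zero>"
  using assms by (induction w) (simp_all add: convolution_Nil convolution_Cons)

lemma convolution_assoc:
  assumes "\<And>w. f w \<in> carrier R" "\<And>w. g w \<in> carrier R" "\<And>w. h w \<in> carrier R"
  shows "convolution R (convolution R f g) h w = convolution R f (convolution R g h) w"
  using assms(1)
proof (induction w arbitrary: f)
  case Nil
  then show ?case using assms(2,3) by (simp add: convolution_Nil m_assoc)
next
  case (Cons x w)
  have "convolution R (\<lambda>u. convolution R f g (x # u)) h w =
      convolution R (\<lambda>u. f [] \<otimes> g (x # u) \<oplus> convolution R (\<lambda>u. f (x # u)) g u) h w"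
    using Cons.prems assms(2,3) by (simp add: convolution_Cons)
  also have "\<dots> = f [] \<otimes> convolution R (\<lambda>u. g (x # u)) h w
      \<oplus> convolution R (convolution R (\<lambda>u. f (x # u)) g) h w"
    using Cons.prems assms(2,3) by (simp add: convolution_add_left convolution_smult_left)
  also have "convolution R (convolution R (\<lambda>u. f (x # u)) g) h w
      = convolution R (\<lambda>u. f (x # u)) (convolution R g h) w"
    using Cons by simp
  finally show ?case using Cons.prems assms(2,3)
    by (simp add: convolution_Cons convolution_Nil r_distr m_assoc a_assoc)
qed

lemma convolution_word_word:
  "convolution R (word R u) (word R v) w = word R (u @ v) w"
proof (induction u arbitrary: w)
  case Nil
  show ?case
  proof (cases w)
    case (Cons x xs)
    have "(\<lambda>u. word R [] (x # u)) = (\<lambda>u. \<zero>)" by (simp add: word_def fun_eq_iff)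
    then show ?thesis by (simp add: Cons convolution_Cons convolution_zero_left) (simp add: word_def)
  qed (simp add: convolution_Nil, simp add: word_def)
next
  case (Cons y u)
  show ?case
  proof (cases w)
    case w: (Cons x xs)
    have "(\<lambda>w. word R (y # u) (x # w)) = (if x = y then word R u else (\<lambda>w. \<zero>))"
      by (auto simp: word_def fun_eq_iff)
    then show ?thesis
      using Cons.IH by (simp add: w convolution_Cons convolution_zero_left) (simp add: word_def)
  qed (simp add: convolution_Nil, simp add: word_def)
qed

lemma convolution_one_right:
  assumes "\<And>w. f w \<in> carrier R"
  shows "convolution R f (word R []) w = f w"
  using assms
proof (induction w arbitrary: f)
  case (Cons x w)
  then show ?case by (simp add: convolution_Cons) (simp add: word_def)
qed (simp add: convolution_Nil word_def)

lemma convolution_one_left: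
  assumes "\<And>w. f w \<in> carrier R"
  shows "convolution R (word R []) f w = f w"
proof (cases w)
  case (Cons x xs)
  have "(\<lambda>u. word R [] (x # u)) = (\<lambda>u. \<zero>)" by (simp add: word_def fun_eq_iff)
  then show ?thesis using assms
    by (simp add: Cons convolution_Cons convolution_zero_left) (simp add: word_def)
qed (use assms in \<open>simp add: convolution_Nil word_def\<close>)

lemma convolution_finite_support:
  assumes "\<And>w. f w \<in> carrier R" "\<And>w. g w \<in> carrier R"
    and "finite {w. f w \<noteq> \<zero>}" "finite {w. g w \<noteq> \<zero>}"
  shows "{w. convolution R f g w \<noteq> \<zero>} \<subseteq> (\<lambda>(u, v). u @ v) ` ({w. f w \<noteq> \<zero>} \<times> {w. g w \<noteq> \<zero>})"
proof
  fix w assume "w \<in> {w. convolution R f g w \<noteq> \<zero>}"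
  then have "convolution R f g w \<noteq> \<zero>" by simp
  then obtain i where "f (take i w) \<otimes> g (drop i w) \<noteq> \<zero>"
    unfolding convolution_def by (metis (no_types, lifting) add.finprod_one_eqI)
  then have "f (take i w) \<noteq> \<zero>" "g (drop i w) \<noteq> \<zero>" using assms by auto
  then show "w \<in> (\<lambda>(u, v). u @ v) ` ({w. f w \<noteq> \<zero>} \<times> {w. g w \<noteq> \<zero>})"
    by (intro image_eqI[of _ _ "(take i w, drop i w)"]) auto
qed

lemma free_algebra_simps:
  "mult (free_algebra R X) = convolution R"
  "one (free_algebra R X) = word R []"
  "zero (free_algebra R X) = (\<lambda>w. \<zero>)"
  "add (free_algebra R X) = (\<lambda>f g w. f w \<oplus> g w)"
  "smult (free_algebra R X) = (\<lambda>c f w. c \<otimes> f w)"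
  by (simp_all add: free_algebra_def convolution_def word_def fun_eq_iff)

lemma free_algebra_carrier_iff:
  "f \<in> carrier (free_algebra R X) \<longleftrightarrow>
    (\<forall>w. f w \<in> carrier R) \<and> finite {w. f w \<noteq> \<zero>} \<and> (\<forall>w. f w \<noteq> \<zero> \<longrightarrow> w \<in> lists X)"
  by (auto simp: free_algebra_def)

lemma free_algebra_unital_algebra: "unital_algebra R (free_algebra R X)"
proof -
  let ?F = "free_algebra R X"
  note iff = free_algebra_carrier_iff
  have add: "(\<lambda>w. f w \<oplus> g w) \<in> carrier ?F" if "f \<in> carrier ?F" "g \<in> carrier ?F" for f g
  proof -
    have "{w. f w \<oplus> g w \<noteq> \<zero>} \<subseteq> {w. f w \<noteq> \<zero>} \<union> {w. g w \<noteq> \<zero>}" by auto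
    then have "finite {w. f w \<oplus> g w \<noteq> \<zero>}" using that by (auto simp: iff intro: finite_subset)
    moreover have "w \<in> lists X" if "f w \<oplus> g w \<noteq> \<zero>" for w
      using that \<open>f \<in> _\<close> \<open>g \<in> _\<close> by (metis iff l_zero zero_closed)
    ultimately show ?thesis using that by (auto simp: iff)
  qed
  have smult: "(\<lambda>w. c \<otimes> f w) \<in> carrier ?F" if "c \<in> carrier R" "f \<in> carrier ?F" for c f
  proof -
    have "{w. c \<otimes> f w \<noteq> \<zero>} \<subseteq> {w. f w \<noteq> \<zero>}" using that by auto
    then have "finite {w. c \<otimes> f w \<noteq> \<zero>}" using that by (auto simp: iff intro: finite_subset)
    moreover have "w \<in> lists X" if "c \<otimes> f w \<noteq> \<zero>" for w
      using that \<open>f \<in> _\<close> \<open>c \<in> _\<close> by (metis iff r_null)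
    ultimately show ?thesis using that by (auto simp: iff)
  qed
  have mult: "convolution R f g \<in> carrier ?F" if "f \<in> carrier ?F" "g \<in> carrier ?F" for f g
  proof -
    have sub: "{w. convolution R f g w \<noteq> \<zero>} \<subseteq> (\<lambda>(u, v). u @ v) ` ({w. f w \<noteq> \<zero>} \<times> {w. g w \<noteq> \<zero>})"
      by (rule convolution_finite_support) (use that in \<open>auto simp: iff\<close>)
    have "w \<in> lists X" if w: "convolution R f g w \<noteq> \<zero>" for w
    proof -
      obtain u v where "w = u @ v" "f u \<noteq> \<zero>" "g v \<noteq> \<zero>" using subsetD[OF sub, of w] w by auto
      then show ?thesis using \<open>f \<in> _\<close> \<open>g \<in> _\<close> by (simp add: iff)
    qed
    moreover have "finite {w. convolution R f g w \<noteq> \<zero>}"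
      by (rule finite_subset[OF sub]) (use that in \<open>auto simp: iff\<close>)
    ultimately show ?thesis using that by (auto simp: iff)
  qed
  have one: "word R [] \<in> carrier ?F" by (auto simp: iff word_def)
  have zero: "(\<lambda>w. \<zero>) \<in> carrier ?F" by (auto simp: iff)
  have val: "f w \<in> carrier R" if "f \<in> carrier ?F" for f w using that by (simp add: iff)
  have ag: "abelian_group ?F"
  proof (rule abelian_groupI)
    fix f assume f: "f \<in> carrier ?F"
    show "\<exists>g\<in>carrier ?F. g \<oplus>\<^bsub>?F\<^esub> f = \<zero>\<^bsub>?F\<^esub>"
      using f smult[of "\<ominus> \<one>" f]
      by (intro bexI[of _ "\<lambda>w. \<ominus> \<one> \<otimes> f w"])
        (auto simp: free_algebra_simps val l_minus l_neg)
  qed (auto simp: free_algebra_simps add zero val a_ac)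
  have mod: "module R ?F"
  proof (rule moduleI[OF cring_axioms ag])
  qed (auto simp: free_algebra_simps smult val l_distr r_distr m_assoc)
  have rg: "ring ?F"
  proof (rule ringI[OF ag])
    show "monoid ?F"
    proof (rule monoidI)
    qed (auto simp: free_algebra_simps mult one val fun_eq_iff
        convolution_assoc convolution_one_left convolution_one_right)
  qed (auto simp: free_algebra_simps val fun_eq_iff convolution_add_left convolution_add_right)
  show ?thesis
    by (intro unital_algebra.intro nonassoc_algebra.intro nonassoc_algebra_axioms.intro mod rg)
      (auto simp: free_algebra_simps mult val fun_eq_iff convolution_add_left convolution_add_right
        convolution_smult_left convolution_smult_right)
qed

end

section \<open>Quotients and homomorphisms of algebras\<close>

context unital_algebra
begin

lemma quotient_algebra_simps:
  "carrier (quotient_algebra A I) = a_rcosets\<^bsub>A\<^esub> I"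
  "mult (quotient_algebra A I) = rcoset_mult A I"
  "one (quotient_algebra A I) = I +>\<^bsub>A\<^esub> \<one>\<^bsub>A\<^esub>"
  "zero (quotient_algebra A I) = I"
  "add (quotient_algebra A I) = set_add A"
  "smult (quotient_algebra A I) = (\<lambda>c C. \<Union>x\<in>C. I +>\<^bsub>A\<^esub> (c \<odot>\<^bsub>A\<^esub> x))"
  by (simp_all add: quotient_algebra_def FactRing_def ring.defs module.defs)

lemma ideal_smult_closed:
  assumes "ideal I A" "c \<in> carrier K" "x \<in> I"
  shows "c \<odot>\<^bsub>A\<^esub> x \<in> I"
proof -
  interpret I: ideal I A by fact
  have x: "x \<in> carrier A" using assms(3) by simp
  \<comment> \<open>The unit makes every two-sided ideal closed under scalars.\<close>
  have "(c \<odot>\<^bsub>A\<^esub> \<one>\<^bsub>A\<^esub>) \<otimes>\<^bsub>A\<^esub> x = c \<odot>\<^bsub>A\<^esub> x"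
    using assms x by (simp add: mult_smult_l)
  then show ?thesis using assms I.I_l_closed[OF assms(3), of "c \<odot>\<^bsub>A\<^esub> \<one>\<^bsub>A\<^esub>"] by simp
qed

lemma smult_coset:
  assumes "ideal I A" "c \<in> carrier K" "x \<in> carrier A"
  shows "c \<odot>\<^bsub>quotient_algebra A I\<^esub> (I +>\<^bsub>A\<^esub> x) = I +>\<^bsub>A\<^esub> (c \<odot>\<^bsub>A\<^esub> x)"
proof -
  interpret I: ideal I A by fact
  have "I +>\<^bsub>A\<^esub> (c \<odot>\<^bsub>A\<^esub> y) = I +>\<^bsub>A\<^esub> (c \<odot>\<^bsub>A\<^esub> x)" if y: "y \<in> I +>\<^bsub>A\<^esub> x" for y
  proof -
    obtain h where h: "h \<in> I" "y = h \<oplus>\<^bsub>A\<^esub> x" using y by (auto simp: a_r_coset_def')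
    then have "c \<odot>\<^bsub>A\<^esub> y \<ominus>\<^bsub>A\<^esub> c \<odot>\<^bsub>A\<^esub> x = c \<odot>\<^bsub>A\<^esub> h"
      using assms by (simp add: smult_r_distr M.minus_eq M.a_assoc M.r_neg)
    then have "c \<odot>\<^bsub>A\<^esub> y \<ominus>\<^bsub>A\<^esub> c \<odot>\<^bsub>A\<^esub> x \<in> I"
      using ideal_smult_closed[OF assms(1,2) h(1)] by simp
    then show ?thesis
      using A.quotient_eq_iff_same_a_r_cos[OF assms(1)] h assms by simp
  qed
  then have "(\<Union>y\<in>I +>\<^bsub>A\<^esub> x. I +>\<^bsub>A\<^esub> (c \<odot>\<^bsub>A\<^esub> y)) = (\<Union>y\<in>I +>\<^bsub>A\<^esub> x. I +>\<^bsub>A\<^esub> (c \<odot>\<^bsub>A\<^esub> x))"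
    by (rule SUP_cong[OF refl])
  also have "\<dots> = I +>\<^bsub>A\<^esub> (c \<odot>\<^bsub>A\<^esub> x)"
    using I.a_rcos_self[OF assms(3)] by blast
  finally show ?thesis unfolding quotient_algebra_simps(6) .
qed

lemma quotient_unital_algebra:
  assumes "ideal I A"
  shows "unital_algebra K (quotient_algebra A I)"
proof -
  interpret I: ideal I A by fact
  let ?Q = "quotient_algebra A I"
  note simps = quotient_algebra_simps(1-5) FactRing_simps I.rcoset_mult_add I.a_rcos_sum
  have carr: "C \<in> carrier ?Q \<longleftrightarrow> (\<exists>x\<in>carrier A. C = I +>\<^bsub>A\<^esub> x)" for C
    by (auto simp: simps)
  have ag: "abelian_group ?Q"
  proof (rule abelian_groupI)
    have zero: "\<zero>\<^bsub>?Q\<^esub> = I +>\<^bsub>A\<^esub> \<zero>\<^bsub>A\<^esub>" by (simp add: simps I.a_subset)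
    fix C assume "C \<in> carrier ?Q"
    then obtain x where x: "x \<in> carrier A" "C = I +>\<^bsub>A\<^esub> x" by (auto simp: carr)
    then show "\<zero>\<^bsub>?Q\<^esub> \<oplus>\<^bsub>?Q\<^esub> C = C" unfolding zero by (simp add: simps)
    show "\<exists>D\<in>carrier ?Q. D \<oplus>\<^bsub>?Q\<^esub> C = \<zero>\<^bsub>?Q\<^esub>"
      unfolding zero using x by (intro bexI[of _ "I +>\<^bsub>A\<^esub> \<ominus>\<^bsub>A\<^esub> x"]) (auto simp: simps M.l_neg)
  next
    show "\<zero>\<^bsub>?Q\<^esub> \<in> carrier ?Q"
      unfolding carr by (rule bexI[of _ "\<zero>\<^bsub>A\<^esub>"]) (simp_all add: simps I.a_subset)
  next
    fix C D E assume "C \<in> carrier ?Q" "D \<in> carrier ?Q" "E \<in> carrier ?Q"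
    then obtain x y z where "x \<in> carrier A" "C = I +>\<^bsub>A\<^esub> x" "y \<in> carrier A" "D = I +>\<^bsub>A\<^esub> y"
      "z \<in> carrier A" "E = I +>\<^bsub>A\<^esub> z" unfolding carr by blast
    then show "C \<oplus>\<^bsub>?Q\<^esub> D \<in> carrier ?Q" "C \<oplus>\<^bsub>?Q\<^esub> D = D \<oplus>\<^bsub>?Q\<^esub> C"
      "C \<oplus>\<^bsub>?Q\<^esub> D \<oplus>\<^bsub>?Q\<^esub> E = C \<oplus>\<^bsub>?Q\<^esub> (D \<oplus>\<^bsub>?Q\<^esub> E)"
      using M.a_comm[of x y] M.a_assoc[of x y z]
      by (auto simp add: quotient_algebra_simps(5) carr I.a_rcos_sum)
  qed
  note ops = smult_coset[OF assms] quotient_algebra_simps(2,5) I.a_rcos_sum I.rcoset_mult_add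
  have one: "\<one>\<^bsub>?Q\<^esub> = I +>\<^bsub>A\<^esub> \<one>\<^bsub>A\<^esub>" by (rule quotient_algebra_simps)
  have mult: "C \<otimes>\<^bsub>?Q\<^esub> D \<in> carrier ?Q" if "C \<in> carrier ?Q" "D \<in> carrier ?Q" for C D
    using that unfolding carr by (metis A.m_closed I.rcoset_mult_add quotient_algebra_simps(2))
  have smult: "c \<odot>\<^bsub>?Q\<^esub> C \<in> carrier ?Q" if "c \<in> carrier K" "C \<in> carrier ?Q" for c C
    using that unfolding carr by (metis smult_closed smult_coset[OF assms])
  have rg: "ring ?Q"
  proof (rule ringI[OF ag])
    show "Group.monoid ?Q"
    proof (rule monoidI)
      fix C D E assume "C \<in> carrier ?Q" "D \<in> carrier ?Q" "E \<in> carrier ?Q"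
      obtain x where x: "x \<in> carrier A" "C = I +>\<^bsub>A\<^esub> x" using \<open>C \<in> carrier ?Q\<close> carr by blast
      obtain y where y: "y \<in> carrier A" "D = I +>\<^bsub>A\<^esub> y" using \<open>D \<in> carrier ?Q\<close> carr by blast
      obtain z where z: "z \<in> carrier A" "E = I +>\<^bsub>A\<^esub> z" using \<open>E \<in> carrier ?Q\<close> carr by blast
      show "C \<otimes>\<^bsub>?Q\<^esub> D \<otimes>\<^bsub>?Q\<^esub> E = C \<otimes>\<^bsub>?Q\<^esub> (D \<otimes>\<^bsub>?Q\<^esub> E)"
        using x(1) y(1) z(1) unfolding x(2) y(2) z(2) by (simp add: ops A.m_assoc)
    next
      fix C assume "C \<in> carrier ?Q"
      obtain x where x: "x \<in> carrier A" "C = I +>\<^bsub>A\<^esub> x" using \<open>C \<in> carrier ?Q\<close> carr by blast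
      show "\<one>\<^bsub>?Q\<^esub> \<otimes>\<^bsub>?Q\<^esub> C = C" "C \<otimes>\<^bsub>?Q\<^esub> \<one>\<^bsub>?Q\<^esub> = C"
        using x(1) unfolding x(2) one by (simp_all add: ops)
    next
      show "\<one>\<^bsub>?Q\<^esub> \<in> carrier ?Q" unfolding carr one by blast
    qed (rule mult)
  next
    fix C D E assume "C \<in> carrier ?Q" "D \<in> carrier ?Q" "E \<in> carrier ?Q"
      obtain x where x: "x \<in> carrier A" "C = I +>\<^bsub>A\<^esub> x" using \<open>C \<in> carrier ?Q\<close> carr by blast
      obtain y where y: "y \<in> carrier A" "D = I +>\<^bsub>A\<^esub> y" using \<open>D \<in> carrier ?Q\<close> carr by blast
      obtain z where z: "z \<in> carrier A" "E = I +>\<^bsub>A\<^esub> z" using \<open>E \<in> carrier ?Q\<close> carr by blast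
    show "(C \<oplus>\<^bsub>?Q\<^esub> D) \<otimes>\<^bsub>?Q\<^esub> E = C \<otimes>\<^bsub>?Q\<^esub> E \<oplus>\<^bsub>?Q\<^esub> D \<otimes>\<^bsub>?Q\<^esub> E"
      "E \<otimes>\<^bsub>?Q\<^esub> (C \<oplus>\<^bsub>?Q\<^esub> D) = E \<otimes>\<^bsub>?Q\<^esub> C \<oplus>\<^bsub>?Q\<^esub> E \<otimes>\<^bsub>?Q\<^esub> D"
      using x(1) y(1) z(1) unfolding x(2) y(2) z(2) by (simp_all add: ops A.l_distr A.r_distr)
  qed
  have mod: "module K ?Q"
  proof (rule moduleI[OF R.cring_axioms ag smult])
    fix c C D assume c: "c \<in> carrier K" and "C \<in> carrier ?Q" "D \<in> carrier ?Q"
      obtain x where x: "x \<in> carrier A" "C = I +>\<^bsub>A\<^esub> x" using \<open>C \<in> carrier ?Q\<close> carr by blast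
      obtain y where y: "y \<in> carrier A" "D = I +>\<^bsub>A\<^esub> y" using \<open>D \<in> carrier ?Q\<close> carr by blast
    show "c \<odot>\<^bsub>?Q\<^esub> (C \<oplus>\<^bsub>?Q\<^esub> D) = c \<odot>\<^bsub>?Q\<^esub> C \<oplus>\<^bsub>?Q\<^esub> c \<odot>\<^bsub>?Q\<^esub> D"
      using c x(1) y(1) unfolding x(2) y(2) by (simp add: ops smult_r_distr)
  next
    fix c d C assume cd: "c \<in> carrier K" "d \<in> carrier K" and "C \<in> carrier ?Q"
      obtain x where x: "x \<in> carrier A" "C = I +>\<^bsub>A\<^esub> x" using \<open>C \<in> carrier ?Q\<close> carr by blast
    show "(c \<oplus>\<^bsub>K\<^esub> d) \<odot>\<^bsub>?Q\<^esub> C = c \<odot>\<^bsub>?Q\<^esub> C \<oplus>\<^bsub>?Q\<^esub> d \<odot>\<^bsub>?Q\<^esub> C"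
      "(c \<otimes>\<^bsub>K\<^esub> d) \<odot>\<^bsub>?Q\<^esub> C = c \<odot>\<^bsub>?Q\<^esub> (d \<odot>\<^bsub>?Q\<^esub> C)"
      using cd x(1) unfolding x(2) by (simp_all add: ops smult_l_distr smult_assoc1)
  next
    fix C assume "C \<in> carrier ?Q"
      obtain x where x: "x \<in> carrier A" "C = I +>\<^bsub>A\<^esub> x" using \<open>C \<in> carrier ?Q\<close> carr by blast
    show "\<one>\<^bsub>K\<^esub> \<odot>\<^bsub>?Q\<^esub> C = C"
      using x(1) unfolding x(2) by (simp add: ops)
  qed
  interpret Q: ring ?Q by (rule rg)
  show ?thesis
  proof (intro unital_algebra.intro nonassoc_algebra.intro nonassoc_algebra_axioms.intro mod rg)
    fix c C D assume c: "c \<in> carrier K" and "C \<in> carrier ?Q" "D \<in> carrier ?Q"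
      obtain x where x: "x \<in> carrier A" "C = I +>\<^bsub>A\<^esub> x" using \<open>C \<in> carrier ?Q\<close> carr by blast
      obtain y where y: "y \<in> carrier A" "D = I +>\<^bsub>A\<^esub> y" using \<open>D \<in> carrier ?Q\<close> carr by blast
    show "(c \<odot>\<^bsub>?Q\<^esub> C) \<otimes>\<^bsub>?Q\<^esub> D = c \<odot>\<^bsub>?Q\<^esub> (C \<otimes>\<^bsub>?Q\<^esub> D)"
      "C \<otimes>\<^bsub>?Q\<^esub> (c \<odot>\<^bsub>?Q\<^esub> D) = c \<odot>\<^bsub>?Q\<^esub> (C \<otimes>\<^bsub>?Q\<^esub> D)"
      using c x(1) y(1) unfolding x(2) y(2) by (simp_all add: ops mult_smult_l mult_smult_r)
  qed (simp_all add: Q.l_distr Q.r_distr)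
qed

end

text \<open>
  Homomorphisms of unital associative algebras over the same ring of scalars.
\<close>

locale unital_algebra_hom = A: unital_algebra K A + B: unital_algebra K B
  for K :: "('k, 'm) ring_scheme" (structure) and A :: "('k, 'a) module" (structure)
    and B :: "('k, 'b) module" (structure) and h +
  assumes hom_closed [simp]: "x \<in> carrier A \<Longrightarrow> h x \<in> carrier B"
    and hom_add [simp]: "\<lbrakk>x \<in> carrier A; y \<in> carrier A\<rbrakk> \<Longrightarrow> h (x \<oplus>\<^bsub>A\<^esub> y) = h x \<oplus>\<^bsub>B\<^esub> h y"
    and hom_mult [simp]: "\<lbrakk>x \<in> carrier A; y \<in> carrier A\<rbrakk> \<Longrightarrow> h (x \<otimes>\<^bsub>A\<^esub> y) = h x \<otimes>\<^bsub>B\<^esub> h y"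
    and hom_one [simp]: "h \<one>\<^bsub>A\<^esub> = \<one>\<^bsub>B\<^esub>"
    and hom_smult [simp]: "\<lbrakk>c \<in> carrier K; x \<in> carrier A\<rbrakk> \<Longrightarrow> h (c \<odot>\<^bsub>A\<^esub> x) = c \<odot>\<^bsub>B\<^esub> h x"
begin

lemma hom_zero [simp]: "h \<zero>\<^bsub>A\<^esub> = \<zero>\<^bsub>B\<^esub>"
proof -
  have "h (\<zero>\<^bsub>K\<^esub> \<odot>\<^bsub>A\<^esub> \<zero>\<^bsub>A\<^esub>) = \<zero>\<^bsub>K\<^esub> \<odot>\<^bsub>B\<^esub> h \<zero>\<^bsub>A\<^esub>" by (rule hom_smult) auto
  then show ?thesis by simp
qed

lemma hom_uminus [simp]:
  assumes "x \<in> carrier A"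
  shows "h (\<ominus>\<^bsub>A\<^esub> x) = \<ominus>\<^bsub>B\<^esub> h x"
proof -
  have "h (\<ominus>\<^bsub>A\<^esub> x) \<oplus>\<^bsub>B\<^esub> h x = \<zero>\<^bsub>B\<^esub>"
    using hom_add[of "\<ominus>\<^bsub>A\<^esub> x" x] assms by (simp add: A.M.l_neg)
  then show ?thesis using assms B.M.minus_equality[of "h (\<ominus>\<^bsub>A\<^esub> x)" "h x"] by simp
qed

lemma hom_minus [simp]:
  "\<lbrakk>x \<in> carrier A; y \<in> carrier A\<rbrakk> \<Longrightarrow> h (x \<ominus>\<^bsub>A\<^esub> y) = h x \<ominus>\<^bsub>B\<^esub> h y"
  by (simp add: a_minus_def)

end

lemma (in unital_algebra) quotient_hom_surj:
  "(\<lambda>x. I +>\<^bsub>A\<^esub> x) ` carrier A = carrier (quotient_algebra A I)"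
  unfolding quotient_algebra_simps(1) A_RCOSETS_def' by blast

lemma (in unital_algebra) quotient_hom:
  assumes "ideal I A"
  shows "unital_algebra_hom K A (quotient_algebra A I) (\<lambda>x. I +>\<^bsub>A\<^esub> x)"
proof -
  interpret I: ideal I A by fact
  show ?thesis
  proof (intro unital_algebra_hom.intro unital_algebra_hom_axioms.intro
        unital_algebra_axioms quotient_unital_algebra assms)
    show "I +>\<^bsub>A\<^esub> x \<in> carrier (quotient_algebra A I)" if "x \<in> carrier A" for x
      using that unfolding quotient_hom_surj[symmetric] by blast
  qed (simp_all add: smult_coset[OF assms] quotient_algebra_simps(2,3,5) I.a_rcos_sum
        I.rcoset_mult_add)
qed

lemma unital_algebra_hom_comp:
  assumes "unital_algebra_hom K A B g" "unital_algebra_hom K B C h"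
  shows "unital_algebra_hom K A C (\<lambda>x. h (g x))"
proof -
  interpret g: unital_algebra_hom K A B g by fact
  interpret h: unital_algebra_hom K B C h by fact
  show ?thesis by unfold_locales auto
qed

lemma (in unital_algebra_hom) image_ideal:
  assumes "ideal N A" "h ` carrier A = carrier B"
  shows "ideal (h ` N) B"
proof -
  interpret N: ideal N A by fact
  show ?thesis
  proof (rule idealI)
    show "ring B" by (rule B.A.ring_axioms)
    show "subgroup (h ` N) (add_monoid B)"
    proof
      show "h ` N \<subseteq> carrier (add_monoid B)" by auto
      show "x \<otimes>\<^bsub>add_monoid B\<^esub> y \<in> h ` N" if xy: "x \<in> h ` N" "y \<in> h ` N" for x y
      proof -
      obtain a b where "a \<in> N" "b \<in> N" "x = h a" "y = h b" using xy by auto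
        then show ?thesis by (intro image_eqI[of _ _ "a \<oplus>\<^bsub>A\<^esub> b"]) auto
      qed
      show "\<one>\<^bsub>add_monoid B\<^esub> \<in> h ` N"
        using N.zero_closed by (intro image_eqI[of _ _ "\<zero>\<^bsub>A\<^esub>"]) auto
      show "inv\<^bsub>add_monoid B\<^esub> x \<in> h ` N" if x: "x \<in> h ` N" for x
      proof -
      obtain a where "a \<in> N" "x = h a" using x by auto
        then show ?thesis
          by (intro image_eqI[of _ _ "\<ominus>\<^bsub>A\<^esub> a"]) (auto simp: a_inv_def[symmetric])
      qed
    qed
    fix y x assume y: "y \<in> h ` N" and x: "x \<in> carrier B"
    obtain a b where ab: "a \<in> N" "b \<in> carrier A" "y = h a" "x = h b"
      using y x assms(2) by (metis image_iff)
    show "x \<otimes>\<^bsub>B\<^esub> y \<in> h ` N"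
      by (rule image_eqI[of _ _ "b \<otimes>\<^bsub>A\<^esub> a"]) (use ab in \<open>auto simp: N.I_l_closed\<close>)
    show "y \<otimes>\<^bsub>B\<^esub> x \<in> h ` N"
      by (rule image_eqI[of _ _ "a \<otimes>\<^bsub>A\<^esub> b"]) (use ab in \<open>auto simp: N.I_r_closed\<close>)
  qed
qed

text \<open>
  The enveloping algebra is a quotient of a quotient. An ideal of the bottom algebra that contains the
  first relations, and representatives of the second ones, contains the kernel of the composite
  projection.
\<close>

lemma (in unital_algebra) iterated_quotient_kernel:
  assumes N: "ideal N A" "S \<subseteq> N" "I = Idl\<^bsub>A\<^esub> S"
    and J: "J = Idl\<^bsub>quotient_algebra A I\<^esub> S'" "S' \<subseteq> (\<lambda>x. I +>\<^bsub>A\<^esub> x) ` N"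
    and f: "f \<in> carrier A" "J +>\<^bsub>quotient_algebra A I\<^esub> (I +>\<^bsub>A\<^esub> f) = J"
  shows "f \<in> N"
proof -
  interpret N: ideal N A by fact
  have I: "ideal I A" unfolding N(3) using N(2) by (intro A.genideal_ideal) auto
  have IN: "I \<subseteq> N" unfolding N(3) by (rule A.genideal_minimal) (use N in auto)
  interpret q: unital_algebra_hom K A "quotient_algebra A I" "\<lambda>x. I +>\<^bsub>A\<^esub> x"
    by (rule quotient_hom[OF I])
  have N': "ideal ((\<lambda>x. I +>\<^bsub>A\<^esub> x) ` N) (quotient_algebra A I)"
    by (rule q.image_ideal[OF N(1)]) (rule quotient_hom_surj)
  have JN: "J \<subseteq> (\<lambda>x. I +>\<^bsub>A\<^esub> x) ` N"
    unfolding J(1) by (rule q.B.A.genideal_minimal) (use N' J in auto)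
  have "ideal J (quotient_algebra A I)"
    unfolding J(1) by (rule q.B.A.genideal_ideal) (use J(2) in force)
  then interpret J: ideal J "quotient_algebra A I" .
  have "I +>\<^bsub>A\<^esub> f \<in> J" using J.a_rcos_self[of "I +>\<^bsub>A\<^esub> f"] f by simp
  then obtain g where g: "g \<in> N" "I +>\<^bsub>A\<^esub> f = I +>\<^bsub>A\<^esub> g" using JN by auto
  then have "f \<ominus>\<^bsub>A\<^esub> g \<in> N" using A.quotient_eq_iff_same_a_r_cos[OF I f(1), of g] IN by auto
  then have "(f \<ominus>\<^bsub>A\<^esub> g) \<oplus>\<^bsub>A\<^esub> g \<in> N" using g by auto
  then show ?thesis using f g by (simp add: M.minus_eq M.a_assoc M.l_neg)
qed

section \<open>Spans and functionals on the free algebra\<close>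

text \<open>
  The linear span of a set. The inductive form avoids finite sums in closure proofs; the
  passage to coefficient families is lemma \<open>lspan_image_finsum\<close>.
\<close>

inductive_set lspan :: "('k, 'm) ring_scheme \<Rightarrow> ('k, 'a, 'z) module_scheme \<Rightarrow> 'a set \<Rightarrow> 'a set"
  for K M S where
  lspan_zero: "\<zero>\<^bsub>M\<^esub> \<in> lspan K M S"
| lspan_step: "\<lbrakk>c \<in> carrier K; s \<in> S; x \<in> lspan K M S\<rbrakk> \<Longrightarrow> c \<odot>\<^bsub>M\<^esub> s \<oplus>\<^bsub>M\<^esub> x \<in> lspan K M S"

lemma lspan_mono: "x \<in> lspan K M S \<Longrightarrow> S \<subseteq> T \<Longrightarrow> x \<in> lspan K M T"
  by (induction rule: lspan.induct) (auto intro: lspan.intros)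

context module
begin

lemma lspan_carrier: "x \<in> lspan R M S \<Longrightarrow> S \<subseteq> carrier M \<Longrightarrow> x \<in> carrier M"
  by (induction rule: lspan.induct) auto

lemma lspan_base:
  assumes "s \<in> S" "S \<subseteq> carrier M"
  shows "s \<in> lspan R M S"
proof -
  have "\<one> \<odot>\<^bsub>M\<^esub> s \<oplus>\<^bsub>M\<^esub> \<zero>\<^bsub>M\<^esub> \<in> lspan R M S"
    using assms by (intro lspan.intros) auto
  moreover have "s \<in> carrier M" using assms by auto
  ultimately show ?thesis by simp
qed

lemma lspan_add:
  assumes "x \<in> lspan R M S" "y \<in> lspan R M S" "S \<subseteq> carrier M"
  shows "x \<oplus>\<^bsub>M\<^esub> y \<in> lspan R M S"
  using assms(1)
proof induction
  case lspan_zero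
  then show ?case using assms lspan_carrier by simp
next
  case (lspan_step c s x)
  then have "c \<odot>\<^bsub>M\<^esub> s \<oplus>\<^bsub>M\<^esub> (x \<oplus>\<^bsub>M\<^esub> y) \<in> lspan R M S" by (intro lspan.intros)
  moreover have "s \<in> carrier M" "x \<in> carrier M" "y \<in> carrier M"
    using lspan_step assms lspan_carrier by auto
  ultimately show ?case using lspan_step(1) by (simp add: M.a_assoc)
qed

lemma lspan_smult:
  assumes "x \<in> lspan R M S" "a \<in> carrier R" "S \<subseteq> carrier M"
  shows "a \<odot>\<^bsub>M\<^esub> x \<in> lspan R M S"
  using assms(1)
proof induction
  case lspan_zero
  then show ?case using assms lspan.lspan_zero by simp
next
  case (lspan_step c s x)
  then have "(a \<otimes> c) \<odot>\<^bsub>M\<^esub> s \<oplus>\<^bsub>M\<^esub> a \<odot>\<^bsub>M\<^esub> x \<in> lspan R M S"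
    using assms by (intro lspan.intros) auto
  moreover have "s \<in> carrier M" "x \<in> carrier M"
    using lspan_step assms lspan_carrier by auto
  ultimately show ?case using lspan_step(1) assms(2) by (simp add: smult_r_distr smult_assoc1)
qed

lemma lspan_uminus:
  assumes "x \<in> lspan R M S" "S \<subseteq> carrier M"
  shows "\<ominus>\<^bsub>M\<^esub> x \<in> lspan R M S"
proof -
  have "(\<ominus> \<one>) \<odot>\<^bsub>M\<^esub> x \<in> lspan R M S" using assms by (intro lspan_smult) auto
  moreover have "x \<in> carrier M" using assms lspan_carrier by auto
  ultimately show ?thesis by (simp add: smult_l_minus)
qed

lemma lspan_subset:
  assumes "x \<in> lspan R M T" "T \<subseteq> lspan R M S" "S \<subseteq> carrier M"
  shows "x \<in> lspan R M S"
  using assms(1)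
  by induction (use assms in \<open>auto intro!: lspan_add lspan_smult intro: lspan.lspan_zero\<close>)

lemma lspan_image_finsum:
  assumes "x \<in> lspan R M (e ` I)" "finite I" "e \<in> I \<rightarrow> carrier M"
  shows "\<exists>c \<in> I \<rightarrow> carrier R. x = (\<Oplus>\<^bsub>M\<^esub>i\<in>I. c i \<odot>\<^bsub>M\<^esub> e i)"
  using assms(1)
proof induction
  case lspan_zero
  have "(\<Oplus>\<^bsub>M\<^esub>i\<in>I. \<zero> \<odot>\<^bsub>M\<^esub> e i) = \<zero>\<^bsub>M\<^esub>"
    by (rule M.add.finprod_one_eqI) (use assms(3) in \<open>auto simp: Pi_iff\<close>)
  then show ?case by (intro bexI[of _ "\<lambda>i. \<zero>"]) auto
next
  case (lspan_step a s x)
  then obtain c j where c: "c \<in> I \<rightarrow> carrier R" "x = (\<Oplus>\<^bsub>M\<^esub>i\<in>I. c i \<odot>\<^bsub>M\<^esub> e i)"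
    and j: "j \<in> I" "s = e j" by auto
  have e: "e i \<in> carrier M" if "i \<in> I" for i using that assms(3) by auto
  have "a \<odot>\<^bsub>M\<^esub> s = (\<Oplus>\<^bsub>M\<^esub>i\<in>I. if j = i then a \<odot>\<^bsub>M\<^esub> e i else \<zero>\<^bsub>M\<^esub>)"
    using M.finsum_singleton[OF j(1) assms(2), of "\<lambda>i. a \<odot>\<^bsub>M\<^esub> e i"] lspan_step(1) e j(2) by auto
  then have "a \<odot>\<^bsub>M\<^esub> s \<oplus>\<^bsub>M\<^esub> x =
      (\<Oplus>\<^bsub>M\<^esub>i\<in>I. (if j = i then a \<odot>\<^bsub>M\<^esub> e i else \<zero>\<^bsub>M\<^esub>) \<oplus>\<^bsub>M\<^esub> c i \<odot>\<^bsub>M\<^esub> e i)"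
    unfolding c(2) using lspan_step(1) e c(1) by (subst M.finsum_addf) (auto simp: Pi_iff)
  also have "\<dots> = (\<Oplus>\<^bsub>M\<^esub>i\<in>I. (if i = j then a \<oplus> c i else c i) \<odot>\<^bsub>M\<^esub> e i)"
    using lspan_step(1) e c(1) by (intro M.finsum_cong') (auto simp: Pi_iff smult_l_distr)
  finally show ?case
    using lspan_step(1) c(1) by (intro bexI[of _ "\<lambda>i. if i = j then a \<oplus> c i else c i"]) (auto simp: Pi_iff)
qed

end

lemma (in unital_algebra) lspan_mult:
  assumes "x \<in> lspan K A S" "y \<in> lspan K A T" "S \<subseteq> carrier A" "T \<subseteq> carrier A"
  shows "x \<otimes>\<^bsub>A\<^esub> y \<in> lspan K A {s \<otimes>\<^bsub>A\<^esub> t | s t. s \<in> S \<and> t \<in> T}" (is "_ \<in> lspan K A ?P")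
  using assms(1)
proof induction
  case lspan_zero
  then show ?case using assms lspan_carrier lspan.lspan_zero by simp
next
  case (lspan_step c s x)
  have P: "?P \<subseteq> carrier A" using assms by auto
  have s: "s \<in> carrier A" and x: "x \<in> carrier A" and y: "y \<in> carrier A"
    using lspan_step assms lspan_carrier by auto
  have "s \<otimes>\<^bsub>A\<^esub> y \<in> lspan K A ?P"
    using assms(2)
  proof induction
    case lspan_zero
    then show ?case using s lspan.lspan_zero by simp
  next
    case (lspan_step d t y)
    then have "d \<odot>\<^bsub>A\<^esub> (s \<otimes>\<^bsub>A\<^esub> t) \<oplus>\<^bsub>A\<^esub> s \<otimes>\<^bsub>A\<^esub> y \<in> lspan K A ?P"
      using \<open>s \<in> S\<close> by (intro lspan.lspan_step) auto
    moreover have "t \<in> carrier A" "y \<in> carrier A"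
      using lspan_step assms lspan_carrier by auto
    ultimately show ?case using s lspan_step(1) by (simp add: A.r_distr mult_smult_r)
  qed
  then have "c \<odot>\<^bsub>A\<^esub> (s \<otimes>\<^bsub>A\<^esub> y) \<oplus>\<^bsub>A\<^esub> x \<otimes>\<^bsub>A\<^esub> y \<in> lspan K A ?P"
    using lspan_step P by (intro lspan_add lspan_smult) auto
  then show ?case using s x y lspan_step(1) by (simp add: A.l_distr mult_smult_l)
qed

text \<open>
  The linear functional on the free algebra that takes the value \<open>p w\<close> at each word \<open>w\<close>.
\<close>

definition word_functional :: "('k, 'm) ring_scheme \<Rightarrow> ('x list \<Rightarrow> 'k) \<Rightarrow> ('x list \<Rightarrow> 'k) \<Rightarrow> 'k" where
  "word_functional K p f = (\<Oplus>\<^bsub>K\<^esub>w\<in>{w. f w \<noteq> \<zero>\<^bsub>K\<^esub>}. f w \<otimes>\<^bsub>K\<^esub> p w)"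

text \<open>
  The largest two-sided ideal in the kernel of the functional given by \<open>p\<close>.
\<close>

definition annihilator_ideal ::
  "('k, 'm) ring_scheme \<Rightarrow> 'x set \<Rightarrow> ('x list \<Rightarrow> 'k) \<Rightarrow> ('x list \<Rightarrow> 'k) set" where
  "annihilator_ideal K X p = (let F = free_algebra K X in
    {f \<in> carrier F. \<forall>u\<in>carrier F. \<forall>v\<in>carrier F. word_functional K p (u \<otimes>\<^bsub>F\<^esub> f \<otimes>\<^bsub>F\<^esub> v) = \<zero>\<^bsub>K\<^esub>})"

context cring
begin

lemma word_in_free_algebra: "w \<in> lists X \<Longrightarrow> word R w \<in> carrier (free_algebra R X)"
  by (auto simp: free_algebra_carrier_iff word_def)

lemma word_mult: "word R u \<otimes>\<^bsub>free_algebra R X\<^esub> word R v = word R (u @ v)"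
  by (simp add: free_algebra_simps convolution_word_word fun_eq_iff)

lemma free_algebra_lspan_words:
  assumes "finite W" "\<And>w. f w \<noteq> \<zero> \<Longrightarrow> w \<in> W" "\<And>w. f w \<in> carrier R"
  shows "f \<in> lspan R (free_algebra R X) (word R ` W)"
  using assms
proof (induction W arbitrary: f rule: finite_induct)
  case empty
  then have "f = \<zero>\<^bsub>free_algebra R X\<^esub>" by (auto simp: free_algebra_simps)
  then show ?case using lspan.lspan_zero by metis
next
  case (insert w W)
  have "(f(w := \<zero>)) \<in> lspan R (free_algebra R X) (word R ` W)"
    using insert by (intro insert.IH) (auto split: if_splits)
  then have "f(w := \<zero>) \<in> lspan R (free_algebra R X) (word R ` insert w W)"
    by (rule lspan_mono) auto
  then have "f w \<odot>\<^bsub>free_algebra R X\<^esub> word R w \<oplus>\<^bsub>free_algebra R X\<^esub> f(w := \<zero>)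
      \<in> lspan R (free_algebra R X) (word R ` insert w W)"
    using insert by (intro lspan.lspan_step) auto
  moreover have "f w \<odot>\<^bsub>free_algebra R X\<^esub> word R w \<oplus>\<^bsub>free_algebra R X\<^esub> f(w := \<zero>) = f"
    using insert(5) by (auto simp: free_algebra_simps word_def fun_eq_iff)
  ultimately show ?case by simp
qed

lemma free_algebra_lspan:
  assumes "f \<in> carrier (free_algebra R X)"
  shows "f \<in> lspan R (free_algebra R X) (word R ` {w. f w \<noteq> \<zero>})"
  using assms by (intro free_algebra_lspan_words) (auto simp: free_algebra_carrier_iff)

lemma word_functional_superset:
  assumes "f \<in> carrier (free_algebra R X)" "\<And>w. p w \<in> carrier R"
    and "finite W" "{w. f w \<noteq> \<zero>} \<subseteq> W"
  shows "word_functional R p f = (\<Oplus>w\<in>W. f w \<otimes> p w)"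
  unfolding word_functional_def
  by (rule add.finprod_mono_neutral_cong_left)
    (use assms in \<open>auto simp: free_algebra_carrier_iff\<close>)

lemma word_functional_closed [simp]:
  assumes "f \<in> carrier (free_algebra R X)" "\<And>w. p w \<in> carrier R"
  shows "word_functional R p f \<in> carrier R"
  unfolding word_functional_def
  by (rule finsum_closed) (use assms in \<open>auto simp: free_algebra_carrier_iff\<close>)

lemma word_functional_add:
  assumes "f \<in> carrier (free_algebra R X)" "g \<in> carrier (free_algebra R X)"
    and p: "\<And>w. p w \<in> carrier R"
  shows "word_functional R p (f \<oplus>\<^bsub>free_algebra R X\<^esub> g) = word_functional R p f \<oplus> word_functional R p g"
proof -
  interpret F: unital_algebra R "free_algebra R X" by (rule free_algebra_unital_algebra)
  let ?W = "{w. f w \<noteq> \<zero>} \<union> {w. g w \<noteq> \<zero>}"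
  have W: "finite ?W" using assms by (auto simp: free_algebra_carrier_iff)
  have fg: "\<And>w. f w \<in> carrier R" "\<And>w. g w \<in> carrier R"
    using assms by (auto simp: free_algebra_carrier_iff)
  have "word_functional R p (f \<oplus>\<^bsub>free_algebra R X\<^esub> g) =
      (\<Oplus>w\<in>?W. (f \<oplus>\<^bsub>free_algebra R X\<^esub> g) w \<otimes> p w)"
    by (rule word_functional_superset[OF F.M.a_closed[OF assms(1,2)] p W])
      (auto simp: free_algebra_simps)
  also have "\<dots> = (\<Oplus>w\<in>?W. f w \<otimes> p w \<oplus> g w \<otimes> p w)"
    by (intro finsum_cong') (auto simp: free_algebra_simps fg p l_distr)
  also have "\<dots> = (\<Oplus>w\<in>?W. f w \<otimes> p w) \<oplus> (\<Oplus>w\<in>?W. g w \<otimes> p w)"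
    by (rule finsum_addf) (auto simp: fg p)
  finally show ?thesis
    using word_functional_superset[OF assms(1) p W] word_functional_superset[OF assms(2) p W]
    by simp
qed

lemma word_functional_smult:
  assumes "f \<in> carrier (free_algebra R X)" "c \<in> carrier R" and p: "\<And>w. p w \<in> carrier R"
  shows "word_functional R p (c \<odot>\<^bsub>free_algebra R X\<^esub> f) = c \<otimes> word_functional R p f"
proof -
  interpret F: unital_algebra R "free_algebra R X" by (rule free_algebra_unital_algebra)
  let ?W = "{w. f w \<noteq> \<zero>}"
  have W: "finite ?W" using assms by (auto simp: free_algebra_carrier_iff)
  have f: "\<And>w. f w \<in> carrier R" using assms by (auto simp: free_algebra_carrier_iff)
  have "word_functional R p (c \<odot>\<^bsub>free_algebra R X\<^esub> f) =
      (\<Oplus>w\<in>?W. (c \<odot>\<^bsub>free_algebra R X\<^esub> f) w \<otimes> p w)"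
    by (rule word_functional_superset[OF F.smult_closed[OF assms(2,1)] p W])
      (use assms in \<open>auto simp: free_algebra_simps\<close>)
  also have "\<dots> = (\<Oplus>w\<in>?W. c \<otimes> (f w \<otimes> p w))"
    by (intro finsum_cong') (auto simp: free_algebra_simps f p assms m_assoc)
  also have "\<dots> = c \<otimes> (\<Oplus>w\<in>?W. f w \<otimes> p w)"
    by (rule finsum_rdistr[symmetric]) (auto simp: f p assms W)
  finally show ?thesis by (simp add: word_functional_def)
qed

lemma word_functional_zero: "word_functional R p \<zero>\<^bsub>free_algebra R X\<^esub> = \<zero>"
  by (simp add: word_functional_def free_algebra_simps)

lemma word_functional_uminus:
  assumes "f \<in> carrier (free_algebra R X)" and p: "\<And>w. p w \<in> carrier R"
  shows "word_functional R p (\<ominus>\<^bsub>free_algebra R X\<^esub> f) = \<ominus> word_functional R p f"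
proof -
  interpret F: unital_algebra R "free_algebra R X" by (rule free_algebra_unital_algebra)
  have "word_functional R p ((\<ominus> \<one>) \<odot>\<^bsub>free_algebra R X\<^esub> f) = (\<ominus> \<one>) \<otimes> word_functional R p f"
    by (rule word_functional_smult) (use assms in auto)
  then show ?thesis using assms word_functional_closed[OF assms] by (simp add: F.smult_l_minus l_minus)
qed

lemma word_functional_minus:
  assumes "f \<in> carrier (free_algebra R X)" "g \<in> carrier (free_algebra R X)"
    and p: "\<And>w. p w \<in> carrier R"
  shows "word_functional R p (f \<ominus>\<^bsub>free_algebra R X\<^esub> g) = word_functional R p f \<ominus> word_functional R p g"
proof -
  interpret F: unital_algebra R "free_algebra R X" by (rule free_algebra_unital_algebra)
  show ?thesis using assms
    by (simp add: a_minus_def word_functional_add word_functional_uminus)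
qed

lemma word_functional_word:
  assumes "w \<in> lists X" and p: "\<And>w. p w \<in> carrier R"
  shows "word_functional R p (word R w) = p w"
proof -
  have "word_functional R p (word R w) = (\<Oplus>v\<in>{w}. word R w v \<otimes> p v)"
    by (rule word_functional_superset[OF word_in_free_algebra[OF assms(1)] p])
      (auto simp: word_def)
  then show ?thesis using p by (simp add: finsum_insert) (simp add: word_def)
qed

lemma annihilator_ideal_subset: "annihilator_ideal R X p \<subseteq> carrier (free_algebra R X)"
  by (auto simp: annihilator_ideal_def Let_def)

lemma annihilator_ideal_ideal:
  assumes p: "\<And>w. p w \<in> carrier R"
  shows "ideal (annihilator_ideal R X p) (free_algebra R X)"
proof -
  interpret F: unital_algebra R "free_algebra R X" by (rule free_algebra_unital_algebra)
  let ?F = "free_algebra R X" and ?N = "annihilator_ideal R X p"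
  note N = annihilator_ideal_def Let_def mem_Collect_eq
  show ?thesis
  proof (rule idealI)
    show "ring ?F" by (rule F.A.ring_axioms)
    show "subgroup ?N (add_monoid ?F)"
    proof (rule F.M.add.subgroupI)
      show "?N \<subseteq> carrier ?F" by (rule annihilator_ideal_subset)
      have "\<zero>\<^bsub>?F\<^esub> \<in> ?N"
        unfolding N by (simp add: word_functional_zero)
      then show "?N \<noteq> {}" by blast
    next
      fix f assume "f \<in> ?N"
      then show "\<ominus>\<^bsub>?F\<^esub> f \<in> ?N"
        unfolding N by (simp add: F.A.l_minus F.A.r_minus word_functional_uminus p)
    next
      fix f g assume "f \<in> ?N" "g \<in> ?N"
      then show "f \<oplus>\<^bsub>?F\<^esub> g \<in> ?N"
        unfolding N by (simp add: F.A.l_distr F.A.r_distr word_functional_add p)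
    qed
  next
    fix f g assume f: "f \<in> ?N" and g: "g \<in> carrier ?F"
    have fF: "f \<in> carrier ?F" using f annihilator_ideal_subset by blast
    have z: "word_functional R p (u \<otimes>\<^bsub>?F\<^esub> f \<otimes>\<^bsub>?F\<^esub> v) = \<zero>"
      if "u \<in> carrier ?F" "v \<in> carrier ?F" for u v
      using f that unfolding N by blast
    have "word_functional R p (u \<otimes>\<^bsub>?F\<^esub> (g \<otimes>\<^bsub>?F\<^esub> f) \<otimes>\<^bsub>?F\<^esub> v) = \<zero>"
      if "u \<in> carrier ?F" "v \<in> carrier ?F" for u v
      using z[of "u \<otimes>\<^bsub>?F\<^esub> g" v] that fF g by (simp add: F.A.m_assoc)
    then show "g \<otimes>\<^bsub>?F\<^esub> f \<in> ?N" unfolding N using fF g by simp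
    have "word_functional R p (u \<otimes>\<^bsub>?F\<^esub> (f \<otimes>\<^bsub>?F\<^esub> g) \<otimes>\<^bsub>?F\<^esub> v) = \<zero>"
      if "u \<in> carrier ?F" "v \<in> carrier ?F" for u v
      using z[of u "g \<otimes>\<^bsub>?F\<^esub> v"] that fF g by (simp add: F.A.m_assoc)
    then show "f \<otimes>\<^bsub>?F\<^esub> g \<in> ?N" unfolding N using fF g by simp
  qed
qed

text \<open>
  By linearity, membership in this ideal need only be tested with words on both sides.
\<close>

lemma annihilator_idealI:
  assumes p: "\<And>w. p w \<in> carrier R" and f: "f \<in> carrier (free_algebra R X)"
    and z: "\<And>u v. \<lbrakk>u \<in> lists X; v \<in> lists X\<rbrakk> \<Longrightarrow> word_functional R p
      (word R u \<otimes>\<^bsub>free_algebra R X\<^esub> f \<otimes>\<^bsub>free_algebra R X\<^esub> word R v) = \<zero>"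
  shows "f \<in> annihilator_ideal R X p"
proof -
  interpret F: unital_algebra R "free_algebra R X" by (rule free_algebra_unital_algebra)
  let ?F = "free_algebra R X" and ?W = "word R ` lists X"
  have W: "?W \<subseteq> carrier ?F" by (intro image_subsetI word_in_free_algebra)
  have span: "g \<in> lspan R ?F ?W" if "g \<in> carrier ?F" for g
    using free_algebra_lspan[OF that] by (rule lspan_mono) (use that in \<open>auto simp: free_algebra_carrier_iff\<close>)
  have 1: "word_functional R p (word R u \<otimes>\<^bsub>?F\<^esub> f \<otimes>\<^bsub>?F\<^esub> v) = \<zero>"
    if u: "u \<in> lists X" and "v \<in> lspan R ?F ?W" for u v
    using that(2)
  proof induction
    case lspan_zero
    then show ?case using f word_in_free_algebra[OF u] by (simp add: word_functional_zero)
  next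
    case (lspan_step c s v)
    have *: "s \<in> carrier ?F" "v \<in> carrier ?F" "word R u \<in> carrier ?F"
      using lspan_step F.lspan_carrier[OF _ W] W word_in_free_algebra[OF u] by auto
    have "word_functional R p (word R u \<otimes>\<^bsub>?F\<^esub> f \<otimes>\<^bsub>?F\<^esub> s) = \<zero>"
      using lspan_step(2) z u by auto
    then show ?case using * f lspan_step p
      by (simp add: F.A.r_distr F.mult_smult_r word_functional_add word_functional_smult)
  qed
  have 2: "word_functional R p (u \<otimes>\<^bsub>?F\<^esub> f \<otimes>\<^bsub>?F\<^esub> v) = \<zero>"
    if v: "v \<in> carrier ?F" and "u \<in> lspan R ?F ?W" for u v
    using that(2)
  proof induction
    case lspan_zero
    then show ?case using f v by (simp add: word_functional_zero)
  next
    case (lspan_step c s u)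
    have *: "s \<in> carrier ?F" "u \<in> carrier ?F"
      using lspan_step F.lspan_carrier[OF _ W] W by auto
    have "word_functional R p (s \<otimes>\<^bsub>?F\<^esub> f \<otimes>\<^bsub>?F\<^esub> v) = \<zero>"
      using lspan_step(2) 1 span[OF v] by auto
    then show ?case using * f v lspan_step p
      by (simp add: F.A.l_distr F.mult_smult_l word_functional_add word_functional_smult)
  qed
  show ?thesis unfolding annihilator_ideal_def Let_def using f 2 span by blast
qed

lemma annihilator_idealD:
  assumes "f \<in> annihilator_ideal R X p"
  shows "word_functional R p f = \<zero>"
proof -
  interpret F: unital_algebra R "free_algebra R X" by (rule free_algebra_unital_algebra)
  have "f \<in> carrier (free_algebra R X)" using assms annihilator_ideal_subset by blast
  moreover have "word_functional R p (\<one>\<^bsub>free_algebra R X\<^esub> \<otimes>\<^bsub>free_algebra R X\<^esub> f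
      \<otimes>\<^bsub>free_algebra R X\<^esub> \<one>\<^bsub>free_algebra R X\<^esub>) = \<zero>"
    using assms unfolding annihilator_ideal_def Let_def by blast
  ultimately show ?thesis by simp
qed

end

lemma (in unital_algebra_hom) hom_lspan:
  assumes "x \<in> lspan K A S" "S \<subseteq> carrier A"
  shows "h x \<in> lspan K B (h ` S)"
  using assms(1)
proof induction
  case lspan_zero
  then show ?case by (simp add: lspan.lspan_zero)
next
  case (lspan_step c s x)
  have "s \<in> carrier A" "x \<in> carrier A" using lspan_step assms(2) A.lspan_carrier by auto
  then have "h (c \<odot>\<^bsub>A\<^esub> s \<oplus>\<^bsub>A\<^esub> x) = c \<odot>\<^bsub>B\<^esub> h s \<oplus>\<^bsub>B\<^esub> h x" using lspan_step(1) by simp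
  then show ?case using lspan_step by (simp add: lspan.lspan_step)
qed

lemma (in unital_algebra_hom) hom_finsum:
  assumes "f \<in> I \<rightarrow> carrier A"
  shows "h (\<Oplus>\<^bsub>A\<^esub>i\<in>I. f i) = (\<Oplus>\<^bsub>B\<^esub>i\<in>I. h (f i))"
  using assms
proof (induction I rule: infinite_finite_induct)
  case (insert i I)
  then show ?case
    by (subst A.M.finsum_insert, simp, simp, simp, simp, subst B.M.finsum_insert)
      (auto simp: Pi_iff A.M.finsum_closed)
qed simp_all

text \<open>
  A finite sum is taken in a structure, carrier included; shrinking the carrier to that of a submodule does
  not change it.
\<close>

lemma finsum_carrier_update:
  assumes "abelian_monoid G" "abelian_monoid (G\<lparr>carrier := C\<rparr>)" "C \<subseteq> carrier G" "f \<in> I \<rightarrow> C"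
  shows "finsum (G\<lparr>carrier := C\<rparr>) f I = finsum G f I"
proof -
  interpret G: abelian_monoid G by fact
  interpret C: abelian_monoid "G\<lparr>carrier := C\<rparr>" by fact
  show ?thesis
    using assms(4)
  proof (induction I rule: infinite_finite_induct)
    case (insert i I)
    then have fC: "f \<in> I \<rightarrow> C" "f i \<in> C" by auto
    then have fG: "f \<in> I \<rightarrow> carrier G" "f i \<in> carrier G" using assms(3) by auto
    have "finsum (G\<lparr>carrier := C\<rparr>) f (insert i I) = f i \<oplus>\<^bsub>G\<^esub> finsum (G\<lparr>carrier := C\<rparr>) f I"
      using C.finsum_insert[of I i f] insert(1,2) fC by simp
    also have "\<dots> = finsum G f (insert i I)"
      using G.finsum_insert[of I i f] insert fC(1) fG by simp
    finally show ?case .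
  qed (simp_all add: G.finsum_infinite C.finsum_infinite)
qed

context cring
begin

lemma word_functional_finsum:
  assumes "f \<in> I \<rightarrow> carrier (free_algebra R X)" and p: "\<And>w. p w \<in> carrier R"
  shows "word_functional R p (\<Oplus>\<^bsub>free_algebra R X\<^esub>i\<in>I. f i) = (\<Oplus>i\<in>I. word_functional R p (f i))"
proof -
  interpret F: unital_algebra R "free_algebra R X" by (rule free_algebra_unital_algebra)
  show ?thesis using assms(1)
  proof (induction I rule: infinite_finite_induct)
    case (insert i I)
    then have f: "f i \<in> carrier (free_algebra R X)" "f \<in> I \<rightarrow> carrier (free_algebra R X)" by auto
    have wf: "word_functional R p (f j) \<in> carrier R" if "f j \<in> carrier (free_algebra R X)" for j
      using that p by (rule word_functional_closed)
    have wfI: "(\<lambda>i. word_functional R p (f i)) \<in> I \<rightarrow> carrier R" using f(2) wf by auto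
    show ?case
      using insert f p F.M.finsum_closed[OF f(2)] wf[OF f(1)] finsum_insert[OF insert(1,2) wfI]
      by (simp add: F.M.finsum_insert word_functional_add)
  qed (simp_all add: word_functional_zero)
qed

end

section \<open>Basis words and their dual functionals\<close>

text \<open>
  The sign of the permutation that sorts a list, and 0 if the list has a repeated entry: the
  coefficient of the increasing monomial in the wedge product of the listed basis vectors.
\<close>

fun sort_sign :: "nat list \<Rightarrow> int" where
  "sort_sign [] = 1"
| "sort_sign (x # xs) = (\<Prod>y\<leftarrow>xs. sgn (int y - int x)) * sort_sign xs"

lemma sort_sign_swap: "sort_sign (us @ [i, j] @ vs) = - sort_sign (us @ [j, i] @ vs)"
proof (induction us)
  case Nil
  have "sgn (int j - int i) = - sgn (int i - int j)" by (simp add: sgn_if)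
  then show ?case by (simp add: algebra_simps)
qed (simp add: algebra_simps)

lemma sort_sign_repeat: "sort_sign (us @ [i, i] @ vs) = 0"
  by (induction us) auto

lemma sort_sign_sorted: "sorted_wrt (<) xs \<Longrightarrow> sort_sign xs = 1"
proof (induction xs)
  case (Cons x xs)
  have "map (\<lambda>y. sgn (int y - int x)) xs = replicate (length xs) 1"
    using Cons.prems by (intro replicate_eqI) auto
  then show ?case using Cons by simp
qed simp

text \<open>
  Words in the generators are lists of pairs; \<open>(False, i)\<close> stands for \<open>l\<^sub>i\<close> and \<open>(True, i)\<close> for
  \<open>r\<^sub>i\<close>. The twist of a word is the exponent of \<open>\<omega>\<close> in its image in the twisted exterior algebra: each
  \<open>r\<close> contributes 1, with a sign change for every letter to its right.
\<close>

fun twist :: "(bool \<times> nat) list \<Rightarrow> int" where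
  "twist [] = 0"
| "twist (x # w) = (if fst x then (- 1) ^ length w else 0) + twist w"

lemma twist_append: "twist (u @ v) = (- 1) ^ length v * twist u + twist v"
  by (induction u) (auto simp: power_add algebra_simps)

text \<open>
  The coordinate of a word at the increasing monomial on \<open>S\<close>, where \<open>c\<close> sends an exponent of \<open>\<omega>\<close> to the
  chosen coordinate of that power. Words whose length is not the cardinality of \<open>S\<close> get the value 0,
  either because their index set is not \<open>S\<close> or because an index is repeated.
\<close>

definition top_functional :: "(int \<Rightarrow> int) \<Rightarrow> nat set \<Rightarrow> (bool \<times> nat) list \<Rightarrow> int" where
  "top_functional c S w =
    (if set (map snd w) = S then sort_sign (map snd w) * c (twist w) else 0)"

text \<open>
  In length 2 the letters \<open>l\<^sub>i\<close> and \<open>r\<^sub>j\<close> commute up to terms \<open>l l\<close>, so the coefficient of the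
  unordered pair formed by \<open>l\<^sub>i\<close> and \<open>r\<^sub>j\<close> is well defined.
\<close>

definition square_functional :: "nat \<Rightarrow> nat \<Rightarrow> (bool \<times> nat) list \<Rightarrow> int" where
  "square_functional i j w =
    (if w = [(False, i), (True, j)] \<or> w = [(True, j), (False, i)] then 1 else 0)"

text \<open>
  Compatibility of an integer function on words with the relations at an arbitrary position. The
  vanishing on repeated letters is a separate clause, as it does not follow from antisymmetry once 2
  is a zero divisor in the ring of scalars.
\<close>

definition respects_relations :: "((bool \<times> nat) list \<Rightarrow> int) \<Rightarrow> bool" where
  "respects_relations \<chi> \<longleftrightarrow> (\<forall>u v i j.
    \<chi> (u @ [(False, i), (False, i)] @ v) = 0 \<and>
    \<chi> (u @ [(False, i), (False, j)] @ v) = - \<chi> (u @ [(False, j), (False, i)] @ v) \<and>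
    \<chi> (u @ [(True, i), (True, j)] @ v) = \<chi> (u @ [(False, i), (False, j)] @ v) \<and>
    \<chi> (u @ [(True, j), (False, i)] @ v) =
      \<chi> (u @ [(False, i), (True, j)] @ v) + \<chi> (u @ [(False, i), (False, j)] @ v))"

text \<open>
  The assumption on \<open>c\<close> expresses \<open>\<omega>\<^sup>-\<^sup>1 + 1 + \<omega> = 0\<close>.
\<close>

lemma respects_relations_top_functional:
  assumes c: "\<And>e. c (e - 1) + c e + c (e + 1) = 0"
  shows "respects_relations (top_functional c S)"
  unfolding respects_relations_def
proof (intro allI conjI)
  fix u v :: "(bool \<times> nat) list" and i j
  let ?e = "twist u" and ?s = "(- 1 :: int) ^ length v"
  have tw: "twist (u @ [x, y] @ v) = ?s * (?e + (if fst y then 1 else 0) - (if fst x then 1 else 0)) + twist v"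
    for x y by (simp add: twist_append algebra_simps)
  have s: "?s = 1 \<or> ?s = - 1" by (cases "even (length v)") auto
  note sg = sort_sign_swap[of "map snd u" i j "map snd v", simplified]
    sort_sign_repeat[of "map snd u" i "map snd v", simplified]
  show "top_functional c S (u @ [(False, i), (False, i)] @ v) = 0"
    by (simp add: top_functional_def sg)
  show "top_functional c S (u @ [(False, i), (False, j)] @ v) =
      - top_functional c S (u @ [(False, j), (False, i)] @ v)"
    unfolding top_functional_def tw by (simp add: sg insert_commute)
  show "top_functional c S (u @ [(True, i), (True, j)] @ v) =
      top_functional c S (u @ [(False, i), (False, j)] @ v)"
    unfolding top_functional_def tw by simp
  show "top_functional c S (u @ [(True, j), (False, i)] @ v) =
      top_functional c S (u @ [(False, i), (True, j)] @ v) +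
      top_functional c S (u @ [(False, i), (False, j)] @ v)"
  proof (cases "insert i (insert j (snd ` (set u \<union> set v))) = S")
    case True
    let ?t = "?s * ?e + twist v"
    have ij: "(set (map snd (u @ [(s, i), (t, j)] @ v)) = S) = True"
      and ji: "(set (map snd (u @ [(s, j), (t, i)] @ v)) = S) = True" for s t
      unfolding True[symmetric] by auto
    have "c (?t - 1) + c ?t + c (?t + 1) = 0" by (rule c)
    moreover have "c (?s * (?e - 1) + twist v) + c (?s * (?e + 1) + twist v) = c (?t - 1) + c (?t + 1)"
      using s by (auto simp: algebra_simps)
    ultimately have "c (?s * (?e - 1) + twist v) = - c (?s * (?e + 1) + twist v) - c ?t" by simp
    moreover have "top_functional c S (u @ [(True, j), (False, i)] @ v) =
        - sort_sign (map snd u @ [i, j] @ map snd v) * c (?s * (?e - 1) + twist v)"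
      "top_functional c S (u @ [(False, i), (True, j)] @ v) =
        sort_sign (map snd u @ [i, j] @ map snd v) * c (?s * (?e + 1) + twist v)"
      "top_functional c S (u @ [(False, i), (False, j)] @ v) =
        sort_sign (map snd u @ [i, j] @ map snd v) * c ?t"
      using sort_sign_swap[of "map snd u" i j "map snd v"]
      unfolding top_functional_def tw ij ji if_True by simp_all
    ultimately show ?thesis by (simp only:) (simp only: algebra_simps)
  next
    case False
    then show ?thesis unfolding top_functional_def by (auto simp: insert_commute image_Un)
  qed
qed

lemma respects_relations_square_functional: "respects_relations (square_functional i j)"
proof -
  have *: "u @ [x, y] @ v = [a, b] \<longleftrightarrow> u = [] \<and> v = [] \<and> x = a \<and> y = b"
    for u v :: "(bool \<times> nat) list" and x y a b
    by (cases u; cases "tl u") (auto simp: append_eq_Cons_conv)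
  show ?thesis unfolding respects_relations_def square_functional_def * by auto
qed

text \<open>
  The coordinates of the powers of \<open>\<omega>\<close> in the basis \<open>1, \<omega>\<close>; note \<open>\<omega>\<^sup>2 = - 1 - \<omega>\<close>.
\<close>

definition one_coeff :: "int \<Rightarrow> int" where
  "one_coeff e = (if e mod 3 = 0 then 1 else if e mod 3 = 2 then - 1 else 0)"

definition omega_coeff :: "int \<Rightarrow> int" where
  "omega_coeff e = (if e mod 3 = 1 then 1 else if e mod 3 = 2 then - 1 else 0)"

lemma one_coeff_sum: "one_coeff (e - 1) + one_coeff e + one_coeff (e + 1) = 0"
proof -
  have "e mod 3 = 0 \<and> (e - 1) mod 3 = 2 \<and> (e + 1) mod 3 = 1 \<or>
    e mod 3 = 1 \<and> (e - 1) mod 3 = 0 \<and> (e + 1) mod 3 = 2 \<or>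
    e mod 3 = 2 \<and> (e - 1) mod 3 = 1 \<and> (e + 1) mod 3 = 0" by presburger
  then show ?thesis by (auto simp: one_coeff_def)
qed

lemma omega_coeff_sum: "omega_coeff (e - 1) + omega_coeff e + omega_coeff (e + 1) = 0"
proof -
  have "e mod 3 = 0 \<and> (e - 1) mod 3 = 2 \<and> (e + 1) mod 3 = 1 \<or>
    e mod 3 = 1 \<and> (e - 1) mod 3 = 0 \<and> (e + 1) mod 3 = 2 \<or>
    e mod 3 = 2 \<and> (e - 1) mod 3 = 1 \<and> (e + 1) mod 3 = 0" by presburger
  then show ?thesis by (auto simp: omega_coeff_def)
qed

text \<open>
  The words \<open>l \<cdots> l\<close> and \<open>l \<cdots> l r\<close> with a prescribed list of indices. The second one is used for
  nonempty lists only, as its last index belongs to the letter \<open>r\<close>.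
\<close>

definition l_word :: "nat list \<Rightarrow> (bool \<times> nat) list" where
  "l_word xs = map (Pair False) xs"

definition r_word :: "nat list \<Rightarrow> (bool \<times> nat) list" where
  "r_word xs = map (Pair False) (butlast xs) @ [(True, last xs)]"

text \<open>
  The strictly increasing index lists of length \<open>k\<close>.
\<close>

definition increasing_lists :: "nat \<Rightarrow> nat \<Rightarrow> nat list set" where
  "increasing_lists n k = {xs. sorted_wrt (<) xs \<and> set xs \<subseteq> {..<n} \<and> length xs = k}"

text \<open>
  The index lists of the basis words ending in \<open>r\<close>: there is none in length 0, and no condition on the
  indices in length 2.
\<close>

definition r_index :: "nat \<Rightarrow> nat \<Rightarrow> nat list set" where
  "r_index n k = (if k = 0 then {} else if k = 2 then {xs. set xs \<subseteq> {..<n} \<and> length xs = k}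
    else increasing_lists n k)"

text \<open>
  The words of length \<open>k\<close> that map to a basis of the weight \<open>k\<close> component.
\<close>

definition basis_words :: "nat \<Rightarrow> nat \<Rightarrow> (bool \<times> nat) list set" where
  "basis_words n k = l_word ` increasing_lists n k \<union> r_word ` r_index n k"

lemma twist_l_word: "twist (l_word xs) = 0"
  by (induction xs) (auto simp: l_word_def)

lemma twist_r_word: "twist (r_word xs) = 1"
  using twist_l_word[of "butlast xs"] by (simp add: r_word_def twist_append l_word_def)

lemma map_snd_l_word: "map snd (l_word xs) = xs"
  by (simp add: l_word_def comp_def)

lemma map_snd_r_word: "xs \<noteq> [] \<Longrightarrow> map snd (r_word xs) = xs"
  by (simp add: r_word_def comp_def)

lemma l_word_neq_r_word: "l_word xs \<noteq> r_word ys"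
  using twist_l_word twist_r_word by (metis zero_neq_one)

lemma inj_l_word: "inj l_word"
  by (metis injI map_snd_l_word)

lemma inj_on_r_word: "inj_on r_word (r_index n k)"
proof (rule inj_onI)
  fix xs ys assume "xs \<in> r_index n k" "ys \<in> r_index n k" and eq: "r_word xs = r_word ys"
  then have "xs \<noteq> []" "ys \<noteq> []"
    by (auto simp: r_index_def increasing_lists_def split: if_splits)
  then show "xs = ys" using eq map_snd_r_word by metis
qed

lemma bij_betw_increasing_lists:
  "bij_betw set (increasing_lists n k) {S. S \<subseteq> {..<n} \<and> card S = k}"
proof (rule bij_betw_byWitness[where f' = sorted_list_of_set])
  have fin: "finite S" if "S \<in> {S. S \<subseteq> {..<n} \<and> card S = k}" for S
    using that finite_subset[of S "{..<n}"] by simp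
  show "\<forall>xs\<in>increasing_lists n k. sorted_list_of_set (set xs) = xs"
    by (simp add: increasing_lists_def strict_sorted_iff
        sorted_list_of_set.idem_if_sorted_distinct)
  show "\<forall>S\<in>{S. S \<subseteq> {..<n} \<and> card S = k}. set (sorted_list_of_set S) = S"
    using fin by (intro ballI set_sorted_list_of_set)
  show "set ` increasing_lists n k \<subseteq> {S. S \<subseteq> {..<n} \<and> card S = k}"
    by (rule image_subsetI) (simp add: increasing_lists_def strict_sorted_iff distinct_card)
  show "sorted_list_of_set ` {S. S \<subseteq> {..<n} \<and> card S = k} \<subseteq> increasing_lists n k"
  proof (rule image_subsetI)
    fix S assume "S \<in> {S. S \<subseteq> {..<n} \<and> card S = k}"
    with fin[OF this] show "sorted_list_of_set S \<in> increasing_lists n k"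
      by (simp add: increasing_lists_def)
  qed
qed

lemma card_increasing_lists: "card (increasing_lists n k) = n choose k"
  using bij_betw_same_card[OF bij_betw_increasing_lists] n_subsets[of "{..<n}" k] by simp

lemma finite_lists_bounded: "finite {xs. set xs \<subseteq> {..<n::nat} \<and> length xs = k}"
  by (rule finite_lists_length_eq) simp

lemma finite_increasing_lists: "finite (increasing_lists n k)"
  by (rule finite_subset[OF _ finite_lists_bounded[of n k]]) (auto simp: increasing_lists_def)

lemma finite_r_index: "finite (r_index n k)"
  by (simp add: r_index_def finite_lists_bounded finite_increasing_lists)

lemma finite_basis_words: "finite (basis_words n k)"
  by (simp add: basis_words_def finite_r_index finite_increasing_lists)

lemma choose_two_plus_square: "(n choose 2) + n ^ 2 = (3 * n ^ 2 - n) div 2"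
proof (induction n)
  case (Suc n)
  have "(Suc n choose 2) = n + (n choose 2)" by (simp add: numeral_2_eq_2)
  moreover have "2 * ((n choose 2) + n ^ 2) = 3 * n ^ 2 - n"
    using choose_two[of n] by (cases n) (auto simp: power2_eq_square algebra_simps)
  ultimately have "2 * ((Suc n choose 2) + Suc n ^ 2) = 3 * Suc n ^ 2 - Suc n"
    by (cases n) (auto simp: power2_eq_square algebra_simps)
  then show ?case by simp
qed simp

lemma card_basis_words:
  "card (basis_words n k) = (if k = 0 then 1 else if k = 1 then 2 * n
    else if k = 2 then (3 * n ^ 2 - n) div 2 else 2 * (n choose k))"
proof -
  have "card (basis_words n k) = card (increasing_lists n k) + card (r_index n k)"
    unfolding basis_words_def
    using finite_increasing_lists[of n k] finite_r_index[of n k] l_word_neq_r_word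
    by (subst card_Un_disjoint)
      (auto simp: card_image inj_on_r_word inj_on_subset[OF inj_l_word])
  also have "\<dots> = (n choose k) +
      (if k = 0 then 0 else if k = 2 then n ^ 2 else n choose k)"
    using card_lists_length_eq[of "{..<n}" 2] by (simp add: card_increasing_lists r_index_def)
  finally show ?thesis using choose_two_plus_square[of n] by auto
qed

text \<open>
  The member of the dual family that belongs to a basis word \<open>b\<close>. The twist of \<open>b\<close> is 0 for a word
  \<open>l \<cdots> l\<close> and 1 for a word \<open>l \<cdots> l r\<close>.
\<close>

definition dual_functional :: "nat \<Rightarrow> (bool \<times> nat) list \<Rightarrow> (bool \<times> nat) list \<Rightarrow> int" where
  "dual_functional k b = (if twist b = 0 then top_functional one_coeff (set (map snd b))
    else if k = 2 then square_functional (snd (b ! 0)) (snd (b ! 1))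
    else top_functional omega_coeff (set (map snd b)))"

lemma respects_relations_dual_functional: "respects_relations (dual_functional k b)"
  by (auto simp: dual_functional_def one_coeff_sum omega_coeff_sum
      intro!: respects_relations_top_functional respects_relations_square_functional)

lemma increasing_lists_eq_iff:
  "xs \<in> increasing_lists n k \<Longrightarrow> ys \<in> increasing_lists m l \<Longrightarrow> set xs = set ys \<longleftrightarrow> xs = ys"
  by (auto simp: increasing_lists_def strict_sorted_equal)

lemma dual_functional_basis_words:
  assumes "b \<in> basis_words n k" "b' \<in> basis_words n k"
  shows "dual_functional k b b' = (if b = b' then 1 else 0)"
proof -
  consider (l) xs where "b = l_word xs" "xs \<in> increasing_lists n k"
    | (r) xs where "b = r_word xs" "xs \<in> r_index n k"
    using assms(1) by (auto simp: basis_words_def)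
  then show ?thesis
  proof cases
    case l
    consider (l') ys where "b' = l_word ys" "ys \<in> increasing_lists n k"
      | (r') ys where "b' = r_word ys" "ys \<in> r_index n k"
      using assms(2) by (auto simp: basis_words_def)
    then show ?thesis
    proof cases
      case l'
      have "sort_sign ys = 1" using l'(2) by (intro sort_sign_sorted) (simp add: increasing_lists_def)
      moreover have "set ys = set xs \<longleftrightarrow> b = b'"
        using l l' increasing_lists_eq_iff[OF l(2) l'(2)] by (auto dest: injD[OF inj_l_word])
      ultimately show ?thesis
        using l(1) l'(1) by (simp add: dual_functional_def top_functional_def twist_l_word
            map_snd_l_word one_coeff_def del: set_map)
    next
      case r'
      then show ?thesis
        using l(1) l_word_neq_r_word[of xs ys] by (simp add: dual_functional_def top_functional_def
            twist_l_word twist_r_word one_coeff_def)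
    qed
  next
    case r
    have ne: "xs \<noteq> []" using r(2) by (auto simp: r_index_def increasing_lists_def split: if_splits)
    consider (l') ys where "b' = l_word ys" "ys \<in> increasing_lists n k"
      | (r') ys where "b' = r_word ys" "ys \<in> r_index n k"
      using assms(2) by (auto simp: basis_words_def)
    then show ?thesis
    proof cases
      case l'
      have "square_functional i j b' = 0" for i j
        using l'(1) by (auto simp: square_functional_def l_word_def)
      moreover have "top_functional omega_coeff S b' = 0" for S
        using l'(1) by (simp add: top_functional_def twist_l_word omega_coeff_def)
      ultimately show ?thesis
        using r(1) l'(1) l_word_neq_r_word[of ys xs] by (auto simp: dual_functional_def twist_r_word)
    next
      case r'
      have ne': "ys \<noteq> []" using r'(2) by (auto simp: r_index_def increasing_lists_def split: if_splits)
      show ?thesis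
      proof (cases "k = 2")
        case True
        then obtain p q p' q' where "xs = [p, q]" "ys = [p', q']"
          using r(2) r'(2) by (auto simp: r_index_def numeral_2_eq_2 length_Suc_conv)
        then show ?thesis using r(1) r'(1) True twist_r_word[of xs]
          by (auto simp: dual_functional_def r_word_def square_functional_def)
      next
        case False
        then have inc: "xs \<in> increasing_lists n k" "ys \<in> increasing_lists n k"
          using r(2) r'(2) by (auto simp: r_index_def split: if_splits)
        have "sort_sign ys = 1" using inc(2) by (intro sort_sign_sorted) (simp add: increasing_lists_def)
        moreover have "set ys = set xs \<longleftrightarrow> b = b'"
          using r r' increasing_lists_eq_iff[OF inc] by (auto dest: inj_onD[OF inj_on_r_word])
        ultimately show ?thesis
          using r(1) r'(1) False by (simp add: dual_functional_def top_functional_def twist_r_word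
              map_snd_r_word ne ne' omega_coeff_def del: set_map)
      qed
    qed
  qed
qed

section \<open>Reduction of words to normal form\<close>

lemma (in abelian_group) a_inv_zero: "\<ominus> \<zero> = \<zero>"
  by (rule minus_equality) simp_all

context module
begin

text \<open>
  Insertion sort: an alternating function on lists of length \<open>k\<close> takes at any list, up to sign, the value
  at a strictly increasing list, or vanishes. The prefix \<open>us\<close> is carried along since the sorting proceeds
  inside the list. This lemma inserts one entry into a sorted tail.
\<close>

lemma alternating_insert:
  fixes f :: "nat list \<Rightarrow> 'c"
  assumes cl: "\<And>xs. f xs \<in> carrier M"
    and rep: "\<And>us i vs. length us + length vs + 2 = k \<Longrightarrow> f (us @ [i, i] @ vs) = \<zero>\<^bsub>M\<^esub>"
    and swap: "\<And>us i j vs. length us + length vs + 2 = k \<Longrightarrow>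
      f (us @ [i, j] @ vs) = \<ominus>\<^bsub>M\<^esub> f (us @ [j, i] @ vs)"
    and "sorted_wrt (<) s" "length us + length s + 1 = k"
  shows "f (us @ x # s) = \<zero>\<^bsub>M\<^esub> \<or> (\<exists>t. sorted_wrt (<) t \<and> set t \<subseteq> insert x (set s) \<and>
    length t = Suc (length s) \<and> (f (us @ x # s) = f (us @ t) \<or> f (us @ x # s) = \<ominus>\<^bsub>M\<^esub> f (us @ t)))"
  using assms(4,5)
proof (induction s arbitrary: us)
  case Nil
  then show ?case by (intro disjI2 exI[of _ "[x]"]) auto
next
  case (Cons y s)
  consider "x < y" | "x = y" | "y < x" by linarith
  then show ?case
  proof cases
    case 1
    then have "sorted_wrt (<) (x # y # s)" using Cons.prems(1) by auto
    then show ?thesis by (intro disjI2 exI[of _ "x # y # s"]) auto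
  next
    case 2
    then show ?thesis using rep[of us s x] Cons.prems(2) by simp
  next
    case 3
    have eq: "f (us @ x # y # s) = \<ominus>\<^bsub>M\<^esub> f ((us @ [y]) @ x # s)"
      using swap[of us s x y] Cons.prems(2) by simp
    have "f ((us @ [y]) @ x # s) = \<zero>\<^bsub>M\<^esub> \<or> (\<exists>t. sorted_wrt (<) t \<and> set t \<subseteq> insert x (set s) \<and>
        length t = Suc (length s) \<and> (f ((us @ [y]) @ x # s) = f ((us @ [y]) @ t) \<or>
        f ((us @ [y]) @ x # s) = \<ominus>\<^bsub>M\<^esub> f ((us @ [y]) @ t)))"
      using Cons.prems by (intro Cons.IH) auto
    then show ?thesis
    proof (elim disjE exE conjE)
      assume "f ((us @ [y]) @ x # s) = \<zero>\<^bsub>M\<^esub>"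
      then have "f (us @ x # y # s) = \<zero>\<^bsub>M\<^esub>" unfolding eq by (simp only: M.a_inv_zero)
      then show ?thesis by blast
    next
      fix t assume t: "sorted_wrt (<) t" "set t \<subseteq> insert x (set s)" "length t = Suc (length s)"
        and ft: "f ((us @ [y]) @ x # s) = f ((us @ [y]) @ t)"
      have "sorted_wrt (<) (y # t)" using t(1,2) 3 Cons.prems(1) by auto
      moreover have "f (us @ x # y # s) = \<ominus>\<^bsub>M\<^esub> f (us @ y # t)" unfolding eq ft by simp
      ultimately show ?thesis using t(2,3) by (intro disjI2 exI[of _ "y # t"]) auto
    next
      fix t assume t: "sorted_wrt (<) t" "set t \<subseteq> insert x (set s)" "length t = Suc (length s)"
        and ft: "f ((us @ [y]) @ x # s) = \<ominus>\<^bsub>M\<^esub> f ((us @ [y]) @ t)"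
      have "sorted_wrt (<) (y # t)" using t(1,2) 3 Cons.prems(1) by auto
      moreover have "f (us @ x # y # s) = f (us @ y # t)" unfolding eq ft using cl by simp
      ultimately show ?thesis using t(2,3) by (intro disjI2 exI[of _ "y # t"]) auto
    qed
  qed
qed

lemma alternating_sort:
  fixes f :: "nat list \<Rightarrow> 'c"
  assumes cl: "\<And>xs. f xs \<in> carrier M"
    and rep: "\<And>us i vs. length us + length vs + 2 = k \<Longrightarrow> f (us @ [i, i] @ vs) = \<zero>\<^bsub>M\<^esub>"
    and swap: "\<And>us i j vs. length us + length vs + 2 = k \<Longrightarrow>
      f (us @ [i, j] @ vs) = \<ominus>\<^bsub>M\<^esub> f (us @ [j, i] @ vs)"
    and "length us + length xs = k"
  shows "f (us @ xs) = \<zero>\<^bsub>M\<^esub> \<or> (\<exists>t. sorted_wrt (<) t \<and> set t \<subseteq> set xs \<and>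
    length t = length xs \<and> (f (us @ xs) = f (us @ t) \<or> f (us @ xs) = \<ominus>\<^bsub>M\<^esub> f (us @ t)))"
  using assms(4)
proof (induction xs arbitrary: us)
  case Nil
  then show ?case by auto
next
  case (Cons x xs)
  have "f ((us @ [x]) @ xs) = \<zero>\<^bsub>M\<^esub> \<or> (\<exists>t. sorted_wrt (<) t \<and> set t \<subseteq> set xs \<and>
      length t = length xs \<and> (f ((us @ [x]) @ xs) = f ((us @ [x]) @ t) \<or>
      f ((us @ [x]) @ xs) = \<ominus>\<^bsub>M\<^esub> f ((us @ [x]) @ t)))"
    using Cons.prems by (intro Cons.IH) auto
  then have "f (us @ x # xs) = \<zero>\<^bsub>M\<^esub> \<or> (\<exists>s. sorted_wrt (<) s \<and> set s \<subseteq> set xs \<and>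
      length s = length xs \<and> (f (us @ x # xs) = f (us @ x # s) \<or>
      f (us @ x # xs) = \<ominus>\<^bsub>M\<^esub> f (us @ x # s)))" by simp
  then show ?case
  proof
    assume "\<exists>s. sorted_wrt (<) s \<and> set s \<subseteq> set xs \<and> length s = length xs \<and>
      (f (us @ x # xs) = f (us @ x # s) \<or> f (us @ x # xs) = \<ominus>\<^bsub>M\<^esub> f (us @ x # s))"
    then obtain s where s: "sorted_wrt (<) s" "set s \<subseteq> set xs" "length s = length xs"
      and fs: "f (us @ x # xs) = f (us @ x # s) \<or> f (us @ x # xs) = \<ominus>\<^bsub>M\<^esub> f (us @ x # s)" by blast
    have k: "length us + length s + 1 = k" using Cons.prems s(3) by simp
    have "f (us @ x # s) = \<zero>\<^bsub>M\<^esub> \<or> (\<exists>t. sorted_wrt (<) t \<and> set t \<subseteq> insert x (set s) \<and>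
        length t = Suc (length s) \<and> (f (us @ x # s) = f (us @ t) \<or> f (us @ x # s) = \<ominus>\<^bsub>M\<^esub> f (us @ t)))"
      by (rule alternating_insert[where f = f, OF cl rep swap s(1) k])
    then show ?thesis
    proof (elim disjE exE conjE)
      assume z: "f (us @ x # s) = \<zero>\<^bsub>M\<^esub>"
      then have "f (us @ x # xs) = \<zero>\<^bsub>M\<^esub>" using fs unfolding z by (auto simp only: M.a_inv_zero)
      then show ?thesis by blast
    next
      fix t assume t: "sorted_wrt (<) t" "set t \<subseteq> insert x (set s)" "length t = Suc (length s)"
        and ft: "f (us @ x # s) = f (us @ t)"
      have "f (us @ x # xs) = f (us @ t) \<or> f (us @ x # xs) = \<ominus>\<^bsub>M\<^esub> f (us @ t)"
        using fs unfolding ft .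
      then show ?thesis using t s by (intro disjI2 exI[of _ t]) auto
    next
      fix t assume t: "sorted_wrt (<) t" "set t \<subseteq> insert x (set s)" "length t = Suc (length s)"
        and ft: "f (us @ x # s) = \<ominus>\<^bsub>M\<^esub> f (us @ t)"
      have "f (us @ x # xs) = f (us @ t) \<or> f (us @ x # xs) = \<ominus>\<^bsub>M\<^esub> f (us @ t)"
        using fs unfolding ft M.minus_minus[OF cl] by blast
      then show ?thesis using t s by (intro disjI2 exI[of _ t]) auto
    qed
  qed blast
qed

lemma alternating_in_lspan:
  fixes f :: "nat list \<Rightarrow> 'c"
  assumes cl: "\<And>xs. f xs \<in> carrier M"
    and rep: "\<And>us i vs. length us + length vs + 2 = k \<Longrightarrow> f (us @ [i, i] @ vs) = \<zero>\<^bsub>M\<^esub>"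
    and swap: "\<And>us i j vs. length us + length vs + 2 = k \<Longrightarrow>
      f (us @ [i, j] @ vs) = \<ominus>\<^bsub>M\<^esub> f (us @ [j, i] @ vs)"
    and xs: "length xs = k" "set xs \<subseteq> {..<n}"
  shows "f xs \<in> lspan R M (f ` increasing_lists n k)"
proof -
  have C: "f ` increasing_lists n k \<subseteq> carrier M" using cl by (intro image_subsetI)
  have k: "length ([] :: nat list) + length xs = k" using xs by simp
  have "f ([] @ xs) = \<zero>\<^bsub>M\<^esub> \<or> (\<exists>t. sorted_wrt (<) t \<and> set t \<subseteq> set xs \<and>
      length t = length xs \<and> (f ([] @ xs) = f ([] @ t) \<or> f ([] @ xs) = \<ominus>\<^bsub>M\<^esub> f ([] @ t)))"
    by (rule alternating_sort[where f = f, OF cl rep swap k])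
  then have "f xs = \<zero>\<^bsub>M\<^esub> \<or> (\<exists>t. sorted_wrt (<) t \<and> set t \<subseteq> set xs \<and>
      length t = length xs \<and> (f xs = f t \<or> f xs = \<ominus>\<^bsub>M\<^esub> f t))" by simp
  then show ?thesis
  proof
    assume "\<exists>t. sorted_wrt (<) t \<and> set t \<subseteq> set xs \<and>
      length t = length xs \<and> (f xs = f t \<or> f xs = \<ominus>\<^bsub>M\<^esub> f t)"
    then obtain t where t: "t \<in> increasing_lists n k" "f xs = f t \<or> f xs = \<ominus>\<^bsub>M\<^esub> f t"
      using xs by (auto simp: increasing_lists_def)
    have "f t \<in> lspan R M (f ` increasing_lists n k)"
      by (rule lspan_base[OF _ C]) (rule imageI[OF t(1)])
    then show ?thesis using t(2) lspan_uminus[OF _ C, of "f t"] by auto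
  qed (simp add: lspan.lspan_zero)
qed

end

lemma l_word_append: "l_word (xs @ ys) = l_word xs @ l_word ys"
  by (simp add: l_word_def)

lemma l_word_Cons: "l_word (x # xs) = (False, x) # l_word xs"
  by (simp add: l_word_def)

lemma l_word_Nil: "l_word [] = []"
  by (simp add: l_word_def)

lemma r_word_snoc: "r_word (xs @ [x]) = l_word xs @ [(True, x)]"
  by (simp add: r_word_def l_word_def)

lemma r_word_append: "ys \<noteq> [] \<Longrightarrow> r_word (xs @ ys) = l_word xs @ r_word ys"
  by (simp add: r_word_def l_word_def butlast_append)

text \<open>
  A function from words to a module that satisfies the relations of the enveloping algebra at every
  position. Multiplication is not needed for the reduction to normal form.
\<close>

locale word_evaluation = module R M for R (structure) and M (structure) +
  fixes ev :: "(bool \<times> nat) list \<Rightarrow> 'c"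
  assumes ev_closed [simp]: "ev w \<in> carrier M"
    and ev_ll_same: "ev (u @ (False, i) # (False, i) # v) = \<zero>\<^bsub>M\<^esub>"
    and ev_ll: "ev (u @ (False, i) # (False, j) # v) = \<ominus>\<^bsub>M\<^esub> ev (u @ (False, j) # (False, i) # v)"
    and ev_rr: "ev (u @ (True, i) # (True, j) # v) = ev (u @ (False, i) # (False, j) # v)"
    and ev_rl: "ev (u @ (True, j) # (False, i) # v) =
      ev (u @ (False, i) # (True, j) # v) \<oplus>\<^bsub>M\<^esub> ev (u @ (False, i) # (False, j) # v)"
begin

text \<open>
  The values at the words \<open>l \<cdots> l v\<close> and \<open>l \<cdots> l r v\<close> with \<open>k\<close> letters before \<open>v\<close> and indices in
  \<open>I\<close>.
\<close>

definition normal_forms :: "nat set \<Rightarrow> nat \<Rightarrow> (bool \<times> nat) list \<Rightarrow> 'c set" where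
  "normal_forms I k v = {ev (l_word xs @ v) | xs. set xs \<subseteq> I \<and> length xs = k} \<union>
    {ev (r_word xs @ v) | xs. xs \<noteq> [] \<and> set xs \<subseteq> I \<and> length xs = k}"

lemma normal_forms_closed: "normal_forms I k v \<subseteq> carrier M"
  by (auto simp: normal_forms_def)

lemma ev_in_lspan_normal_forms:
  "ev (w @ v) \<in> lspan R M (normal_forms (snd ` set w) (length w) v)"
proof (induction w arbitrary: v rule: rev_induct)
  case Nil
  have "ev ([] @ v) \<in> normal_forms (snd ` set []) (length []) v"
    unfolding normal_forms_def by (auto simp: l_word_Nil)
  then show ?case by (rule lspan_base[OF _ normal_forms_closed])
next
  case (snoc x w)
  let ?I = "snd ` set w" and ?I' = "snd ` set (w @ [x])"
  let ?N = "normal_forms ?I' (length (w @ [x])) v"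
  note base = lspan_base[OF _ normal_forms_closed]
  obtain t i where x: "x = (t, i)" by force
  have l: "ev (l_word ys @ v) \<in> lspan R M ?N" if "set ys \<subseteq> ?I'" "length ys = Suc (length w)" for ys
    using that by (intro base) (auto simp: normal_forms_def)
  have r: "ev (r_word ys @ v) \<in> lspan R M ?N"
    if "ys \<noteq> []" "set ys \<subseteq> ?I'" "length ys = Suc (length w)" for ys
    using that by (intro base) (auto simp: normal_forms_def)
  have i: "i \<in> ?I'" and sub: "?I \<subseteq> ?I'" using x by auto
  have "normal_forms ?I (length w) (x # v) \<subseteq> lspan R M ?N"
  proof
    fix y assume "y \<in> normal_forms ?I (length w) (x # v)"
    then consider (L) xs where "y = ev (l_word xs @ x # v)" "set xs \<subseteq> ?I" "length xs = length w"
      | (R) xs where "y = ev (r_word xs @ x # v)" "xs \<noteq> []" "set xs \<subseteq> ?I" "length xs = length w"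
      unfolding normal_forms_def by blast
    then show "y \<in> lspan R M ?N"
    proof cases
      case L
      have xi: "set (xs @ [i]) \<subseteq> ?I'" "length (xs @ [i]) = Suc (length w)" using L i sub by auto
      show ?thesis
      proof (cases t)
        case True
        then have "y = ev (r_word (xs @ [i]) @ v)" using L x by (simp add: r_word_snoc)
        then show ?thesis using r[OF _ xi] by simp
      next
        case False
        then have "y = ev (l_word (xs @ [i]) @ v)"
          using L x by (simp add: l_word_append l_word_Cons l_word_Nil)
        then show ?thesis using l[OF xi] by simp
      qed
    next
      case R
      obtain zs j where xs: "xs = zs @ [j]" using R(2) by (metis rev_exhaust)
      have zij: "set (zs @ [i, j]) \<subseteq> ?I'" "length (zs @ [i, j]) = Suc (length w)"
        and zji: "set (zs @ [j, i]) \<subseteq> ?I'" "length (zs @ [j, i]) = Suc (length w)"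
        using R i sub xs by auto
      show ?thesis
      proof (cases t)
        case True
        then have "y = ev (l_word zs @ (True, j) # (True, i) # v)"
          using R(1) x xs by (simp add: r_word_snoc)
        then have "y = ev (l_word (zs @ [j, i]) @ v)"
          unfolding ev_rr by (simp add: l_word_append l_word_Cons l_word_Nil)
        then show ?thesis using l[OF zji] by simp
      next
        case False
        then have "y = ev (l_word zs @ (True, j) # (False, i) # v)"
          using R(1) x xs by (simp add: r_word_snoc)
        then have "y = ev (r_word (zs @ [i, j]) @ v) \<oplus>\<^bsub>M\<^esub> ev (l_word (zs @ [i, j]) @ v)"
          unfolding ev_rl using r_word_snoc[of "zs @ [i]" j]
          by (simp add: l_word_append l_word_Cons l_word_Nil)
        then show ?thesis using l[OF zij] r[OF _ zij] lspan_add[OF _ _ normal_forms_closed] by simp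
      qed
    qed
  qed
  then show ?case
    using lspan_subset[OF snoc.IH[of "x # v"] _ normal_forms_closed] by simp
qed

text \<open>
  The overlap of the relation for \<open>r r\<close> with itself, in the word \<open>r\<^sub>i r\<^sub>j r\<^sub>k\<close>.
\<close>

lemma ev_llr_cyclic:
  "ev (u @ (False, i) # (False, j) # (True, k) # v) = ev (u @ (False, j) # (False, k) # (True, i) # v)"
proof -
  have "ev (u @ (False, i) # (False, j) # (True, k) # v) = ev (u @ (True, i) # (True, j) # (True, k) # v)"
    by (rule ev_rr[symmetric])
  also have "\<dots> = ev (u @ (True, i) # (False, j) # (False, k) # v)"
    using ev_rr[of "u @ [(True, i)]" j k v] by simp
  also have "\<dots> = ev (u @ (False, j) # (True, i) # (False, k) # v) \<oplus>\<^bsub>M\<^esub>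
      ev (u @ (False, j) # (False, i) # (False, k) # v)"
    by (rule ev_rl)
  also have "ev (u @ (False, j) # (True, i) # (False, k) # v) =
      ev (u @ (False, j) # (False, k) # (True, i) # v) \<oplus>\<^bsub>M\<^esub>
      ev (u @ (False, j) # (False, k) # (False, i) # v)"
    using ev_rl[of "u @ [(False, j)]" i k v] by simp
  also have "ev (u @ (False, j) # (False, k) # (False, i) # v) =
      \<ominus>\<^bsub>M\<^esub> ev (u @ (False, j) # (False, i) # (False, k) # v)"
    using ev_ll[of "u @ [(False, j)]" k i v] by simp
  finally show ?thesis by (simp add: M.a_assoc M.l_neg)
qed

text \<open>
  A swap among the leading \<open>l\<close> is immediate; a swap that involves the final \<open>r\<close> is moved to the two
  letters \<open>l\<close> before it by the cyclic identity. This needs a third letter.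
\<close>

lemma ev_r_word_alternating:
  assumes "length us + length vs \<ge> 1"
  shows "ev (r_word (us @ [i, i] @ vs)) = \<zero>\<^bsub>M\<^esub>"
    and "ev (r_word (us @ [i, j] @ vs)) = \<ominus>\<^bsub>M\<^esub> ev (r_word (us @ [j, i] @ vs))"
proof -
  have "ev (r_word (us @ [i, i] @ vs)) = \<zero>\<^bsub>M\<^esub> \<and>
    ev (r_word (us @ [i, j] @ vs)) = \<ominus>\<^bsub>M\<^esub> ev (r_word (us @ [j, i] @ vs))"
  proof (cases "vs = []")
    case False
    then have eq: "r_word (us @ [p, q] @ vs) = l_word us @ (False, p) # (False, q) # r_word vs" for p q
      using r_word_append[of vs "us @ [p, q]"] by (simp add: l_word_append l_word_Cons l_word_Nil)
    show ?thesis unfolding eq using ev_ll_same ev_ll by blast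
  next
    case True
    then obtain ws h where us: "us = ws @ [h]" using assms by (cases us rule: rev_cases) auto
    have eq: "r_word (us @ [p, q] @ vs) = l_word ws @ (False, h) # (False, p) # (True, q) # []" for p q
      using r_word_snoc[of "ws @ [h, p]" q] True us by (simp add: l_word_append l_word_Cons l_word_Nil)
    show ?thesis unfolding eq ev_llr_cyclic[of _ h]
      using ev_ll_same ev_ll by blast
  qed
  then show "ev (r_word (us @ [i, i] @ vs)) = \<zero>\<^bsub>M\<^esub>"
    "ev (r_word (us @ [i, j] @ vs)) = \<ominus>\<^bsub>M\<^esub> ev (r_word (us @ [j, i] @ vs))" by blast+
qed

lemma ev_in_lspan_basis_words:
  assumes "snd ` set w \<subseteq> {..<n}"
  shows "ev w \<in> lspan R M (ev ` basis_words n (length w))"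
proof -
  let ?k = "length w" and ?B = "ev ` basis_words n (length w)"
  have B: "?B \<subseteq> carrier M" by auto
  have l: "ev (l_word xs) \<in> lspan R M ?B" if "length xs = ?k" "set xs \<subseteq> {..<n}" for xs
  proof -
    have "ev (l_word xs) \<in> lspan R M ((\<lambda>xs. ev (l_word xs)) ` increasing_lists n ?k)"
      by (rule alternating_in_lspan[where f = "\<lambda>xs. ev (l_word xs)", OF _ _ _ that])
        (simp_all add: l_word_append l_word_Cons ev_ll_same ev_ll[symmetric])
    then show ?thesis by (rule lspan_mono) (auto simp: basis_words_def)
  qed
  have r: "ev (r_word xs) \<in> lspan R M ?B" if xs: "length xs = ?k" "set xs \<subseteq> {..<n}" "xs \<noteq> []" for xs
  proof (cases "?k \<ge> 3")
    case True
    have "ev (r_word xs) \<in> lspan R M ((\<lambda>xs. ev (r_word xs)) ` increasing_lists n ?k)"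
    proof (rule alternating_in_lspan[where f = "\<lambda>xs. ev (r_word xs)", OF _ _ _ xs(1,2)])
      fix us vs :: "nat list" and i j assume "length us + length vs + 2 = ?k"
      then have "length us + length vs \<ge> 1" using True by simp
      then show "ev (r_word (us @ [i, i] @ vs)) = \<zero>\<^bsub>M\<^esub>"
        "ev (r_word (us @ [i, j] @ vs)) = \<ominus>\<^bsub>M\<^esub> ev (r_word (us @ [j, i] @ vs))"
        by (rule ev_r_word_alternating)+
    qed simp
    then show ?thesis by (rule lspan_mono) (use True in \<open>auto simp: basis_words_def r_index_def\<close>)
  next
    case False
    then have "xs \<in> r_index n ?k"
      using xs by (cases xs; cases "tl xs") (auto simp: r_index_def increasing_lists_def)
    then show ?thesis by (intro lspan_base[OF _ B]) (auto simp: basis_words_def)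
  qed
  have "normal_forms (snd ` set w) ?k [] \<subseteq> lspan R M ?B"
    unfolding normal_forms_def using l r assms by auto
  then show ?thesis
    using lspan_subset[OF ev_in_lspan_normal_forms[of w "[]"] _ B] by simp
qed

end

section \<open>Multilinear extension of functionals on words\<close>

text \<open>
  The multilinear extension of a function \<open>\<chi>\<close> on words in the generators to words in vectors of
  \<open>K\<^sup>n \<oplus> K\<^sup>n\<close>: each vector is expanded in the generators.
\<close>

fun multilinear_ext :: "('k, 'm) ring_scheme \<Rightarrow> nat \<Rightarrow> ((bool \<times> nat) list \<Rightarrow> 'k) \<Rightarrow>
    ((nat \<Rightarrow> 'k) \<times> (nat \<Rightarrow> 'k)) list \<Rightarrow> 'k" where
  "multilinear_ext K n \<chi> [] = \<chi> []"
| "multilinear_ext K n \<chi> (v # w) =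
    (\<Oplus>\<^bsub>K\<^esub>i\<in>{..<n}. fst v i \<otimes>\<^bsub>K\<^esub> multilinear_ext K n (\<lambda>u. \<chi> ((False, i) # u)) w) \<oplus>\<^bsub>K\<^esub>
    (\<Oplus>\<^bsub>K\<^esub>i\<in>{..<n}. snd v i \<otimes>\<^bsub>K\<^esub> multilinear_ext K n (\<lambda>u. \<chi> ((True, i) # u)) w)"

lemma (in abelian_monoid) finsum_swap:
  assumes "finite I" "finite J" "\<And>i j. \<lbrakk>i \<in> I; j \<in> J\<rbrakk> \<Longrightarrow> f i j \<in> carrier G"
  shows "(\<Oplus>i\<in>I. \<Oplus>j\<in>J. f i j) = (\<Oplus>j\<in>J. \<Oplus>i\<in>I. f i j)"
  using assms(1,3)
proof (induction I rule: finite_induct)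
  case empty
  then show ?case by (simp add: finsum_zero)
next
  case (insert i I)
  then have "(\<Oplus>i\<in>insert i I. \<Oplus>j\<in>J. f i j) = (\<Oplus>j\<in>J. f i j) \<oplus> (\<Oplus>j\<in>J. \<Oplus>i\<in>I. f i j)"
    by (subst finsum_insert) (auto intro!: finsum_closed)
  also have "\<dots> = (\<Oplus>j\<in>J. f i j \<oplus> (\<Oplus>i\<in>I. f i j))"
    using insert by (subst finsum_addf) (auto intro!: finsum_closed)
  also have "\<dots> = (\<Oplus>j\<in>J. \<Oplus>i\<in>insert i I. f i j)"
    using insert by (intro finsum_cong') (auto intro!: finsum_closed simp: Pi_iff)
  finally show ?case .
qed

lemma (in abelian_monoid) finsum_alternating:
  assumes "\<And>i j. \<lbrakk>i < n; j < n\<rbrakk> \<Longrightarrow> f i j \<in> carrier G"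
    and "\<And>i. i < n \<Longrightarrow> f i i = \<zero>" "\<And>i j. \<lbrakk>i < n; j < n\<rbrakk> \<Longrightarrow> f i j \<oplus> f j i = \<zero>"
  shows "(\<Oplus>i\<in>{..<n::nat}. \<Oplus>j\<in>{..<n}. f i j) = \<zero>"
  using assms
proof (induction n)
  case 0
  then show ?case by simp
next
  case (Suc n)
  have f: "f i j \<in> carrier G" if "i < Suc n" "j < Suc n" for i j using Suc.prems(1) that .
  have col: "(\<Oplus>i\<in>{..<n}. f i n) \<in> carrier G" and row: "(\<Oplus>j\<in>{..<n}. f n j) \<in> carrier G"
    by (auto intro!: finsum_closed f)
  have "(\<Oplus>i\<in>{..<Suc n}. \<Oplus>j\<in>{..<Suc n}. f i j) =
      (f n n \<oplus> (\<Oplus>j\<in>{..<n}. f n j)) \<oplus> (\<Oplus>i\<in>{..<n}. f i n \<oplus> (\<Oplus>j\<in>{..<n}. f i j))"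
  proof -
    have *: "(\<Oplus>j\<in>{..<Suc n}. f i j) = f i n \<oplus> (\<Oplus>j\<in>{..<n}. f i j)" if "i < Suc n" for i
      unfolding lessThan_Suc using f that by (subst finsum_insert) auto
    have "(\<Oplus>i\<in>{..<Suc n}. \<Oplus>j\<in>{..<Suc n}. f i j) =
        (\<Oplus>i\<in>{..<Suc n}. f i n \<oplus> (\<Oplus>j\<in>{..<n}. f i j))"
      by (intro finsum_cong') (auto simp: * intro!: finsum_closed f)
    then show ?thesis
      unfolding lessThan_Suc using f by (subst (asm) finsum_insert) (auto intro!: finsum_closed)
  qed
  also have "(\<Oplus>i\<in>{..<n}. f i n \<oplus> (\<Oplus>j\<in>{..<n}. f i j)) =
      (\<Oplus>i\<in>{..<n}. f i n) \<oplus> (\<Oplus>i\<in>{..<n}. \<Oplus>j\<in>{..<n}. f i j)"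
    by (rule finsum_addf) (auto intro!: finsum_closed f)
  also have "(\<Oplus>i\<in>{..<n}. \<Oplus>j\<in>{..<n}. f i j) = \<zero>" by (rule Suc.IH) (auto intro: Suc.prems)
  also have "f n n \<oplus> (\<Oplus>j\<in>{..<n}. f n j) \<oplus> ((\<Oplus>i\<in>{..<n}. f i n) \<oplus> \<zero>) =
      (\<Oplus>j\<in>{..<n}. f n j) \<oplus> (\<Oplus>i\<in>{..<n}. f i n)"
    using Suc.prems(2) row col by simp
  also have "\<dots> = (\<Oplus>j\<in>{..<n}. f n j \<oplus> f j n)"
    by (rule finsum_addf[symmetric]) (auto intro!: f)
  also have "\<dots> = \<zero>" by (rule add.finprod_one_eqI) (auto intro!: Suc.prems(3))
  finally show ?case .
qed

context cring
begin

text \<open>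
  Pairs of coefficient functions; their values outside the range of indices are irrelevant.
\<close>

abbreviation vectors :: "nat \<Rightarrow> ((nat \<Rightarrow> 'a) \<times> (nat \<Rightarrow> 'a)) set" where
  "vectors n \<equiv> ({..<n} \<rightarrow> carrier R) \<times> ({..<n} \<rightarrow> carrier R)"

lemma multilinear_ext_closed:
  assumes "w \<in> lists (vectors n)" "\<And>u. \<chi> u \<in> carrier R"
  shows "multilinear_ext R n \<chi> w \<in> carrier R"
  using assms
proof (induction w arbitrary: \<chi> rule: list.induct)
  case (Cons v w)
  have "multilinear_ext R n (\<lambda>u. \<chi> ((t, i) # u)) w \<in> carrier R" for t i
    by (rule Cons.IH) (use Cons.prems in auto)
  moreover have "fst v i \<in> carrier R" "snd v i \<in> carrier R" if "i < n" for i
    using Cons.prems(1) that by auto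
  ultimately show ?case by (auto intro!: a_closed finsum_closed)
qed simp

text \<open>
  With this lemma identities in the middle of a word follow from identities at its beginning.
\<close>

lemma multilinear_ext_append:
  "multilinear_ext R n \<chi> (u @ w) = multilinear_ext R n (\<lambda>s. multilinear_ext R n (\<lambda>t. \<chi> (s @ t)) w) u"
  by (induction u arbitrary: \<chi>) simp_all

lemma multilinear_ext_add:
  assumes "w \<in> lists (vectors n)" "\<And>u. f u \<in> carrier R" "\<And>u. g u \<in> carrier R"
  shows "multilinear_ext R n (\<lambda>u. f u \<oplus> g u) w = multilinear_ext R n f w \<oplus> multilinear_ext R n g w"
  using assms
proof (induction w arbitrary: f g rule: list.induct)
  case (Cons v w)
  have w: "w \<in> lists (vectors n)" using Cons.prems(1) by auto
  have sum: "(\<Oplus>i\<in>{..<n}. x i \<otimes> multilinear_ext R n (\<lambda>u. f ((t, i) # u) \<oplus> g ((t, i) # u)) w) =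
      (\<Oplus>i\<in>{..<n}. x i \<otimes> multilinear_ext R n (\<lambda>u. f ((t, i) # u)) w) \<oplus>
      (\<Oplus>i\<in>{..<n}. x i \<otimes> multilinear_ext R n (\<lambda>u. g ((t, i) # u)) w)"
    and cl: "(\<Oplus>i\<in>{..<n}. x i \<otimes> multilinear_ext R n (\<lambda>u. f ((t, i) # u)) w) \<in> carrier R"
      "(\<Oplus>i\<in>{..<n}. x i \<otimes> multilinear_ext R n (\<lambda>u. g ((t, i) # u)) w) \<in> carrier R"
    if x: "x \<in> {..<n} \<rightarrow> carrier R" for x t
  proof -
    have c: "x i \<otimes> multilinear_ext R n (\<lambda>u. h ((t, i) # u)) w \<in> carrier R"
      if "i < n" "\<And>u. h u \<in> carrier R" for h i
      using multilinear_ext_closed[OF w] that x by (intro m_closed) auto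
    show "(\<Oplus>i\<in>{..<n}. x i \<otimes> multilinear_ext R n (\<lambda>u. f ((t, i) # u)) w) \<in> carrier R"
      "(\<Oplus>i\<in>{..<n}. x i \<otimes> multilinear_ext R n (\<lambda>u. g ((t, i) # u)) w) \<in> carrier R"
      using Cons.prems(2,3) by (auto intro!: finsum_closed c)
    have "(\<Oplus>i\<in>{..<n}. x i \<otimes> multilinear_ext R n (\<lambda>u. f ((t, i) # u) \<oplus> g ((t, i) # u)) w) =
        (\<Oplus>i\<in>{..<n}. x i \<otimes> multilinear_ext R n (\<lambda>u. f ((t, i) # u)) w \<oplus>
          x i \<otimes> multilinear_ext R n (\<lambda>u. g ((t, i) # u)) w)"
      using Cons.IH[OF w] Cons.prems(2,3) x multilinear_ext_closed[OF w]
      by (intro finsum_cong') (auto intro!: a_closed c r_distr)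
    also have "\<dots> = (\<Oplus>i\<in>{..<n}. x i \<otimes> multilinear_ext R n (\<lambda>u. f ((t, i) # u)) w) \<oplus>
        (\<Oplus>i\<in>{..<n}. x i \<otimes> multilinear_ext R n (\<lambda>u. g ((t, i) # u)) w)"
      using Cons.prems(2,3) by (intro finsum_addf) (auto intro!: c)
    finally show "(\<Oplus>i\<in>{..<n}. x i \<otimes> multilinear_ext R n (\<lambda>u. f ((t, i) # u) \<oplus> g ((t, i) # u)) w) =
        (\<Oplus>i\<in>{..<n}. x i \<otimes> multilinear_ext R n (\<lambda>u. f ((t, i) # u)) w) \<oplus>
        (\<Oplus>i\<in>{..<n}. x i \<otimes> multilinear_ext R n (\<lambda>u. g ((t, i) # u)) w)" .
  qed
  have v: "fst v \<in> {..<n} \<rightarrow> carrier R" "snd v \<in> {..<n} \<rightarrow> carrier R" using Cons.prems(1) by auto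
  show ?case using sum[OF v(1)] sum[OF v(2)] cl[OF v(1)] cl[OF v(2)] by (simp add: a_ac)
qed simp

lemma multilinear_ext_smult:
  assumes "w \<in> lists (vectors n)" "\<And>u. f u \<in> carrier R" "c \<in> carrier R"
  shows "multilinear_ext R n (\<lambda>u. c \<otimes> f u) w = c \<otimes> multilinear_ext R n f w"
  using assms
proof (induction w arbitrary: f rule: list.induct)
  case (Cons v w)
  have w: "w \<in> lists (vectors n)" using Cons.prems(1) by auto
  have sum: "(\<Oplus>i\<in>{..<n}. x i \<otimes> multilinear_ext R n (\<lambda>u. c \<otimes> f ((t, i) # u)) w) =
      c \<otimes> (\<Oplus>i\<in>{..<n}. x i \<otimes> multilinear_ext R n (\<lambda>u. f ((t, i) # u)) w)"
    and cl: "(\<Oplus>i\<in>{..<n}. x i \<otimes> multilinear_ext R n (\<lambda>u. f ((t, i) # u)) w) \<in> carrier R"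
    if x: "x \<in> {..<n} \<rightarrow> carrier R" for x t
  proof -
    have c: "multilinear_ext R n (\<lambda>u. f ((t, i) # u)) w \<in> carrier R" "x i \<in> carrier R"
      if "i < n" for i
      using that x multilinear_ext_closed[OF w] Cons.prems(2) by auto
    show "(\<Oplus>i\<in>{..<n}. x i \<otimes> multilinear_ext R n (\<lambda>u. f ((t, i) # u)) w) \<in> carrier R"
      by (auto intro!: finsum_closed c)
    have "(\<Oplus>i\<in>{..<n}. x i \<otimes> multilinear_ext R n (\<lambda>u. c \<otimes> f ((t, i) # u)) w) =
        (\<Oplus>i\<in>{..<n}. c \<otimes> (x i \<otimes> multilinear_ext R n (\<lambda>u. f ((t, i) # u)) w))"
      using Cons.IH[OF w] Cons.prems(2,3) by (intro finsum_cong') (auto simp: c m_lcomm)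
    also have "\<dots> = c \<otimes> (\<Oplus>i\<in>{..<n}. x i \<otimes> multilinear_ext R n (\<lambda>u. f ((t, i) # u)) w)"
      using Cons.prems(3) by (intro finsum_rdistr[symmetric]) (auto simp: c)
    finally show "(\<Oplus>i\<in>{..<n}. x i \<otimes> multilinear_ext R n (\<lambda>u. c \<otimes> f ((t, i) # u)) w) =
        c \<otimes> (\<Oplus>i\<in>{..<n}. x i \<otimes> multilinear_ext R n (\<lambda>u. f ((t, i) # u)) w)" .
  qed
  have v: "fst v \<in> {..<n} \<rightarrow> carrier R" "snd v \<in> {..<n} \<rightarrow> carrier R" using Cons.prems(1) by auto
  show ?case using sum[OF v(1)] sum[OF v(2)] cl[OF v(1)] cl[OF v(2)] Cons.prems(3)
    by (simp add: r_distr)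
qed simp

lemma multilinear_ext_zero:
  assumes "w \<in> lists (vectors n)"
  shows "multilinear_ext R n (\<lambda>u. \<zero>) w = \<zero>"
  using multilinear_ext_smult[OF assms, of "\<lambda>u. \<zero>" \<zero>] multilinear_ext_closed[OF assms, of "\<lambda>u. \<zero>"]
  by simp

lemma finsum_coeff_add:
  assumes "x \<in> {..<n} \<rightarrow> carrier R" "y \<in> {..<n} \<rightarrow> carrier R" "\<And>i. i < n \<Longrightarrow> m i \<in> carrier R"
    "\<And>i. i < n \<Longrightarrow> z i = x i \<oplus> y i"
  shows "(\<Oplus>i\<in>{..<n::nat}. z i \<otimes> m i) = (\<Oplus>i\<in>{..<n}. x i \<otimes> m i) \<oplus> (\<Oplus>i\<in>{..<n}. y i \<otimes> m i)"
proof -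
  have x: "x i \<in> carrier R" "y i \<in> carrier R" if "i < n" for i using assms(1,2) that by auto
  have "(\<Oplus>i\<in>{..<n}. z i \<otimes> m i) = (\<Oplus>i\<in>{..<n}. x i \<otimes> m i \<oplus> y i \<otimes> m i)"
    by (intro finsum_cong') (auto simp: x assms(3,4) l_distr)
  then show ?thesis by (subst (asm) finsum_addf) (auto simp: x assms(3))
qed

lemma finsum_coeff_smult:
  assumes "x \<in> {..<n} \<rightarrow> carrier R" "c \<in> carrier R" "\<And>i. i < n \<Longrightarrow> m i \<in> carrier R"
    "\<And>i. i < n \<Longrightarrow> z i = c \<otimes> x i"
  shows "(\<Oplus>i\<in>{..<n::nat}. z i \<otimes> m i) = c \<otimes> (\<Oplus>i\<in>{..<n}. x i \<otimes> m i)"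
proof -
  have x: "x i \<in> carrier R" if "i < n" for i using assms(1) that by auto
  have "(\<Oplus>i\<in>{..<n}. z i \<otimes> m i) = (\<Oplus>i\<in>{..<n}. c \<otimes> (x i \<otimes> m i))"
    by (intro finsum_cong') (auto simp: x assms(2,3,4) m_assoc)
  then show ?thesis using assms(2) by (subst finsum_rdistr) (auto simp: x assms(3))
qed

lemma multilinear_ext_Cons_add:
  assumes "w \<in> lists (vectors n)" "\<And>u. \<chi> u \<in> carrier R" "x \<in> vectors n" "y \<in> vectors n"
    and "\<And>i. i < n \<Longrightarrow> fst z i = fst x i \<oplus> fst y i" "\<And>i. i < n \<Longrightarrow> snd z i = snd x i \<oplus> snd y i"
  shows "multilinear_ext R n \<chi> (z # w) = multilinear_ext R n \<chi> (x # w) \<oplus> multilinear_ext R n \<chi> (y # w)"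
proof -
  have xy: "fst x \<in> {..<n} \<rightarrow> carrier R" "snd x \<in> {..<n} \<rightarrow> carrier R"
    "fst y \<in> {..<n} \<rightarrow> carrier R" "snd y \<in> {..<n} \<rightarrow> carrier R" using assms(3,4) by auto
  have m: "multilinear_ext R n (\<lambda>u. \<chi> ((t, i) # u)) w \<in> carrier R" for t i
    using assms(1,2) by (rule multilinear_ext_closed)
  have cl: "(\<Oplus>i\<in>{..<n}. a i \<otimes> multilinear_ext R n (\<lambda>u. \<chi> ((t, i) # u)) w) \<in> carrier R"
    if "a \<in> {..<n} \<rightarrow> carrier R" for a t using that m by (auto intro!: finsum_closed)
  show ?thesis
    using finsum_coeff_add[OF xy(1,3), of "\<lambda>i. multilinear_ext R n (\<lambda>u. \<chi> ((False, i) # u)) w" "fst z"]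
      finsum_coeff_add[OF xy(2,4), of "\<lambda>i. multilinear_ext R n (\<lambda>u. \<chi> ((True, i) # u)) w" "snd z"]
      assms(5,6) m cl[OF xy(1)] cl[OF xy(2)] cl[OF xy(3)] cl[OF xy(4)] by (simp add: a_ac)
qed

lemma multilinear_ext_Cons_smult:
  assumes "w \<in> lists (vectors n)" "\<And>u. \<chi> u \<in> carrier R" "x \<in> vectors n" "c \<in> carrier R"
    and "\<And>i. i < n \<Longrightarrow> fst z i = c \<otimes> fst x i" "\<And>i. i < n \<Longrightarrow> snd z i = c \<otimes> snd x i"
  shows "multilinear_ext R n \<chi> (z # w) = c \<otimes> multilinear_ext R n \<chi> (x # w)"
proof -
  have x: "fst x \<in> {..<n} \<rightarrow> carrier R" "snd x \<in> {..<n} \<rightarrow> carrier R" using assms(3) by auto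
  have m: "multilinear_ext R n (\<lambda>u. \<chi> ((t, i) # u)) w \<in> carrier R" for t i
    using assms(1,2) by (rule multilinear_ext_closed)
  have cl: "(\<Oplus>i\<in>{..<n}. a i \<otimes> multilinear_ext R n (\<lambda>u. \<chi> ((t, i) # u)) w) \<in> carrier R"
    if "a \<in> {..<n} \<rightarrow> carrier R" for a t using that m by (auto intro!: finsum_closed)
  show ?thesis
    using finsum_coeff_smult[OF x(1) assms(4), of "\<lambda>i. multilinear_ext R n (\<lambda>u. \<chi> ((False, i) # u)) w" "fst z"]
      finsum_coeff_smult[OF x(2) assms(4), of "\<lambda>i. multilinear_ext R n (\<lambda>u. \<chi> ((True, i) # u)) w" "snd z"]
      assms(4,5,6) m cl[OF x(1)] cl[OF x(2)] by (simp add: r_distr)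
qed

text \<open>
  The vector \<open>a\<close> placed in the first (\<open>False\<close>) or second (\<open>True\<close>) summand, that is, the argument of
  \<open>l\<close> or \<open>r\<close>.
\<close>

definition letter_vector :: "nat \<Rightarrow> bool \<Rightarrow> (nat \<Rightarrow> 'a) \<Rightarrow> (nat \<Rightarrow> 'a) \<times> (nat \<Rightarrow> 'a)" where
  "letter_vector n t a = (if t then (\<lambda>i\<in>{..<n}. \<zero>, a) else (a, \<lambda>i\<in>{..<n}. \<zero>))"

lemma letter_vector_vectors:
  "a \<in> {..<n} \<rightarrow> carrier R \<Longrightarrow> letter_vector n t a \<in> vectors n"
  by (auto simp: letter_vector_def)

lemma multilinear_ext_letter_vector:
  assumes "w \<in> lists (vectors n)" "\<And>u. \<chi> u \<in> carrier R" "a \<in> {..<n} \<rightarrow> carrier R"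
  shows "multilinear_ext R n \<chi> (letter_vector n t a # w) =
    (\<Oplus>i\<in>{..<n}. a i \<otimes> multilinear_ext R n (\<lambda>u. \<chi> ((t, i) # u)) w)"
proof -
  have m: "multilinear_ext R n (\<lambda>u. \<chi> ((s, i) # u)) w \<in> carrier R" for s i
    using assms(1,2) by (rule multilinear_ext_closed)
  have "(\<Oplus>i\<in>{..<n}. (\<lambda>i\<in>{..<n}. \<zero>) i \<otimes> multilinear_ext R n (\<lambda>u. \<chi> ((s, i) # u)) w) = \<zero>" for s
    by (rule add.finprod_one_eqI) (simp add: m)
  moreover have "(\<Oplus>i\<in>{..<n}. a i \<otimes> multilinear_ext R n (\<lambda>u. \<chi> ((s, i) # u)) w) \<in> carrier R" for s
    using assms(3) by (auto intro!: finsum_closed simp: m)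
  ultimately show ?thesis by (simp add: letter_vector_def)
qed

lemma multilinear_ext_letter_vector2:
  assumes w: "w \<in> lists (vectors n)" and \<chi>: "\<And>u. \<chi> u \<in> carrier R"
    and a: "a \<in> {..<n} \<rightarrow> carrier R" and b: "b \<in> {..<n} \<rightarrow> carrier R"
  shows "multilinear_ext R n \<chi> (letter_vector n t a # letter_vector n s b # w) =
    (\<Oplus>i\<in>{..<n}. \<Oplus>j\<in>{..<n}. a i \<otimes> b j \<otimes> multilinear_ext R n (\<lambda>u. \<chi> ((t, i) # (s, j) # u)) w)"
proof -
  have m: "multilinear_ext R n (\<lambda>u. \<chi> ((t, i) # (s, j) # u)) w \<in> carrier R" for i j
    using w \<chi> by (rule multilinear_ext_closed)
  have ab: "a i \<in> carrier R" "b i \<in> carrier R" if "i < n" for i using a b that by auto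
  have bw: "letter_vector n s b # w \<in> lists (vectors n)"
    using w letter_vector_vectors[OF b] by auto
  have "a i \<otimes> multilinear_ext R n (\<lambda>u. \<chi> ((t, i) # u)) (letter_vector n s b # w) =
      (\<Oplus>j\<in>{..<n}. a i \<otimes> b j \<otimes> multilinear_ext R n (\<lambda>u. \<chi> ((t, i) # (s, j) # u)) w)"
    if i: "i < n" for i
  proof -
    have "a i \<otimes> multilinear_ext R n (\<lambda>u. \<chi> ((t, i) # u)) (letter_vector n s b # w) =
        a i \<otimes> (\<Oplus>j\<in>{..<n}. b j \<otimes> multilinear_ext R n (\<lambda>u. \<chi> ((t, i) # (s, j) # u)) w)"
      using multilinear_ext_letter_vector[OF w _ b, of "\<lambda>u. \<chi> ((t, i) # u)" s] \<chi> by simp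
    also have "\<dots> = (\<Oplus>j\<in>{..<n}. a i \<otimes> (b j \<otimes> multilinear_ext R n (\<lambda>u. \<chi> ((t, i) # (s, j) # u)) w))"
      by (rule finsum_rdistr) (auto simp: ab i m)
    also have "\<dots> = (\<Oplus>j\<in>{..<n}. a i \<otimes> b j \<otimes> multilinear_ext R n (\<lambda>u. \<chi> ((t, i) # (s, j) # u)) w)"
      by (rule finsum_cong') (auto simp: ab i m m_assoc)
    finally show ?thesis .
  qed
  then show ?thesis
    unfolding multilinear_ext_letter_vector[OF bw \<chi> a]
    by (intro finsum_cong') (auto intro!: finsum_closed simp: ab m)
qed

lemma multilinear_ext_basis_letter:
  assumes "w \<in> lists (vectors n)" "\<And>u. \<chi> u \<in> carrier R" "i < n"
  shows "multilinear_ext R n \<chi> (letter_vector n t (\<lambda>j\<in>{..<n}. if j = i then \<one> else \<zero>) # w) =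
    multilinear_ext R n (\<lambda>u. \<chi> ((t, i) # u)) w"
proof -
  have m: "multilinear_ext R n (\<lambda>u. \<chi> ((t, j) # u)) w \<in> carrier R" for j
    using assms(1,2) by (rule multilinear_ext_closed)
  have "multilinear_ext R n \<chi> (letter_vector n t (\<lambda>j\<in>{..<n}. if j = i then \<one> else \<zero>) # w) =
      (\<Oplus>j\<in>{..<n}. if i = j then multilinear_ext R n (\<lambda>u. \<chi> ((t, j) # u)) w else \<zero>)"
    by (subst multilinear_ext_letter_vector[OF assms(1,2)]) (auto intro!: finsum_cong' simp: m)
  also have "\<dots> = multilinear_ext R n (\<lambda>u. \<chi> ((t, i) # u)) w"
    by (rule finsum_singleton) (auto simp: assms m)
  finally show ?thesis .
qed

end

context cring
begin

text \<open>
  The canonical map from the integers to the ring.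
\<close>

definition embed_int :: "int \<Rightarrow> 'a" where
  "embed_int k = [k] \<cdot> \<one>"

lemma embed_int_simps [simp]:
  "embed_int k \<in> carrier R" "embed_int 0 = \<zero>" "embed_int 1 = \<one>"
  "embed_int (k + l) = embed_int k \<oplus> embed_int l"
  "embed_int (- k) = \<ominus> embed_int k"
  by (simp_all add: embed_int_def add.int_pow_mult add.int_pow_neg add_pow_int_ge)

text \<open>
  A functional that respects the relations between generators extends to one that respects the
  defining relations of the enveloping algebra, which are quantified over all vectors.
\<close>

lemma multilinear_ext_relations:
  assumes \<chi>: "respects_relations \<chi>" and uw: "u \<in> lists (vectors n)" "w \<in> lists (vectors n)"
    and a: "a \<in> {..<n} \<rightarrow> carrier R" and b: "b \<in> {..<n} \<rightarrow> carrier R"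
  defines "M \<equiv> multilinear_ext R n (\<lambda>u. embed_int (\<chi> u))"
    and "l \<equiv> letter_vector n False" and "r \<equiv> letter_vector n True"
  shows "M (u @ [l a, l a] @ w) = \<zero>"
    and "M (u @ [r b, r b] @ w) = \<zero>"
    and "M (u @ [r b, l a] @ w) \<oplus> M (u @ [l b, l a] @ w) = M (u @ [l a, r b] @ w)"
    and "M (u @ [r b, l a] @ w) = M (u @ [l a, r b] @ w) \<oplus> M (u @ [r a, r b] @ w)"
proof -
  let ?N = "\<lambda>s x i y j. multilinear_ext R n (\<lambda>t. embed_int (\<chi> (s @ (x, i) # (y, j) # t))) w"
  let ?H = "\<lambda>x y c d s. (\<Oplus>i\<in>{..<n}. \<Oplus>j\<in>{..<n}. c i \<otimes> d j \<otimes> ?N s x i y j)"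
  have ab: "a i \<in> carrier R" "b i \<in> carrier R" if "i < n" for i using a b that by auto
  have N: "?N s x i y j \<in> carrier R" for s x i y j
    using uw(2) by (rule multilinear_ext_closed) simp
  have rel: "\<chi> (s @ (False, i) # (False, i) # t) = 0"
    "\<chi> (s @ (False, i) # (False, j) # t) = - \<chi> (s @ (False, j) # (False, i) # t)"
    "\<chi> (s @ (True, i) # (True, j) # t) = \<chi> (s @ (False, i) # (False, j) # t)"
    "\<chi> (s @ (True, j) # (False, i) # t) =
      \<chi> (s @ (False, i) # (True, j) # t) + \<chi> (s @ (False, i) # (False, j) # t)" for s t i j
    using \<chi> unfolding respects_relations_def append_Cons append_Nil by blast+
  have N_ll: "?N s False i False i = \<zero>" for s i
    by (simp add: rel(1) multilinear_ext_zero uw(2))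
  have N_sum: "?N s False i False j \<oplus> ?N s False j False i = \<zero>" for s i j
    using uw(2)
    by (subst multilinear_ext_add[symmetric]) (simp_all add: rel(2)[of s i j] l_neg multilinear_ext_zero)
  have N_rr: "?N s True i True j = ?N s False i False j" for s i j by (simp only: rel(3))
  have N_rl: "?N s True j False i = ?N s False i True j \<oplus> ?N s False i False j" for s i j
    using uw(2) by (subst multilinear_ext_add[symmetric]) (simp_all add: rel(4))
  have H: "?H x y c d s \<in> carrier R"
    if "c \<in> {..<n} \<rightarrow> carrier R" "d \<in> {..<n} \<rightarrow> carrier R" for x y c d s
    using that N by (auto intro!: finsum_closed simp: Pi_iff)
  have M: "M (u @ [letter_vector n x c, letter_vector n y d] @ w) = multilinear_ext R n (?H x y c d) u"
    if "c \<in> {..<n} \<rightarrow> carrier R" "d \<in> {..<n} \<rightarrow> carrier R" for x y c d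
    unfolding M_def multilinear_ext_append[of n _ u] append_Cons append_Nil
    using that by (subst multilinear_ext_letter_vector2[OF uw(2)]) auto
  have alt: "(\<Oplus>i\<in>{..<n}. \<Oplus>j\<in>{..<n}. c i \<otimes> c j \<otimes> ?N s False i False j) = \<zero>"
    if c: "\<And>i. i < n \<Longrightarrow> c i \<in> carrier R" for c s
  proof (rule finsum_alternating)
    fix i j assume ij: "i < n" "j < n"
    then show "c i \<otimes> c j \<otimes> ?N s False i False j \<in> carrier R" using c N by simp
    have "c i \<otimes> c j \<otimes> ?N s False i False j \<oplus> c j \<otimes> c i \<otimes> ?N s False j False i =
        c i \<otimes> c j \<otimes> (?N s False i False j \<oplus> ?N s False j False i)"
      using ij c N by (simp add: r_distr m_comm[of "c j" "c i"])
    then show "c i \<otimes> c j \<otimes> ?N s False i False j \<oplus> c j \<otimes> c i \<otimes> ?N s False j False i = \<zero>"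
      using N_sum ij c by simp
  next
    fix i assume "i < n"
    then show "c i \<otimes> c i \<otimes> ?N s False i False i = \<zero>" using c N_ll by simp
  qed
  show "M (u @ [l a, l a] @ w) = \<zero>"
    unfolding l_def M[OF a a] using alt[OF ab(1)] multilinear_ext_zero[OF uw(1)] by simp
  show "M (u @ [r b, r b] @ w) = \<zero>"
    unfolding r_def M[OF b b] N_rr using alt[OF ab(2)] multilinear_ext_zero[OF uw(1)] by simp
  have swap: "?H x y b a s = (\<Oplus>i\<in>{..<n}. \<Oplus>j\<in>{..<n}. a i \<otimes> b j \<otimes> ?N s x j y i)" for x y s
  proof -
    have "?H x y b a s = (\<Oplus>i\<in>{..<n}. \<Oplus>j\<in>{..<n}. b j \<otimes> a i \<otimes> ?N s x j y i)"
      by (rule finsum_swap) (auto simp: ab N)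
    also have "\<dots> = (\<Oplus>i\<in>{..<n}. \<Oplus>j\<in>{..<n}. a i \<otimes> b j \<otimes> ?N s x j y i)"
      by (intro finsum_cong') (auto intro!: finsum_closed finsum_cong' simp: ab N m_comm)
    finally show ?thesis .
  qed
  have add: "(\<Oplus>i\<in>{..<n}. \<Oplus>j\<in>{..<n}. a i \<otimes> b j \<otimes> f i j) \<oplus> (\<Oplus>i\<in>{..<n}. \<Oplus>j\<in>{..<n}. a i \<otimes> b j \<otimes> g i j)
      = (\<Oplus>i\<in>{..<n}. \<Oplus>j\<in>{..<n}. a i \<otimes> b j \<otimes> (f i j \<oplus> g i j))"
    if f: "\<And>i j. f i j \<in> carrier R" and g: "\<And>i j. g i j \<in> carrier R" for f g
  proof -
    have "(\<Oplus>i\<in>{..<n}. \<Oplus>j\<in>{..<n}. a i \<otimes> b j \<otimes> f i j) \<oplus> (\<Oplus>i\<in>{..<n}. \<Oplus>j\<in>{..<n}. a i \<otimes> b j \<otimes> g i j)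
        = (\<Oplus>i\<in>{..<n}. (\<Oplus>j\<in>{..<n}. a i \<otimes> b j \<otimes> f i j) \<oplus> (\<Oplus>j\<in>{..<n}. a i \<otimes> b j \<otimes> g i j))"
      by (rule finsum_addf[symmetric]) (auto intro!: finsum_closed simp: ab f g)
    also have "\<dots> = (\<Oplus>i\<in>{..<n}. \<Oplus>j\<in>{..<n}. a i \<otimes> b j \<otimes> f i j \<oplus> a i \<otimes> b j \<otimes> g i j)"
      by (intro finsum_cong' finsum_addf[symmetric]) (auto intro!: finsum_closed simp: ab f g)
    also have "\<dots> = (\<Oplus>i\<in>{..<n}. \<Oplus>j\<in>{..<n}. a i \<otimes> b j \<otimes> (f i j \<oplus> g i j))"
      by (intro finsum_cong') (auto intro!: finsum_closed finsum_cong' simp: ab f g r_distr)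
    finally show ?thesis .
  qed
  have "?H True False b a s \<oplus> ?H False False b a s = ?H False True a b s" for s
  proof -
    have "?N s True j False i \<oplus> ?N s False j False i = ?N s False i True j" for i j
      using N N_sum[of s i j] by (simp add: N_rl a_assoc)
    then show ?thesis unfolding swap using add[OF N N] by simp
  qed
  then show "M (u @ [r b, l a] @ w) \<oplus> M (u @ [l b, l a] @ w) = M (u @ [l a, r b] @ w)"
    unfolding r_def l_def M[OF b a] M[OF a b]
    by (subst multilinear_ext_add[OF uw(1) H[OF b a] H[OF b a], symmetric]) simp
  have "?H True False b a s = ?H False True a b s \<oplus> ?H True True a b s" for s
    unfolding swap unfolding N_rr N_rl by (rule add[OF N N, symmetric])
  then show "M (u @ [r b, l a] @ w) = M (u @ [l a, r b] @ w) \<oplus> M (u @ [r a, r b] @ w)"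
    unfolding r_def l_def M[OF b a] M[OF a b]
    by (subst multilinear_ext_add[OF uw(1) H[OF a b] H[OF a b], symmetric]) simp
qed

text \<open>
  The module \<open>K\<^sup>n \<oplus> K\<^sup>n\<close> whose tensor algebra covers the enveloping algebra.
\<close>

definition double_space :: "nat \<Rightarrow> ('a, (nat \<Rightarrow> 'a) \<times> (nat \<Rightarrow> 'a)) module" where
  "double_space n = direct_sum (abelian_algebra R n) (abelian_algebra R n)"

lemma double_space_simps:
  "carrier (double_space n) = ({..<n} \<rightarrow>\<^sub>E carrier R) \<times> ({..<n} \<rightarrow>\<^sub>E carrier R)"
  "x \<oplus>\<^bsub>double_space n\<^esub> y = (\<lambda>i\<in>{..<n}. fst x i \<oplus> fst y i, \<lambda>i\<in>{..<n}. snd x i \<oplus> snd y i)"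
  "c \<odot>\<^bsub>double_space n\<^esub> x = (\<lambda>i\<in>{..<n}. c \<otimes> fst x i, \<lambda>i\<in>{..<n}. c \<otimes> snd x i)"
  by (auto simp: double_space_def direct_sum_def abelian_algebra_def split: prod.splits)

lemma double_space_vectors: "x \<in> carrier (double_space n) \<Longrightarrow> x \<in> vectors n"
  by (auto simp: double_space_simps PiE_def)

lemma double_space_words: "w \<in> lists (carrier (double_space n)) \<Longrightarrow> w \<in> lists (vectors n)"
  unfolding in_lists_conv_set using double_space_vectors by blast

lemma letter_vector_double_space:
  "a \<in> {..<n} \<rightarrow>\<^sub>E carrier R \<Longrightarrow> letter_vector n t a \<in> carrier (double_space n)"
  by (auto simp: letter_vector_def double_space_simps)

text \<open>
  The value 0 at lists with entries outside \<open>K\<^sup>n \<oplus> K\<^sup>n\<close> makes the function total with values in the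
  ring.
\<close>

definition weight_functional :: "nat \<Rightarrow> ((bool \<times> nat) list \<Rightarrow> int) \<Rightarrow>
    ((nat \<Rightarrow> 'a) \<times> (nat \<Rightarrow> 'a)) list \<Rightarrow> 'a" where
  "weight_functional n \<chi> w = (if w \<in> lists (carrier (double_space n))
    then multilinear_ext R n (\<lambda>u. embed_int (\<chi> u)) w else \<zero>)"

lemma weight_functional_closed: "weight_functional n \<chi> w \<in> carrier R"
  using multilinear_ext_closed[OF double_space_words, of w n "\<lambda>u. embed_int (\<chi> u)"]
  by (simp add: weight_functional_def)

lemma weight_functional_add:
  assumes "u \<in> lists (carrier (double_space n))" "w \<in> lists (carrier (double_space n))"
    and x: "x \<in> carrier (double_space n)" and y: "y \<in> carrier (double_space n)"
  shows "weight_functional n \<chi> (u @ [x \<oplus>\<^bsub>double_space n\<^esub> y] @ w) =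
    weight_functional n \<chi> (u @ [x] @ w) \<oplus> weight_functional n \<chi> (u @ [y] @ w)"
proof -
  have uw: "u \<in> lists (vectors n)" "w \<in> lists (vectors n)"
    by (rule double_space_words[OF assms(1)], rule double_space_words[OF assms(2)])
  have xy: "x \<oplus>\<^bsub>double_space n\<^esub> y \<in> carrier (double_space n)"
    using x y by (simp add: double_space_simps mem_Times_iff PiE_iff)
  have v: "x # w \<in> lists (vectors n)" "y # w \<in> lists (vectors n)"
    by (intro lists.Cons double_space_vectors x y uw(2))+
  have "multilinear_ext R n (\<lambda>t. embed_int (\<chi> (s @ t))) ((x \<oplus>\<^bsub>double_space n\<^esub> y) # w) =
      multilinear_ext R n (\<lambda>t. embed_int (\<chi> (s @ t))) (x # w) \<oplus>
      multilinear_ext R n (\<lambda>t. embed_int (\<chi> (s @ t))) (y # w)" for s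
    by (rule multilinear_ext_Cons_add[OF uw(2) _ double_space_vectors[OF x] double_space_vectors[OF y]])
      (auto simp: double_space_simps)
  then have "multilinear_ext R n (\<lambda>t. embed_int (\<chi> t)) (u @ (x \<oplus>\<^bsub>double_space n\<^esub> y) # w) =
      multilinear_ext R n (\<lambda>t. embed_int (\<chi> t)) (u @ x # w) \<oplus>
      multilinear_ext R n (\<lambda>t. embed_int (\<chi> t)) (u @ y # w)"
    unfolding multilinear_ext_append[of n _ u]
    using multilinear_ext_closed[OF v(1)] multilinear_ext_closed[OF v(2)]
    by (subst multilinear_ext_add[OF uw(1), symmetric]) (simp_all del: multilinear_ext.simps)
  then show ?thesis using assms xy by (simp add: weight_functional_def)
qed

lemma weight_functional_smult:
  assumes "u \<in> lists (carrier (double_space n))" "w \<in> lists (carrier (double_space n))"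
    and x: "x \<in> carrier (double_space n)" and c: "c \<in> carrier R"
  shows "weight_functional n \<chi> (u @ [c \<odot>\<^bsub>double_space n\<^esub> x] @ w) =
    c \<otimes> weight_functional n \<chi> (u @ [x] @ w)"
proof -
  have uw: "u \<in> lists (vectors n)" "w \<in> lists (vectors n)"
    by (rule double_space_words[OF assms(1)], rule double_space_words[OF assms(2)])
  have cx: "c \<odot>\<^bsub>double_space n\<^esub> x \<in> carrier (double_space n)"
    using x c by (simp add: double_space_simps mem_Times_iff PiE_iff)
  have v: "x # w \<in> lists (vectors n)"
    by (intro lists.Cons double_space_vectors x uw(2))
  have "multilinear_ext R n (\<lambda>t. embed_int (\<chi> (s @ t))) ((c \<odot>\<^bsub>double_space n\<^esub> x) # w) =
      c \<otimes> multilinear_ext R n (\<lambda>t. embed_int (\<chi> (s @ t))) (x # w)" for s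
    by (rule multilinear_ext_Cons_smult[OF uw(2) _ double_space_vectors[OF x] c])
      (auto simp: double_space_simps)
  then have "multilinear_ext R n (\<lambda>t. embed_int (\<chi> t)) (u @ (c \<odot>\<^bsub>double_space n\<^esub> x) # w) =
      c \<otimes> multilinear_ext R n (\<lambda>t. embed_int (\<chi> t)) (u @ x # w)"
    unfolding multilinear_ext_append[of n _ u]
    using multilinear_ext_closed[OF v] c
    by (subst multilinear_ext_smult[OF uw(1), symmetric]) (simp_all del: multilinear_ext.simps)
  then show ?thesis using assms cx by (simp add: weight_functional_def)
qed

end

section \<open>The enveloping algebra of an abelian algebra\<close>

lemma (in abelian_group) minus_eq_zeroD:
  assumes "x \<ominus> y = \<zero>" "x \<in> carrier G" "y \<in> carrier G"
  shows "x = y"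
  using assms minus_equality[of x "\<ominus> y"] by (simp add: a_minus_def)

lemma (in abelian_group) add_minus_cancel:
  assumes "x \<in> carrier G" "y \<in> carrier G"
  shows "y \<oplus> (x \<ominus> y) = x"
  using assms a_lcomm[of y x "\<ominus> y"] by (simp add: a_minus_def r_neg)

lemma image_comprehension1:
  assumes "\<And>b. b \<in> A \<Longrightarrow> f b = q (g b)"
  shows "{f b | b. b \<in> A} = q ` {g b | b. b \<in> A}"
  using assms by (simp add: setcompr_eq_image image_image)

lemma image_comprehension2:
  assumes "\<And>a b. a \<in> A \<Longrightarrow> b \<in> B \<Longrightarrow> f a b = q (g a b)"
  shows "{f a b | a b. a \<in> A \<and> b \<in> B} = q ` {g a b | a b. a \<in> A \<and> b \<in> B}"
proof -
  have "{f a b | a b. a \<in> A \<and> b \<in> B} = {q (g a b) | a b. a \<in> A \<and> b \<in> B}"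
    using assms by (intro Collect_cong) metis
  also have "\<dots> = q ` {g a b | a b. a \<in> A \<and> b \<in> B}" by blast
  finally show ?thesis .
qed

text \<open>
  The tower of algebras: \<open>F\<close> is the free algebra on the set \<open>V = K\<^sup>n \<oplus> K\<^sup>n\<close>, \<open>T\<close> the tensor
  algebra and \<open>U\<close> the enveloping algebra; \<open>I\<close> and \<open>J\<close> are the ideals factored out. The sets \<open>lin_rels\<close>
  and \<open>alt_rels\<close> consist of elements of \<open>F\<close> that represent the generators of the two ideals, and
  \<open>proj\<close> is the projection from \<open>F\<close> to \<open>U\<close>. As products in \<open>K\<^sup>n\<close> vanish, only the zero vector
  occurs in the linear terms of \<open>alt_rels\<close>; its two copies \<open>(0, 0)\<close> coincide, and both are written
  \<open>word_l nil\<close>.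
\<close>

locale abelian_envelope = cring R for R :: "('k, 'm) ring_scheme" (structure) + fixes n :: nat
begin

abbreviation "A \<equiv> abelian_algebra R n"
abbreviation "V \<equiv> double_space n"
abbreviation "F \<equiv> free_algebra R (carrier V)"
abbreviation "I \<equiv> linearity_ideal R V"
abbreviation "T \<equiv> tensor_algebra R V"
abbreviation "J \<equiv> alt_ideal R A"
abbreviation "U \<equiv> U_Alt R A"
abbreviation "nil \<equiv> \<lambda>i\<in>{..<n}. \<zero>"
abbreviation "vect \<equiv> {..<n} \<rightarrow>\<^sub>E carrier R"
abbreviation "word_l a \<equiv> word R [letter_vector n False a]"
abbreviation "word_r a \<equiv> word R [letter_vector n True a]"

definition proj where "proj f = J +>\<^bsub>T\<^esub> (I +>\<^bsub>F\<^esub> f)"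

definition lin_rels where "lin_rels =
  {word R [x \<oplus>\<^bsub>V\<^esub> y] \<ominus>\<^bsub>F\<^esub> (word R [x] \<oplus>\<^bsub>F\<^esub> word R [y]) | x y. x \<in> carrier V \<and> y \<in> carrier V} \<union>
  {word R [c \<odot>\<^bsub>V\<^esub> x] \<ominus>\<^bsub>F\<^esub> (c \<odot>\<^bsub>F\<^esub> word R [x]) | c x. c \<in> carrier R \<and> x \<in> carrier V}"

definition alt_rels where "alt_rels =
  {(word_r b \<otimes>\<^bsub>F\<^esub> word_r b) \<ominus>\<^bsub>F\<^esub> word_l nil | b. b \<in> vect} \<union>
  {(word_l a \<otimes>\<^bsub>F\<^esub> word_l a) \<ominus>\<^bsub>F\<^esub> word_l nil | a. a \<in> vect} \<union>
  {(word_l nil \<ominus>\<^bsub>F\<^esub> (word_l b \<otimes>\<^bsub>F\<^esub> word_l a)) \<ominus>\<^bsub>F\<^esub>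
    ((word_r b \<otimes>\<^bsub>F\<^esub> word_l a) \<ominus>\<^bsub>F\<^esub> (word_l a \<otimes>\<^bsub>F\<^esub> word_r b)) | a b. a \<in> vect \<and> b \<in> vect} \<union>
  {((word_r b \<otimes>\<^bsub>F\<^esub> word_l a) \<ominus>\<^bsub>F\<^esub> (word_l a \<otimes>\<^bsub>F\<^esub> word_r b)) \<ominus>\<^bsub>F\<^esub>
    ((word_r a \<otimes>\<^bsub>F\<^esub> word_r b) \<ominus>\<^bsub>F\<^esub> word_l nil) | a b. a \<in> vect \<and> b \<in> vect}"

sublocale F: unital_algebra R F by (rule free_algebra_unital_algebra)

lemma free_gen_eq_word: "free_gen R x = word R [x]"
  by (simp add: free_gen_def word_def fun_eq_iff)

lemma V_closed [simp]:
  "\<lbrakk>x \<in> carrier V; y \<in> carrier V\<rbrakk> \<Longrightarrow> x \<oplus>\<^bsub>V\<^esub> y \<in> carrier V"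
  "\<lbrakk>c \<in> carrier R; x \<in> carrier V\<rbrakk> \<Longrightarrow> c \<odot>\<^bsub>V\<^esub> x \<in> carrier V"
  by (simp_all add: double_space_simps mem_Times_iff PiE_iff)

lemma nil_vect [simp]: "nil \<in> vect" by simp

lemma word_closed_F [simp]: "w \<in> lists (carrier V) \<Longrightarrow> word R w \<in> carrier F"
  by (rule word_in_free_algebra)

lemma word1_closed [simp]: "x \<in> carrier V \<Longrightarrow> word R [x] \<in> carrier F"
  by (rule word_in_free_algebra) simp

lemma letter_closed [simp]: "a \<in> vect \<Longrightarrow> letter_vector n t a \<in> carrier V"
  by (rule letter_vector_double_space)

lemma lin_rels_closed: "lin_rels \<subseteq> carrier F"
  unfolding lin_rels_def by auto

lemma linearity_ideal_eq: "I = Idl\<^bsub>F\<^esub> lin_rels"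
  unfolding linearity_ideal_def Let_def free_gen_eq_word lin_rels_def ..

lemma I_ideal: "ideal I F"
  unfolding linearity_ideal_eq by (rule F.A.genideal_ideal[OF lin_rels_closed])

lemma T_eq: "T = quotient_algebra F I"
  by (simp add: tensor_algebra_def)

sublocale q: unital_algebra_hom R F T "\<lambda>f. I +>\<^bsub>F\<^esub> f"
  using F.quotient_hom[OF I_ideal] by (simp only: T_eq)

lemma alt_rels_closed: "alt_rels \<subseteq> carrier F"
  unfolding alt_rels_def
  by (intro Un_least subsetI; elim CollectE exE conjE; hypsubst)
    (intro F.M.minus_closed F.A.m_closed word1_closed letter_closed nil_vect; assumption)+

lemma A_simps: "carrier A = vect" "\<zero>\<^bsub>A\<^esub> = nil" "x \<otimes>\<^bsub>A\<^esub> y = nil"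
  by (simp_all add: abelian_algebra_def)

lemma tensor_incl_letter:
  "tensor_incl R V (a, nil) = I +>\<^bsub>F\<^esub> word_l a" "tensor_incl R V (nil, a) = I +>\<^bsub>F\<^esub> word_r a"
  by (simp_all add: tensor_incl_def free_gen_eq_word letter_vector_def)

lemma alt_ideal_eq: "J = Idl\<^bsub>T\<^esub> ((\<lambda>f. I +>\<^bsub>F\<^esub> f) ` alt_rels)"
proof -
  let ?q = "\<lambda>f. I +>\<^bsub>F\<^esub> f"
  have "J = Idl\<^bsub>T\<^esub>
      ({(?q (word_r b) \<otimes>\<^bsub>T\<^esub> ?q (word_r b)) \<ominus>\<^bsub>T\<^esub> ?q (word_l nil) | b. b \<in> vect} \<union>
       {(?q (word_l a) \<otimes>\<^bsub>T\<^esub> ?q (word_l a)) \<ominus>\<^bsub>T\<^esub> ?q (word_l nil) | a. a \<in> vect} \<union>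
       {(?q (word_l nil) \<ominus>\<^bsub>T\<^esub> (?q (word_l b) \<otimes>\<^bsub>T\<^esub> ?q (word_l a))) \<ominus>\<^bsub>T\<^esub>
         ((?q (word_r b) \<otimes>\<^bsub>T\<^esub> ?q (word_l a)) \<ominus>\<^bsub>T\<^esub> (?q (word_l a) \<otimes>\<^bsub>T\<^esub> ?q (word_r b)))
         | a b. a \<in> vect \<and> b \<in> vect} \<union>
       {((?q (word_r b) \<otimes>\<^bsub>T\<^esub> ?q (word_l a)) \<ominus>\<^bsub>T\<^esub> (?q (word_l a) \<otimes>\<^bsub>T\<^esub> ?q (word_r b))) \<ominus>\<^bsub>T\<^esub>
         ((?q (word_r a) \<otimes>\<^bsub>T\<^esub> ?q (word_r b)) \<ominus>\<^bsub>T\<^esub> ?q (word_l nil))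
         | a b. a \<in> vect \<and> b \<in> vect})"
    unfolding alt_ideal_def Let_def double_space_def[symmetric] A_simps tensor_incl_letter ..
  also have "\<dots> = Idl\<^bsub>T\<^esub> (?q ` alt_rels)"
    unfolding alt_rels_def image_Un
    by (intro arg_cong2[where f = genideal] arg_cong2[where f = "(\<union>)"]
        image_comprehension1 image_comprehension2 refl) simp_all
  finally show ?thesis .
qed

lemma image_alt_rels_closed: "(\<lambda>f. I +>\<^bsub>F\<^esub> f) ` alt_rels \<subseteq> carrier T"
  using alt_rels_closed by (intro image_subsetI q.hom_closed) (rule subsetD)

lemma J_ideal: "ideal J T"
  unfolding alt_ideal_eq by (rule q.B.A.genideal_ideal[OF image_alt_rels_closed])

lemma U_eq: "U = quotient_algebra T J"
  by (simp add: U_Alt_def double_space_def)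

sublocale proj: unital_algebra_hom R F U proj
proof -
  have "unital_algebra_hom R T U (\<lambda>t. J +>\<^bsub>T\<^esub> t)"
    unfolding U_eq by (rule q.B.quotient_hom[OF J_ideal])
  from unital_algebra_hom_comp[OF q.unital_algebra_hom_axioms this]
  show "unital_algebra_hom R F U proj" unfolding proj_def .
qed

lemma proj_alt_rels:
  assumes "f \<in> alt_rels"
  shows "proj f = \<zero>\<^bsub>U\<^esub>"
proof -
  interpret J: ideal J T by (rule J_ideal)
  from q.B.A.genideal_self[OF image_alt_rels_closed]
  have "I +>\<^bsub>F\<^esub> f \<in> J" unfolding alt_ideal_eq using assms by blast
  then have "J +>\<^bsub>T\<^esub> (I +>\<^bsub>F\<^esub> f) = J" by (rule J.a_rcos_const)
  then show ?thesis unfolding proj_def U_eq q.B.quotient_algebra_simps .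
qed

lemma proj_lin_rels:
  assumes "f \<in> lin_rels"
  shows "proj f = \<zero>\<^bsub>U\<^esub>"
proof -
  interpret I: ideal I F by (rule I_ideal)
  interpret J: ideal J T by (rule J_ideal)
  have "f \<in> I" unfolding linearity_ideal_eq using F.A.genideal_self[OF lin_rels_closed] assms by blast
  then have "I +>\<^bsub>F\<^esub> f = \<zero>\<^bsub>T\<^esub>" unfolding T_eq F.quotient_algebra_simps by (rule I.a_rcos_const)
  then have "J +>\<^bsub>T\<^esub> (I +>\<^bsub>F\<^esub> f) = J" using J.a_rcos_const[OF J.zero_closed] by simp
  then show ?thesis unfolding proj_def U_eq q.B.quotient_algebra_simps .
qed

lemma proj_word_add:
  assumes "x \<in> carrier V" "y \<in> carrier V"
  shows "proj (word R [x \<oplus>\<^bsub>V\<^esub> y]) = proj (word R [x]) \<oplus>\<^bsub>U\<^esub> proj (word R [y])"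
proof -
  have "proj (word R [x \<oplus>\<^bsub>V\<^esub> y] \<ominus>\<^bsub>F\<^esub> (word R [x] \<oplus>\<^bsub>F\<^esub> word R [y])) = \<zero>\<^bsub>U\<^esub>"
    by (rule proj_lin_rels) (use assms in \<open>unfold lin_rels_def, blast\<close>)
  then show ?thesis using assms proj.B.M.minus_eq_zeroD by simp
qed

lemma proj_word_smult:
  assumes "c \<in> carrier R" "x \<in> carrier V"
  shows "proj (word R [c \<odot>\<^bsub>V\<^esub> x]) = c \<odot>\<^bsub>U\<^esub> proj (word R [x])"
proof -
  have "proj (word R [c \<odot>\<^bsub>V\<^esub> x] \<ominus>\<^bsub>F\<^esub> (c \<odot>\<^bsub>F\<^esub> word R [x])) = \<zero>\<^bsub>U\<^esub>"
    by (rule proj_lin_rels) (use assms in \<open>unfold lin_rels_def, blast\<close>)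
  then show ?thesis using assms proj.B.M.minus_eq_zeroD by simp
qed

lemma letter_nil: "letter_vector n t nil = \<zero> \<odot>\<^bsub>V\<^esub> letter_vector n t nil"
  by (simp add: letter_vector_def double_space_simps cong: restrict_cong)

lemma proj_word_nil: "proj (word R [letter_vector n t nil]) = \<zero>\<^bsub>U\<^esub>"
  by (subst letter_nil, subst proj_word_smult) simp_all

lemma letter_vector_add:
  assumes "a \<in> vect" "b \<in> vect"
  shows "letter_vector n t (\<lambda>i\<in>{..<n}. a i \<oplus> b i) = letter_vector n t a \<oplus>\<^bsub>V\<^esub> letter_vector n t b"
  by (simp add: letter_vector_def double_space_simps cong: restrict_cong)

lemma letter_vector_smult:
  assumes "a \<in> vect" "c \<in> carrier R"
  shows "letter_vector n t (\<lambda>i\<in>{..<n}. c \<otimes> a i) = c \<odot>\<^bsub>V\<^esub> letter_vector n t a"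
  using assms(2) by (simp add: letter_vector_def double_space_simps cong: restrict_cong)

text \<open>
  The relations solved for normal forms; antisymmetry comes from polarizing \<open>l\<^sub>c l\<^sub>c = 0\<close> at \<open>c = a + b\<close>.
\<close>

lemma U_relations:
  assumes a: "a \<in> vect" and b: "b \<in> vect"
  defines "l \<equiv> \<lambda>a. proj (word_l a)" and "r \<equiv> \<lambda>a. proj (word_r a)"
  shows "l a \<otimes>\<^bsub>U\<^esub> l a = \<zero>\<^bsub>U\<^esub>"
    and "l a \<otimes>\<^bsub>U\<^esub> l b = \<ominus>\<^bsub>U\<^esub> (l b \<otimes>\<^bsub>U\<^esub> l a)"
    and "r a \<otimes>\<^bsub>U\<^esub> r b = l a \<otimes>\<^bsub>U\<^esub> l b"
    and "r b \<otimes>\<^bsub>U\<^esub> l a = l a \<otimes>\<^bsub>U\<^esub> r b \<oplus>\<^bsub>U\<^esub> l a \<otimes>\<^bsub>U\<^esub> l b"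
proof -
  have cl: "l c \<in> carrier U" "r c \<in> carrier U" if "c \<in> vect" for c
    using that by (simp_all add: l_def r_def)
  have sq: "l c \<otimes>\<^bsub>U\<^esub> l c = \<zero>\<^bsub>U\<^esub>" if c: "c \<in> vect" for c
  proof -
    have "proj ((word_l c \<otimes>\<^bsub>F\<^esub> word_l c) \<ominus>\<^bsub>F\<^esub> word_l nil) = \<zero>\<^bsub>U\<^esub>"
      by (rule proj_alt_rels) (use c in \<open>unfold alt_rels_def, blast\<close>)
    then show ?thesis using c cl[OF c] by (simp add: proj_word_nil l_def a_minus_def proj.B.M.a_inv_zero)
  qed
  show "l a \<otimes>\<^bsub>U\<^esub> l a = \<zero>\<^bsub>U\<^esub>" by (rule sq[OF a])
  let ?X = "l b \<otimes>\<^bsub>U\<^esub> l a" and ?X' = "l a \<otimes>\<^bsub>U\<^esub> l b" and ?Y = "r b \<otimes>\<^bsub>U\<^esub> l a"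
    and ?Z = "l a \<otimes>\<^bsub>U\<^esub> r b" and ?W = "r a \<otimes>\<^bsub>U\<^esub> r b"
  have X: "?X \<in> carrier U" "?X' \<in> carrier U" "?Y \<in> carrier U" "?Z \<in> carrier U" "?W \<in> carrier U"
    using cl a b by simp_all
  have ab: "(\<lambda>i\<in>{..<n}. a i \<oplus> b i) \<in> vect" using a b by (auto simp: PiE_iff)
  have "l (\<lambda>i\<in>{..<n}. a i \<oplus> b i) = l a \<oplus>\<^bsub>U\<^esub> l b"
    unfolding l_def letter_vector_add[OF a b] using a b by (simp add: proj_word_add)
  then have "(l a \<oplus>\<^bsub>U\<^esub> l b) \<otimes>\<^bsub>U\<^esub> (l a \<oplus>\<^bsub>U\<^esub> l b) = \<zero>\<^bsub>U\<^esub>" using sq[OF ab] by simp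
  then have "?X' \<oplus>\<^bsub>U\<^esub> ?X = \<zero>\<^bsub>U\<^esub>"
    using cl[OF a] cl[OF b] sq[OF a] sq[OF b] X
    by (simp add: proj.B.A.l_distr proj.B.A.r_distr proj.B.M.a_comm)
  then have X': "?X' = \<ominus>\<^bsub>U\<^esub> ?X" using proj.B.M.minus_equality X by metis
  then show "?X' = \<ominus>\<^bsub>U\<^esub> ?X" .
  have "proj ((word_l nil \<ominus>\<^bsub>F\<^esub> (word_l b \<otimes>\<^bsub>F\<^esub> word_l a)) \<ominus>\<^bsub>F\<^esub>
      ((word_r b \<otimes>\<^bsub>F\<^esub> word_l a) \<ominus>\<^bsub>F\<^esub> (word_l a \<otimes>\<^bsub>F\<^esub> word_r b))) = \<zero>\<^bsub>U\<^esub>"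
    by (rule proj_alt_rels) (use a b in \<open>unfold alt_rels_def, blast\<close>)
  then have "(\<zero>\<^bsub>U\<^esub> \<ominus>\<^bsub>U\<^esub> ?X) \<ominus>\<^bsub>U\<^esub> (?Y \<ominus>\<^bsub>U\<^esub> ?Z) = \<zero>\<^bsub>U\<^esub>"
    using a b by (simp add: proj_word_nil l_def r_def)
  then have "\<zero>\<^bsub>U\<^esub> \<ominus>\<^bsub>U\<^esub> ?X = ?Y \<ominus>\<^bsub>U\<^esub> ?Z"
    using X proj.B.M.minus_eq_zeroD by simp
  then have YZ: "?Y \<ominus>\<^bsub>U\<^esub> ?Z = ?X'" using X by (simp add: X' a_minus_def)
  have "proj (((word_r b \<otimes>\<^bsub>F\<^esub> word_l a) \<ominus>\<^bsub>F\<^esub> (word_l a \<otimes>\<^bsub>F\<^esub> word_r b)) \<ominus>\<^bsub>F\<^esub>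
      ((word_r a \<otimes>\<^bsub>F\<^esub> word_r b) \<ominus>\<^bsub>F\<^esub> word_l nil)) = \<zero>\<^bsub>U\<^esub>"
    by (rule proj_alt_rels) (use a b in \<open>unfold alt_rels_def, blast\<close>)
  then have "(?Y \<ominus>\<^bsub>U\<^esub> ?Z) \<ominus>\<^bsub>U\<^esub> (?W \<ominus>\<^bsub>U\<^esub> \<zero>\<^bsub>U\<^esub>) = \<zero>\<^bsub>U\<^esub>"
    using a b by (simp add: proj_word_nil l_def r_def)
  then have "?Y \<ominus>\<^bsub>U\<^esub> ?Z = ?W \<ominus>\<^bsub>U\<^esub> \<zero>\<^bsub>U\<^esub>"
    using X proj.B.M.minus_eq_zeroD by simp
  then show "?W = ?X'" using X by (simp add: YZ) (simp add: a_minus_def proj.B.M.a_inv_zero)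
  have "?Y = ?Z \<oplus>\<^bsub>U\<^esub> (?Y \<ominus>\<^bsub>U\<^esub> ?Z)"
    using X by (simp add: proj.B.M.add_minus_cancel)
  then show "?Y = ?Z \<oplus>\<^bsub>U\<^esub> ?X'" unfolding YZ .
qed

text \<open>
  The standard basis vectors, the vector in \<open>V\<close> that belongs to a generator, and the value in \<open>U\<close> of a word
  in the generators. For an index \<open>i \<ge> n\<close> the unit vector is zero, so no bound on indices is needed in
  the relations.
\<close>

definition unit_vector :: "nat \<Rightarrow> nat \<Rightarrow> 'k" where
  "unit_vector i = (\<lambda>j\<in>{..<n}. if j = i then \<one> else \<zero>)"

definition vec :: "bool \<times> nat \<Rightarrow> (nat \<Rightarrow> 'k) \<times> (nat \<Rightarrow> 'k)" where
  "vec x = letter_vector n (fst x) (unit_vector (snd x))"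

definition ev where "ev w = proj (word R (map vec w))"

lemma unit_vector_vect [simp]: "unit_vector i \<in> vect"
  by (simp add: unit_vector_def)

lemma vec_closed [simp]: "vec x \<in> carrier V"
  by (simp add: vec_def)

lemma map_vec_closed [simp]: "map vec w \<in> lists (carrier V)"
  by (induction w) auto

lemma ev_closed: "ev w \<in> carrier U"
  unfolding ev_def by (intro proj.hom_closed word_closed_F map_vec_closed)

lemma ev_append: "ev (u @ v) = ev u \<otimes>\<^bsub>U\<^esub> ev v"
proof -
  have "ev (u @ v) = proj (word R (map vec u) \<otimes>\<^bsub>F\<^esub> word R (map vec v))"
    by (simp add: ev_def word_mult)
  then show ?thesis by (simp only: proj.hom_mult word_closed_F map_vec_closed ev_def)
qed

sublocale ev: word_evaluation R U ev
proof -
  have split: "ev (u @ x # y # v) = ev u \<otimes>\<^bsub>U\<^esub> (ev [x] \<otimes>\<^bsub>U\<^esub> ev [y]) \<otimes>\<^bsub>U\<^esub> ev v" for u v x y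
    using ev_append[of u "[x] @ [y] @ v"] ev_append[of "[x]" "[y] @ v"] ev_append[of "[y]" v]
    by (simp add: proj.B.A.m_assoc ev_closed)
  have ev1: "ev [(False, i)] = proj (word_l (unit_vector i))"
    "ev [(True, i)] = proj (word_r (unit_vector i))" for i
    by (simp_all add: ev_def vec_def)
  note rel = U_relations[OF unit_vector_vect unit_vector_vect, folded ev1]
  show "word_evaluation R U ev"
  proof (intro word_evaluation.intro word_evaluation_axioms.intro proj.B.module_axioms)
    fix u v i j
    show "ev (u @ (False, i) # (False, i) # v) = \<zero>\<^bsub>U\<^esub>"
      unfolding split rel(1) by (simp add: ev_closed)
    show "ev (u @ (False, i) # (False, j) # v) = \<ominus>\<^bsub>U\<^esub> ev (u @ (False, j) # (False, i) # v)"
      unfolding split rel(2)[of i j]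
      by (simp add: ev_closed proj.B.A.l_minus proj.B.A.r_minus)
    show "ev (u @ (True, i) # (True, j) # v) = ev (u @ (False, i) # (False, j) # v)"
      unfolding split rel(3) ..
    show "ev (u @ (True, j) # (False, i) # v) =
        ev (u @ (False, i) # (True, j) # v) \<oplus>\<^bsub>U\<^esub> ev (u @ (False, i) # (False, j) # v)"
      unfolding split rel(4)
      by (simp add: ev_closed proj.B.A.l_distr proj.B.A.r_distr)
  qed (rule ev_closed)
qed

lemma weight_functional_relations:
  assumes \<chi>: "respects_relations \<chi>" and u: "u \<in> lists (carrier V)" and v: "v \<in> lists (carrier V)"
    and a: "a \<in> vect" and b: "b \<in> vect"
  defines "p \<equiv> weight_functional n \<chi>"
    and "l \<equiv> letter_vector n False" and "r \<equiv> letter_vector n True"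
  shows "p (u @ [l a, l a] @ v) = \<zero>"
    and "p (u @ [r b, r b] @ v) = \<zero>"
    and "p (u @ [r b, l a] @ v) \<oplus> p (u @ [l b, l a] @ v) = p (u @ [l a, r b] @ v)"
    and "p (u @ [r b, l a] @ v) = p (u @ [l a, r b] @ v) \<oplus> p (u @ [r a, r b] @ v)"
    and "p (u @ [l nil] @ v) = \<zero>"
proof -
  have ab: "a \<in> {..<n} \<rightarrow> carrier R" "b \<in> {..<n} \<rightarrow> carrier R" using a b by (auto simp: PiE_iff)
  have p: "p (u @ [letter_vector n t c, letter_vector n s d] @ v) =
      multilinear_ext R n (\<lambda>u. embed_int (\<chi> u)) (u @ [letter_vector n t c, letter_vector n s d] @ v)"
    if "c \<in> vect" "d \<in> vect" for t s c d
  proof -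
    have "u @ [letter_vector n t c, letter_vector n s d] @ v \<in> lists (carrier V)"
      using u v letter_closed[OF that(1)] letter_closed[OF that(2)] by simp
    then show ?thesis unfolding p_def weight_functional_def by (rule if_P)
  qed
  note rel = multilinear_ext_relations[OF \<chi> double_space_words[OF u] double_space_words[OF v] ab]
  show "p (u @ [l a, l a] @ v) = \<zero>" unfolding l_def p[OF a a] by (rule rel)
  show "p (u @ [r b, r b] @ v) = \<zero>" unfolding r_def p[OF b b] by (rule rel)
  show "p (u @ [r b, l a] @ v) \<oplus> p (u @ [l b, l a] @ v) = p (u @ [l a, r b] @ v)"
    unfolding r_def l_def p[OF b a] p[OF a b] by (rule rel)
  show "p (u @ [r b, l a] @ v) = p (u @ [l a, r b] @ v) \<oplus> p (u @ [r a, r b] @ v)"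
    unfolding r_def l_def p[OF b a] p[OF a b] by (rule rel)
  have "p (u @ [\<zero> \<odot>\<^bsub>V\<^esub> l nil] @ v) = \<zero> \<otimes> p (u @ [l nil] @ v)"
    unfolding p_def l_def by (rule weight_functional_smult[OF u v]) simp_all
  moreover have "\<zero> \<odot>\<^bsub>V\<^esub> l nil = l nil" unfolding l_def by (rule letter_nil[symmetric])
  ultimately show "p (u @ [l nil] @ v) = \<zero>"
    unfolding p_def by (simp add: weight_functional_closed)
qed

text \<open>
  The extended functionals descend to the enveloping algebra.
\<close>

lemma weight_functional_kernel:
  assumes \<chi>: "respects_relations \<chi>" and f: "f \<in> carrier F" "proj f = \<zero>\<^bsub>U\<^esub>"
  shows "word_functional R (weight_functional n \<chi>) f = \<zero>"
proof (rule annihilator_idealD)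
  let ?p = "weight_functional n \<chi>"
  let ?N = "annihilator_ideal R (carrier V) ?p"
  let ?\<phi> = "\<lambda>u v f. word_functional R ?p (word R u \<otimes>\<^bsub>F\<^esub> f \<otimes>\<^bsub>F\<^esub> word R v)"
  note p = weight_functional_closed[of n \<chi>]
  have \<phi>_closed: "?\<phi> u v f \<in> carrier R"
    if "u \<in> lists (carrier V)" "v \<in> lists (carrier V)" "f \<in> carrier F" for u v f
    using that p by (intro word_functional_closed[where X = "carrier V"] F.A.m_closed word_closed_F)
  have \<phi>_add: "?\<phi> u v (f \<oplus>\<^bsub>F\<^esub> g) = ?\<phi> u v f \<oplus> ?\<phi> u v g"
    and \<phi>_minus: "?\<phi> u v (f \<ominus>\<^bsub>F\<^esub> g) = ?\<phi> u v f \<ominus> ?\<phi> u v g"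
    if "u \<in> lists (carrier V)" "v \<in> lists (carrier V)" "f \<in> carrier F" "g \<in> carrier F" for u v f g
  proof -
    have uv: "word R u \<in> carrier F" "word R v \<in> carrier F" using that by simp_all
    show "?\<phi> u v (f \<oplus>\<^bsub>F\<^esub> g) = ?\<phi> u v f \<oplus> ?\<phi> u v g"
      using uv that(3,4) p by (simp add: F.A.l_distr F.A.r_distr word_functional_add)
    have "word R u \<otimes>\<^bsub>F\<^esub> (f \<ominus>\<^bsub>F\<^esub> g) \<otimes>\<^bsub>F\<^esub> word R v =
        (word R u \<otimes>\<^bsub>F\<^esub> f \<otimes>\<^bsub>F\<^esub> word R v) \<ominus>\<^bsub>F\<^esub> (word R u \<otimes>\<^bsub>F\<^esub> g \<otimes>\<^bsub>F\<^esub> word R v)"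
      using uv that(3,4)
      by (simp add: a_minus_def F.A.l_distr F.A.r_distr F.A.l_minus F.A.r_minus)
    then show "?\<phi> u v (f \<ominus>\<^bsub>F\<^esub> g) = ?\<phi> u v f \<ominus> ?\<phi> u v g"
      using uv that(3,4) p by (simp add: word_functional_minus)
  qed
  have \<phi>_smult: "?\<phi> u v (c \<odot>\<^bsub>F\<^esub> f) = c \<otimes> ?\<phi> u v f"
    if "u \<in> lists (carrier V)" "v \<in> lists (carrier V)" "f \<in> carrier F" "c \<in> carrier R" for u v f c
  proof -
    have uv: "word R u \<in> carrier F" "word R v \<in> carrier F" using that by simp_all
    show ?thesis
      using uv that(3,4) p by (simp add: F.mult_smult_l F.mult_smult_r word_functional_smult)
  qed
  have \<phi>_word: "?\<phi> u v (word R s) = ?p (u @ s @ v)"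
    if "u \<in> lists (carrier V)" "v \<in> lists (carrier V)" "s \<in> lists (carrier V)" for u v s
  proof -
    have "u @ s @ v \<in> lists (carrier V)" using that by simp
    then show ?thesis using p by (simp only: word_mult append_assoc word_functional_word[where X = "carrier V"])
  qed
  have lists: "\<And>x. x \<in> carrier V \<Longrightarrow> [x] \<in> lists (carrier V)"
    "\<And>x y. \<lbrakk>x \<in> carrier V; y \<in> carrier V\<rbrakk> \<Longrightarrow> [x, y] \<in> lists (carrier V)" by simp_all
  have N: "f \<in> ?N" if "f \<in> carrier F"
    "\<And>u v. \<lbrakk>u \<in> lists (carrier V); v \<in> lists (carrier V)\<rbrakk> \<Longrightarrow> ?\<phi> u v f = \<zero>" for f
    using p that by (rule annihilator_idealI)
  have lin: "lin_rels \<subseteq> ?N"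
  proof
    fix f assume f: "f \<in> lin_rels"
    show "f \<in> ?N"
    proof (rule N)
      show "f \<in> carrier F" using f lin_rels_closed by blast
      fix u v assume uv: "u \<in> lists (carrier V)" "v \<in> lists (carrier V)"
      consider (add) x y where "x \<in> carrier V" "y \<in> carrier V"
          "f = word R [x \<oplus>\<^bsub>V\<^esub> y] \<ominus>\<^bsub>F\<^esub> (word R [x] \<oplus>\<^bsub>F\<^esub> word R [y])"
        | (smult) c x where "c \<in> carrier R" "x \<in> carrier V"
          "f = word R [c \<odot>\<^bsub>V\<^esub> x] \<ominus>\<^bsub>F\<^esub> (c \<odot>\<^bsub>F\<^esub> word R [x])"
        using f unfolding lin_rels_def by blast
      then show "?\<phi> u v f = \<zero>"
      proof cases
        case add
        have "?\<phi> u v f = ?p (u @ [x \<oplus>\<^bsub>V\<^esub> y] @ v) \<ominus> (?p (u @ [x] @ v) \<oplus> ?p (u @ [y] @ v))"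
          unfolding add(3) using uv add(1,2)
          by (simp only: \<phi>_minus \<phi>_add \<phi>_word lists V_closed word1_closed F.M.a_closed)
        then show ?thesis
          unfolding weight_functional_add[OF uv add(1,2)] using p by (simp add: a_minus_def r_neg)
      next
        case smult
        have "?\<phi> u v f = ?p (u @ [c \<odot>\<^bsub>V\<^esub> x] @ v) \<ominus> c \<otimes> ?p (u @ [x] @ v)"
          unfolding smult(3) using uv smult(1,2)
          by (simp only: \<phi>_minus \<phi>_smult \<phi>_word lists V_closed word1_closed F.smult_closed)
        then show ?thesis
          unfolding weight_functional_smult[OF uv smult(2,1)] using p smult(1)
          by (simp add: a_minus_def r_neg)
      qed
    qed
  qed
  have alt: "alt_rels \<subseteq> ?N"
  proof
    fix f assume f: "f \<in> alt_rels"
    let ?l = "letter_vector n False" and ?r = "letter_vector n True"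
    show "f \<in> ?N"
    proof (rule N)
      show "f \<in> carrier F" using f alt_rels_closed by blast
      fix u v assume uv: "u \<in> lists (carrier V)" "v \<in> lists (carrier V)"
      have \<phi>2: "?\<phi> u v (word R [x] \<otimes>\<^bsub>F\<^esub> word R [y]) = ?p (u @ [x, y] @ v)"
        if "x \<in> carrier V" "y \<in> carrier V" for x y
        using \<phi>_word[OF uv lists(2)[OF that]] by (simp only: word_mult append_Cons append_Nil)
      note \<phi>_simps = \<phi>_minus \<phi>2 \<phi>_word lists letter_closed nil_vect word1_closed
        F.A.m_closed F.M.minus_closed
      note rel = weight_functional_relations[OF \<chi> uv]
      consider (r) b where "b \<in> vect" "f = (word_r b \<otimes>\<^bsub>F\<^esub> word_r b) \<ominus>\<^bsub>F\<^esub> word_l nil"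
        | (l) a where "a \<in> vect" "f = (word_l a \<otimes>\<^bsub>F\<^esub> word_l a) \<ominus>\<^bsub>F\<^esub> word_l nil"
        | (ll) a b where "a \<in> vect" "b \<in> vect" "f = (word_l nil \<ominus>\<^bsub>F\<^esub> (word_l b \<otimes>\<^bsub>F\<^esub> word_l a)) \<ominus>\<^bsub>F\<^esub>
          ((word_r b \<otimes>\<^bsub>F\<^esub> word_l a) \<ominus>\<^bsub>F\<^esub> (word_l a \<otimes>\<^bsub>F\<^esub> word_r b))"
        | (rr) a b where "a \<in> vect" "b \<in> vect" "f = ((word_r b \<otimes>\<^bsub>F\<^esub> word_l a) \<ominus>\<^bsub>F\<^esub>
          (word_l a \<otimes>\<^bsub>F\<^esub> word_r b)) \<ominus>\<^bsub>F\<^esub> ((word_r a \<otimes>\<^bsub>F\<^esub> word_r b) \<ominus>\<^bsub>F\<^esub> word_l nil)"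
        using f unfolding alt_rels_def by blast
      then show "?\<phi> u v f = \<zero>"
      proof cases
        case r
        have "?\<phi> u v f = ?p (u @ [?r b, ?r b] @ v) \<ominus> ?p (u @ [?l nil] @ v)"
          unfolding r(2) using uv r(1) by (simp only: \<phi>_simps)
        then show ?thesis unfolding rel(2)[OF r(1,1)] rel(5)[OF r(1,1)] by (simp add: a_minus_def)
      next
        case l
        have "?\<phi> u v f = ?p (u @ [?l a, ?l a] @ v) \<ominus> ?p (u @ [?l nil] @ v)"
          unfolding l(2) using uv l(1) by (simp only: \<phi>_simps)
        then show ?thesis unfolding rel(1)[OF l(1,1)] rel(5)[OF l(1,1)] by (simp add: a_minus_def)
      next
        case ll
        have "?\<phi> u v f = (?p (u @ [?l nil] @ v) \<ominus> ?p (u @ [?l b, ?l a] @ v)) \<ominus>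
            (?p (u @ [?r b, ?l a] @ v) \<ominus> ?p (u @ [?l a, ?r b] @ v))"
          unfolding ll(3) using uv ll(1,2) by (simp only: \<phi>_simps)
        also have "\<dots> = \<zero>"
          unfolding rel(5)[OF ll(1,2)] rel(3)[OF ll(1,2), symmetric]
          using p[of "u @ [?l b, ?l a] @ v"] p[of "u @ [?r b, ?l a] @ v"] by algebra
        finally show ?thesis .
      next
        case rr
        have "?\<phi> u v f = (?p (u @ [?r b, ?l a] @ v) \<ominus> ?p (u @ [?l a, ?r b] @ v)) \<ominus>
            (?p (u @ [?r a, ?r b] @ v) \<ominus> ?p (u @ [?l nil] @ v))"
          unfolding rr(3) using uv rr(1,2) by (simp only: \<phi>_simps)
        also have "\<dots> = \<zero>"
          unfolding rel(5)[OF rr(1,2)] rel(4)[OF rr(1,2)]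
          using p[of "u @ [?l a, ?r b] @ v"] p[of "u @ [?r a, ?r b] @ v"] by algebra
        finally show ?thesis .
      qed
    qed
  qed
  show "f \<in> ?N"
  proof (rule F.iterated_quotient_kernel[OF annihilator_ideal_ideal[OF p] lin linearity_ideal_eq])
    show "J = Idl\<^bsub>quotient_algebra F I\<^esub> ((\<lambda>f. I +>\<^bsub>F\<^esub> f) ` alt_rels)"
      using alt_ideal_eq unfolding T_eq .
    show "(\<lambda>f. I +>\<^bsub>F\<^esub> f) ` alt_rels \<subseteq> (\<lambda>f. I +>\<^bsub>F\<^esub> f) ` ?N" using alt by (rule image_mono)
    show "f \<in> carrier F" by (rule f)
    show "J +>\<^bsub>quotient_algebra F I\<^esub> (I +>\<^bsub>F\<^esub> f) = J"
    proof -
      have "proj f = J" using f(2) unfolding U_eq q.B.quotient_algebra_simps .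
      then show ?thesis unfolding proj_def T_eq .
    qed
  qed
qed

lemma weight_functional_map_vec:
  assumes "snd ` set w \<subseteq> {..<n}"
  shows "weight_functional n \<chi> (map vec w) = embed_int (\<chi> w)"
proof -
  have "multilinear_ext R n \<psi> (map vec w) = \<psi> w" if "\<And>u. \<psi> u \<in> carrier R" for \<psi>
    using assms that
  proof (induction w arbitrary: \<psi>)
    case (Cons x w)
    have "multilinear_ext R n \<psi> (map vec (x # w)) =
        multilinear_ext R n (\<lambda>u. \<psi> ((fst x, snd x) # u)) (map vec w)"
      using multilinear_ext_basis_letter[OF double_space_words[OF map_vec_closed] Cons.prems(2),
          where i = "snd x" and t = "fst x"] Cons.prems(1)
      by (simp add: vec_def unit_vector_def del: multilinear_ext.simps)
    then show ?case using Cons by simp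
  qed simp
  then show ?thesis by (simp add: weight_functional_def del: in_lists_conv_set)
qed

section \<open>Bases of the weight components\<close>

lemma proj_letter_in_lspan:
  assumes a: "a \<in> vect"
  shows "proj (word R [letter_vector n t a]) \<in> lspan R U ((\<lambda>i. ev [(t, i)]) ` {..<n})"
proof -
  let ?S = "(\<lambda>i. ev [(t, i)]) ` {..<n}"
  have S: "?S \<subseteq> carrier U" by (intro image_subsetI ev_closed)
  \<comment> \<open>Truncations of the vector allow induction on the number of nonzero coordinates.\<close>
  let ?a = "\<lambda>m. \<lambda>i\<in>{..<n}. if i < m then a i else \<zero>"
  have av: "a i \<in> carrier R" if "i < n" for i using a that by auto
  have "proj (word R [letter_vector n t (?a m)]) \<in> lspan R U ?S" if "m \<le> n" for m
    using that
  proof (induction m)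
    case 0
    have "?a 0 = nil" by simp
    then show ?case using proj_word_nil lspan.lspan_zero by metis
  next
    case (Suc m)
    have m: "?a m \<in> vect" "(\<lambda>i\<in>{..<n}. a m \<otimes> unit_vector m i) \<in> vect"
      using av Suc.prems by (auto simp: PiE_iff unit_vector_def)
    have "?a (Suc m) = (\<lambda>i\<in>{..<n}. ?a m i \<oplus> (\<lambda>i\<in>{..<n}. a m \<otimes> unit_vector m i) i)"
      using av Suc.prems by (auto simp: fun_eq_iff unit_vector_def restrict_def less_Suc_eq)
    then have "letter_vector n t (?a (Suc m)) =
        letter_vector n t (?a m) \<oplus>\<^bsub>V\<^esub> a m \<odot>\<^bsub>V\<^esub> letter_vector n t (unit_vector m)"
      using letter_vector_add[OF m] letter_vector_smult[OF unit_vector_vect av] Suc.prems by simp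
    then have eq: "proj (word R [letter_vector n t (?a (Suc m))]) =
        proj (word R [letter_vector n t (?a m)]) \<oplus>\<^bsub>U\<^esub> a m \<odot>\<^bsub>U\<^esub> ev [(t, m)]"
      using m(1) av[of m] Suc.prems
      by (simp add: proj_word_add proj_word_smult ev_def vec_def)
    have base: "ev [(t, m)] \<in> lspan R U ?S"
      using Suc.prems by (intro proj.B.lspan_base[OF _ S] imageI) simp
    have IH: "proj (word R [letter_vector n t (?a m)]) \<in> lspan R U ?S"
      by (rule Suc.IH) (use Suc.prems in simp)
    show ?case
      unfolding eq
      by (intro proj.B.lspan_add[OF _ _ S] proj.B.lspan_smult[OF _ _ S] IH base av)
        (use Suc.prems in simp)
  qed
  from this[of n] have "proj (word R [letter_vector n t (?a n)]) \<in> lspan R U ?S" by simp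
  moreover have "?a n = a" using a by (auto simp: fun_eq_iff restrict_def PiE_iff extensional_def)
  ultimately show ?thesis by simp
qed

text \<open>
  The words of length \<open>k\<close> in the generators with valid indices.
\<close>

definition letter_words :: "nat \<Rightarrow> (bool \<times> nat) list set" where
  "letter_words k = {w. snd ` set w \<subseteq> {..<n} \<and> length w = k}"

lemma ev_letter_words_closed: "ev ` letter_words k \<subseteq> carrier U"
  by (intro image_subsetI ev_closed)

lemma proj_word1_in_lspan:
  assumes v: "v \<in> carrier V"
  shows "proj (word R [v]) \<in> lspan R U (ev ` letter_words 1)"
proof -
  obtain a b where ab: "v = (a, b)" "a \<in> vect" "b \<in> vect"
    using v by (auto simp: double_space_simps)
  have ext: "(\<lambda>i\<in>{..<n}. c i) = c" if "c \<in> vect" for c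
    using that by (simp add: PiE_iff extensional_restrict)
  have "v = letter_vector n False a \<oplus>\<^bsub>V\<^esub> letter_vector n True b"
  proof -
    have "(\<lambda>i\<in>{..<n}. a i \<oplus> nil i) = (\<lambda>i\<in>{..<n}. a i)" "(\<lambda>i\<in>{..<n}. nil i \<oplus> b i) = (\<lambda>i\<in>{..<n}. b i)"
      using ab(2,3) by (auto intro!: restrict_ext simp: PiE_iff)
    then show ?thesis
      unfolding ab(1) letter_vector_def double_space_simps
      by (simp only: if_True if_False fst_conv snd_conv simp_thms ext ab)
  qed
  then have "proj (word R [v]) = proj (word_l a) \<oplus>\<^bsub>U\<^esub> proj (word_r b)"
    using proj_word_add[OF letter_closed[OF ab(2)] letter_closed[OF ab(3)]] by simp
  moreover have mono: "(\<lambda>i. ev [(t, i)]) ` {..<n} \<subseteq> ev ` letter_words 1" for t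
    by (intro image_subsetI imageI) (simp add: letter_words_def)
  ultimately show ?thesis
    using lspan_mono[OF proj_letter_in_lspan[OF ab(2)] mono]
      lspan_mono[OF proj_letter_in_lspan[OF ab(3)] mono]
      proj.B.lspan_add[OF _ _ ev_letter_words_closed] by simp
qed

lemma proj_word_in_lspan_letter_words:
  assumes "w \<in> lists (carrier V)"
  shows "proj (word R w) \<in> lspan R U (ev ` letter_words (length w))"
  using assms
proof (induction w rule: list.induct)
  case Nil
  have "proj (word R []) = ev []" by (simp add: ev_def)
  moreover have "[] \<in> letter_words 0" by (simp add: letter_words_def)
  ultimately show ?case
    using proj.B.lspan_base[OF _ ev_letter_words_closed] by (metis imageI list.size(3))
next
  case (Cons v w)
  have v: "v \<in> carrier V" and w: "w \<in> lists (carrier V)" using Cons.prems by auto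
  have "proj (word R (v # w)) = proj (word R [v] \<otimes>\<^bsub>F\<^esub> word R w)" by (simp add: word_mult)
  also have "\<dots> = proj (word R [v]) \<otimes>\<^bsub>U\<^esub> proj (word R w)"
    using v w by (intro proj.hom_mult word1_closed word_closed_F)
  also have "\<dots> \<in> lspan R U {s \<otimes>\<^bsub>U\<^esub> t | s t. s \<in> ev ` letter_words 1 \<and> t \<in> ev ` letter_words (length w)}"
    by (rule proj.B.lspan_mult[OF proj_word1_in_lspan[OF v] Cons.IH[OF w]]) (rule ev_letter_words_closed)+
  finally show ?case
  proof (rule lspan_mono)
    have "ev x \<otimes>\<^bsub>U\<^esub> ev y \<in> ev ` letter_words (length (v # w))"
      if "x \<in> letter_words 1" "y \<in> letter_words (length w)" for x y
      unfolding ev_append[symmetric] using that by (intro imageI) (auto simp: letter_words_def)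
    then show "{s \<otimes>\<^bsub>U\<^esub> t | s t. s \<in> ev ` letter_words 1 \<and> t \<in> ev ` letter_words (length w)} \<subseteq>
        ev ` letter_words (length (v # w))" by blast
  qed
qed

lemma r_indexD: "xs \<in> r_index n k \<Longrightarrow> xs \<noteq> [] \<and> set xs \<subseteq> {..<n} \<and> length xs = k"
  by (auto simp: r_index_def increasing_lists_def split: if_splits)

lemma basis_words_letter_words: "basis_words n k \<subseteq> letter_words k"
proof
  fix w assume "w \<in> basis_words n k"
  then consider (l) xs where "w = l_word xs" "set xs \<subseteq> {..<n}" "length xs = k"
    | (r) xs where "w = r_word xs" "xs \<noteq> []" "set xs \<subseteq> {..<n}" "length xs = k"
    unfolding basis_words_def increasing_lists_def using r_indexD by blast
  then have "set (map snd w) \<subseteq> {..<n} \<and> length (map snd w) = k"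
    by cases (simp_all add: map_snd_l_word map_snd_r_word del: set_map length_map)
  then show "w \<in> letter_words k" by (simp add: letter_words_def)
qed

text \<open>
  The weight \<open>k\<close> component of the free algebra.
\<close>

definition homogeneous :: "nat \<Rightarrow> (((nat \<Rightarrow> 'k) \<times> (nat \<Rightarrow> 'k)) list \<Rightarrow> 'k) set" where
  "homogeneous k = {f \<in> carrier F. \<forall>w. length w \<noteq> k \<longrightarrow> f w = \<zero>}"

lemma proj_homogeneous_in_lspan:
  assumes "f \<in> homogeneous k"
  shows "proj f \<in> lspan R U (ev ` basis_words n k)"
proof -
  let ?W = "{w. f w \<noteq> \<zero>}"
  have f: "f \<in> carrier F" and k: "\<And>w. w \<in> ?W \<Longrightarrow> length w = k"
    using assms by (auto simp: homogeneous_def)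
  have W: "w \<in> lists (carrier V)" if "w \<in> ?W" for w
    using f that unfolding free_algebra_carrier_iff mem_Collect_eq by blast
  have C: "ev ` basis_words n k \<subseteq> carrier U" by (intro image_subsetI ev_closed)
  have letters: "ev ` letter_words k \<subseteq> lspan R U (ev ` basis_words n k)"
    using ev.ev_in_lspan_basis_words by (auto simp: letter_words_def)
  have "proj f \<in> lspan R U (proj ` word R ` ?W)"
    using W by (intro proj.hom_lspan free_algebra_lspan f image_subsetI word_closed_F)
  moreover have "proj ` word R ` ?W \<subseteq> lspan R U (ev ` basis_words n k)"
  proof (intro image_subsetI, elim imageE, hypsubst)
    fix w assume w: "w \<in> ?W"
    show "proj (word R w) \<in> lspan R U (ev ` basis_words n k)"
      using proj_word_in_lspan_letter_words[OF W[OF w]] unfolding k[OF w]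
      by (rule proj.B.lspan_subset[OF _ letters C])
  qed
  ultimately show ?thesis by (rule proj.B.lspan_subset[OF _ _ C])
qed

lemma U_Alt_weight_eq: "U_Alt_weight R A k = U\<lparr>carrier := proj ` homogeneous k\<rparr>"
proof -
  have "{J +>\<^bsub>T\<^esub> t | t. t \<in> tensor_power R V k} = proj ` homogeneous k"
    unfolding tensor_power_def Let_def homogeneous_def proj_def by blast
  then show ?thesis by (simp add: U_Alt_weight_def Let_def double_space_def)
qed

lemma homogeneous_closed: "homogeneous k \<subseteq> carrier F"
  by (auto simp: homogeneous_def)

lemma homogeneous_submodule:
  "\<zero>\<^bsub>F\<^esub> \<in> homogeneous k"
  "\<lbrakk>f \<in> homogeneous k; g \<in> homogeneous k\<rbrakk> \<Longrightarrow> f \<oplus>\<^bsub>F\<^esub> g \<in> homogeneous k"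
  "\<lbrakk>c \<in> carrier R; f \<in> homogeneous k\<rbrakk> \<Longrightarrow> c \<odot>\<^bsub>F\<^esub> f \<in> homogeneous k"
proof -
  show "\<zero>\<^bsub>F\<^esub> \<in> homogeneous k"
    unfolding homogeneous_def using F.M.zero_closed by (simp add: free_algebra_simps)
  show "f \<oplus>\<^bsub>F\<^esub> g \<in> homogeneous k" if "f \<in> homogeneous k" "g \<in> homogeneous k"
    using that F.M.a_closed[of f g] unfolding homogeneous_def by (simp add: free_algebra_simps)
  show "c \<odot>\<^bsub>F\<^esub> f \<in> homogeneous k" if "c \<in> carrier R" "f \<in> homogeneous k"
    using that F.smult_closed[of c f] unfolding homogeneous_def by (simp add: free_algebra_simps)
qed

lemma U_Alt_weight_module: "module R (U_Alt_weight R A k)"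
proof -
  let ?C = "proj ` homogeneous k" and ?W = "U\<lparr>carrier := proj ` homogeneous k\<rparr>"
  have C: "?C \<subseteq> carrier U" using homogeneous_closed by (intro image_subsetI proj.hom_closed) blast
  have CU: "x \<in> carrier U" if "x \<in> ?C" for x using that C by blast
  have zero: "\<zero>\<^bsub>U\<^esub> \<in> ?C"
    using homogeneous_submodule(1)[of k] by (intro image_eqI[of _ _ "\<zero>\<^bsub>F\<^esub>"]) simp_all
  have add: "x \<oplus>\<^bsub>U\<^esub> y \<in> ?C" if xy: "x \<in> ?C" "y \<in> ?C" for x y
  proof -
    obtain f g where fg: "f \<in> homogeneous k" "g \<in> homogeneous k" "x = proj f" "y = proj g"
      using xy by blast
    then have "x \<oplus>\<^bsub>U\<^esub> y = proj (f \<oplus>\<^bsub>F\<^esub> g)" using homogeneous_closed by (simp add: subset_iff)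
    then show ?thesis using homogeneous_submodule(2)[OF fg(1,2)] by simp
  qed
  have smult: "c \<odot>\<^bsub>U\<^esub> x \<in> ?C" if cx: "c \<in> carrier R" "x \<in> ?C" for c x
  proof -
    obtain f where f: "f \<in> homogeneous k" "x = proj f" using cx(2) by blast
    then have "c \<odot>\<^bsub>U\<^esub> x = proj (c \<odot>\<^bsub>F\<^esub> f)" using homogeneous_closed cx(1) by (simp add: subset_iff)
    then show ?thesis using homogeneous_submodule(3)[OF cx(1) f(1)] by simp
  qed
  have ag: "abelian_group ?W"
  proof (rule abelian_groupI)
    fix x assume "x \<in> carrier ?W"
    then have x: "x \<in> ?C" by simp
    then have "(\<ominus> \<one>) \<odot>\<^bsub>U\<^esub> x \<in> ?C" by (intro smult) simp_all
    moreover have "(\<ominus> \<one>) \<odot>\<^bsub>U\<^esub> x = \<ominus>\<^bsub>U\<^esub> x" using CU[OF x] by (simp add: proj.B.smult_l_minus)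
    ultimately show "\<exists>y\<in>carrier ?W. y \<oplus>\<^bsub>?W\<^esub> x = \<zero>\<^bsub>?W\<^esub>"
      using proj.B.M.l_neg[OF CU[OF x]] by (intro bexI[of _ "\<ominus>\<^bsub>U\<^esub> x"]) simp_all
  next
    fix x y assume "x \<in> carrier ?W" "y \<in> carrier ?W"
    then show "x \<oplus>\<^bsub>?W\<^esub> y = y \<oplus>\<^bsub>?W\<^esub> x" using proj.B.M.a_comm CU by simp
  qed (simp_all add: zero add CU proj.B.M.a_assoc)
  show ?thesis
    unfolding U_Alt_weight_eq
    by (rule moduleI[OF cring_axioms ag])
      (simp_all add: smult CU proj.B.smult_l_distr proj.B.smult_r_distr proj.B.smult_assoc1)
qed

text \<open>
  A linear relation between the basis words in \<open>U\<close> lifts to an element of the kernel of the projection, and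
  the dual functional of the \<open>j\<close>-th basis word reads off its \<open>j\<close>-th coefficient.
\<close>

lemma ev_basis_words_independent:
  assumes h: "bij_betw h X (basis_words n k)" and fin: "finite X"
    and c: "c \<in> X \<rightarrow> carrier R" and d: "d \<in> X \<rightarrow> carrier R"
    and eq: "(\<Oplus>\<^bsub>U\<^esub>i\<in>X. c i \<odot>\<^bsub>U\<^esub> ev (h i)) = (\<Oplus>\<^bsub>U\<^esub>i\<in>X. d i \<odot>\<^bsub>U\<^esub> ev (h i))"
    and j: "j \<in> X"
  shows "c j = d j"
proof -
  let ?w = "\<lambda>i. word R (map vec (h i))"
  let ?f = "\<lambda>c. \<Oplus>\<^bsub>F\<^esub>i\<in>X. c i \<odot>\<^bsub>F\<^esub> ?w i"
  let ?\<chi> = "dual_functional k (h j)"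
  let ?\<phi> = "word_functional R (weight_functional n ?\<chi>)"
  note p = weight_functional_closed[of n ?\<chi>]
  have w: "?w i \<in> carrier F" for i by (intro word_closed_F map_vec_closed)
  have cw: "(\<lambda>i. b i \<odot>\<^bsub>F\<^esub> ?w i) \<in> X \<rightarrow> carrier F" if "b \<in> X \<rightarrow> carrier R" for b
    using that w by (auto simp: Pi_iff)
  have f: "?f b \<in> carrier F" if "b \<in> X \<rightarrow> carrier R" for b
    by (rule F.M.finsum_closed[OF cw[OF that]])
  have proj_f: "proj (?f b) = (\<Oplus>\<^bsub>U\<^esub>i\<in>X. b i \<odot>\<^bsub>U\<^esub> ev (h i))" if b: "b \<in> X \<rightarrow> carrier R" for b
    unfolding proj.hom_finsum[OF cw[OF b]] using b w
    by (intro proj.B.M.finsum_cong') (auto simp: ev_def Pi_iff)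
  have \<phi>_f: "?\<phi> (?f b) = b j" if b: "b \<in> X \<rightarrow> carrier R" for b
  proof -
    have bi: "b i \<in> carrier R" if "i \<in> X" for i using b that by auto
    have "?\<phi> (b i \<odot>\<^bsub>F\<^esub> ?w i) = (if j = i then b i else \<zero>)" if i: "i \<in> X" for i
    proof -
      have "h i \<in> basis_words n k" "h j \<in> basis_words n k" using h i j by (auto simp: bij_betw_def)
      moreover have "h j = h i \<longleftrightarrow> j = i" using h i j by (auto simp: bij_betw_def inj_on_def)
      ultimately have "?\<chi> (h i) = (if j = i then 1 else 0)"
        using dual_functional_basis_words by simp
      moreover have "snd ` set (h i) \<subseteq> {..<n}"
        using basis_words_letter_words \<open>h i \<in> _\<close> by (auto simp: letter_words_def)
      ultimately have "?\<phi> (?w i) = (if j = i then \<one> else \<zero>)"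
        using word_functional_word[where p = "weight_functional n ?\<chi>", OF map_vec_closed p]
          weight_functional_map_vec by simp
      then show ?thesis
        using word_functional_smult[where p = "weight_functional n ?\<chi>", OF w bi[OF i] p] bi[OF i] by simp
    qed
    then have "?\<phi> (?f b) = (\<Oplus>i\<in>X. if j = i then b i else \<zero>)"
      unfolding word_functional_finsum[where p = "weight_functional n ?\<chi>", OF cw[OF b] p]
      using bi by (intro finsum_cong') auto
    also have "\<dots> = b j" by (rule finsum_singleton[OF j fin b])
    finally show ?thesis .
  qed
  have "proj (?f c \<ominus>\<^bsub>F\<^esub> ?f d) = \<zero>\<^bsub>U\<^esub>"
    using proj.hom_minus[OF f[OF c] f[OF d]] proj_f[OF c] proj_f[OF d] eq
      proj.hom_closed[OF f[OF d]] by (simp add: a_minus_def proj.B.M.r_neg)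
  then have "?\<phi> (?f c \<ominus>\<^bsub>F\<^esub> ?f d) = \<zero>"
    by (rule weight_functional_kernel[OF respects_relations_dual_functional F.M.minus_closed[OF f[OF c] f[OF d]]])
  then have "c j \<ominus> d j = \<zero>"
    using word_functional_minus[where p = "weight_functional n ?\<chi>", OF f[OF c] f[OF d] p] \<phi>_f[OF c] \<phi>_f[OF d]
    by simp
  then show ?thesis by (rule minus_eq_zeroD) (use c d j in auto)
qed

lemma U_Alt_weight_free: "free_of_rank R (U_Alt_weight R A k) (card (basis_words n k))"
proof -
  let ?W = "U\<lparr>carrier := proj ` homogeneous k\<rparr>" and ?I = "{..<card (basis_words n k)}"
  interpret W: module R ?W using U_Alt_weight_module unfolding U_Alt_weight_eq .
  obtain h where h: "bij_betw h ?I (basis_words n k)"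
    using ex_bij_betw_nat_finite[OF finite_basis_words] unfolding atLeast0LessThan by blast
  let ?e = "\<lambda>i. ev (h i)"
  have e: "?e i \<in> proj ` homogeneous k" if "i \<in> ?I" for i
  proof -
    have "h i \<in> letter_words k"
      using bij_betwE[OF h] that basis_words_letter_words by blast
    then have "length (h i) = k" by (simp add: letter_words_def)
    then have "word R (map vec (h i)) \<in> homogeneous k"
      unfolding homogeneous_def using word_closed_F[OF map_vec_closed[of "h i"]] by (auto simp: word_def)
    then show ?thesis unfolding ev_def by (rule imageI)
  qed
  have C: "proj ` homogeneous k \<subseteq> carrier U"
    using homogeneous_closed by (intro image_subsetI proj.hom_closed) blast
  have sum: "(\<Oplus>\<^bsub>?W\<^esub>i\<in>?I. c i \<odot>\<^bsub>?W\<^esub> ?e i) = (\<Oplus>\<^bsub>U\<^esub>i\<in>?I. c i \<odot>\<^bsub>U\<^esub> ?e i)"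
    if c: "c \<in> ?I \<rightarrow> carrier R" for c
  proof -
    have "(\<lambda>i. c i \<odot>\<^bsub>U\<^esub> ?e i) \<in> ?I \<rightarrow> proj ` homogeneous k"
      using W.smult_closed c e by (auto simp: Pi_iff)
    then show ?thesis
      using finsum_carrier_update[OF proj.B.M.abelian_monoid_axioms W.M.abelian_monoid_axioms C] by simp
  qed
  have "\<exists>!c. c \<in> ?I \<rightarrow>\<^sub>E carrier R \<and> x = (\<Oplus>\<^bsub>?W\<^esub>i\<in>?I. c i \<odot>\<^bsub>?W\<^esub> ?e i)"
    if x: "x \<in> proj ` homogeneous k" for x
  proof -
    have "x \<in> lspan R U (ev ` basis_words n k)" using x proj_homogeneous_in_lspan by blast
    moreover have "?e ` ?I = ev ` basis_words n k"
      using bij_betw_imp_surj_on[OF h] image_image[of ev h ?I] by simp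
    ultimately have "x \<in> lspan R U (?e ` ?I)" by simp
    then have "\<exists>c\<in>?I \<rightarrow> carrier R. x = (\<Oplus>\<^bsub>U\<^esub>i\<in>?I. c i \<odot>\<^bsub>U\<^esub> ?e i)"
      by (rule proj.B.lspan_image_finsum) (simp_all add: ev_closed)
    then obtain c where c: "c \<in> ?I \<rightarrow> carrier R" "x = (\<Oplus>\<^bsub>U\<^esub>i\<in>?I. c i \<odot>\<^bsub>U\<^esub> ?e i)" by blast
    show ?thesis
    proof (rule ex1I[of _ "restrict c ?I"], intro conjI)
      show r: "restrict c ?I \<in> ?I \<rightarrow>\<^sub>E carrier R" using c(1) by auto
      have "x = (\<Oplus>\<^bsub>U\<^esub>i\<in>?I. restrict c ?I i \<odot>\<^bsub>U\<^esub> ?e i)"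
        unfolding c(2) using c(1)
        by (intro proj.B.M.finsum_cong') (auto simp: Pi_iff intro!: proj.B.smult_closed ev_closed)
      then show "x = (\<Oplus>\<^bsub>?W\<^esub>i\<in>?I. restrict c ?I i \<odot>\<^bsub>?W\<^esub> ?e i)"
        using sum[of "restrict c ?I"] c(1) by auto
    next
      fix d assume d: "d \<in> ?I \<rightarrow>\<^sub>E carrier R \<and> x = (\<Oplus>\<^bsub>?W\<^esub>i\<in>?I. d i \<odot>\<^bsub>?W\<^esub> ?e i)"
      then have d': "d \<in> ?I \<rightarrow> carrier R" by (simp add: PiE_iff)
      have eq: "(\<Oplus>\<^bsub>U\<^esub>i\<in>?I. d i \<odot>\<^bsub>U\<^esub> ?e i) = (\<Oplus>\<^bsub>U\<^esub>i\<in>?I. c i \<odot>\<^bsub>U\<^esub> ?e i)"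
        using d sum[OF d'] c(2) by metis
      have "d j = c j" if "j \<in> ?I" for j
        by (rule ev_basis_words_independent[OF h _ d' c(1) eq that]) simp
      then show "d = restrict c ?I"
        using d by (intro extensionalityI[of _ ?I]) (auto simp: PiE_iff)
    qed
  qed
  then have "is_basis R ?W ?I ?e" using e unfolding is_basis_def by simp
  then show ?thesis
    unfolding free_of_rank_def U_Alt_weight_eq using W.module_axioms by blast
qed

end

theorem theorem1p1:
  fixes K :: "('k, 'm) ring_scheme" and n k :: nat
  assumes "cring K"
  shows "free_of_rank K (U_Alt_weight K (abelian_algebra K n) k)
    (if k = 0 then 1
     else if k = 1 then 2 * n
     else if k = 2 then (3 * n ^ 2 - n) div 2
     else 2 * (n choose k))"
proof -
  interpret cring K by fact
  interpret abelian_envelope K n by unfold_locales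
  show ?thesis using U_Alt_weight_free unfolding card_basis_words .
qed

end
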